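(* Fix $0<k<n$ and consider two plane partitions $\beta$ and $\beta'$ of size $k\times(n-k)$. Then $$\overline{\mathcal C}_\beta\supseteq\overline{\mathcal C}_{\beta'}\quad\Rightarrow\quad\beta\trianglelefteq\beta'.$$ In particular, if $\alpha=\{\alpha_\lambda\}$ (resp. $\alpha'=\{\alpha'_\lambda\}$) is the contact profile of any arc in $\mathcal C_\beta$ (resp. of any arc in $\mathcal C_{\beta'}$), then $$\overline{\mathcal C}_\beta\supseteq\overline{\mathcal C}_{\beta'}\quad\Rightarrow\quad\alpha\le\alpha',$$ where $\alpha\le\alpha'$ means $\alpha_\lambda\le\alpha'_\lambda$ for all partitions $\lambda$ (with at most $k$ parts of size at most $n-k$).
   Context: Work over $\mathbb C$. $G(k,n)$: Grassmannian of $k$-dimensional subspaces of $\mathbb C^n$ (row spans of $k\times n$ matrices). $F_i\subset\mathbb C^n$: span of the last $i$ standard basis vectors. For a partition $\lambda=(\lambda_1\ge\dots\ge\lambda_k\ge0)$ with $\lambda_1\le n-k$, put $i_s=s+\lambda_{k+1-s}$ and $\Omega_\lambda=\{V\mid\dim V\cap F_{n+1-i_s}\ge k+1-s,\ 1\le s\le k\}$ (reduced). $(j^i)$ is the rectangular partition with $i$ rows and $j$ columns. $J_\infty G(k,n)$ is the arc space; points with residue field $K$ are arcs $\operatorname{Spec}K[[t]]\to G(k,n)$. $\operatorname{ord}_\Lambda(Y)=e$ means the ideal of $Y$ pulls back to $(t^e)$ ($t^\infty=0$). The contact profile of $\Lambda$ is the collection $\alpha_\lambda=\operatorname{ord}_\Lambda(\Omega_\lambda)$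 over all partitions $\lambda=(\lambda_1\ge\dots\ge\lambda_k\ge0)$ with $\lambda_1\le n-k$. Put $\alpha_{i,j}=\operatorname{ord}_\Lambda(\Omega_{(j^i)})$ for $1\le i\le k,1\le j\le n-k$ and $\alpha_{i,j}=0$ if $i>k$ or $j>n-k$. The invariant factor profile of $\Lambda$ is the matrix $\beta_{i,j}=\alpha_{i,j}-\alpha_{i+1,j+1}$ ($1\le i\le k,1\le j\le n-k$), with $\infty-x=\infty$. A plane partition is a $k\times(n-k)$ matrix with entries in $\{0,1,\ldots,\infty\}$ non-increasing along rows and columns. $\mathcal C_\beta\subset J_\infty G(k,n)$ is the set of arcs with invariant factor profile $\beta$ (it is non-empty and irreducible, and all its arcs have the same contact profile); $\overline{\mathcal C}_\beta$ is its Zariski closure in $J_\infty G(k,n)$. Network: $\Gamma_0$ is the directed graph with internal vertices $v_{i,j}$ ($1\le i\le k$, $1\le j\le n-k$), sources $1,\ldots,k$, sinks $1,\ldots,n-k$, and edges: source $i\to v_{i,n-k}$; $v_{i,j+1}\to v_{i,j}$; $v_{i,j}\to v_{i+1,j}$; $v_{k,j}\to$ sink $j$. A matrix $(w_{i,j})$ of size $k\times(n-k)$ gives an essential weighting $w$: $w_{i,j}$ is the weight of the edge $v_{i,j+1}\to v_{i,j}$ if $k-i<n-k-j$, of the edge $v_{i,j}\to v_{i+1,j}$ if $k-i>n-k-j$, and of the vertex $v_{i,j}$ if $k-i=n-k-j$; all other edges and vertices have weight $1$. The weight of a directed path is the product of the weights of its vertices and edges; $X(\Gamma_0,w)$ is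 the $k\times(n-k)$ matrix whose $(i,j)$ entry is the sum of the weights of all paths from source $i$ to sink $j$. $\Lambda(\Gamma_0,w)$ is the arc given by the $k\times n$ matrix $(X(\Gamma_0,w)\,|\,\Delta')$, with $\Delta'$ the $k\times k$ antidiagonal permutation matrix. The weight exponents of $\beta$ are $c_{i,j}=\beta_{i,j}$ if $k-i=n-k-j$; $c_{i,j}=\beta_{i,j}-\beta_{i,j+1}$ if $k-i<n-k-j$; $c_{i,j}=\beta_{i,j}-\beta_{i+1,j}$ if $k-i>n-k-j$ ($\infty-x=\infty$). Let $u_{i,j}=\sum_{p\ge0}u_{i,j}^{[p]}t^p$ with independent transcendentals $u_{i,j}^{[p]}$, and let $w(u,\beta)$ be the essential weighting with $w_{i,j}=t^{c_{i,j}}u_{i,j}$ ($t^\infty=0$); $\Lambda(\Gamma_0,w(u,\beta))$ is the generic point of $\mathcal C_\beta$. For $1\le i_1<\dots<i_k\le n$, $\operatorname{ord}_\beta([i_1\ldots i_k])$ is the $t$-order of the $k\times k$ minor of $(X(\Gamma_0,w(u,\beta))|\Delta')$ with columns $i_1,\ldots,i_k$ (a Plücker coordinate). The Plücker order: $\beta\trianglelefteq\beta'$ iff $\operatorname{ord}_\beta([i_1\ldots i_k])\le\operatorname{ord}_{\beta'}([i_1\ldots i_k])$ for all $1\le i_1<\dots<i_k\le n$. *)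

theory Defs
  imports
    "Jordan_Normal_Form.VS_Connect"
    "Jordan_Normal_Form.DL_Submatrix"
    "HOL-Algebra.Algebraic_Closure_Type"
    "HOL-Computational_Algebra.Formal_Power_Series"
    "HOL-Computational_Algebra.Fraction_Field"
    "HOL-Library.Poly_Mapping"
    "HOL-Library.Extended_Nat"
begin

section \<open>Complex polynomials and a universal domain\<close>

text \<open>Polynomials over the complex numbers in variables indexed by \<open>'v\<close>: finitely supported
  maps from monomials (finitely supported exponent vectors) to coefficients.\<close>
type_synonym 'v cpoly = "('v \<Rightarrow>\<^sub>0 nat) \<Rightarrow>\<^sub>0 complex"

definition cpolys :: "'v set \<Rightarrow> 'v cpoly set" where
  "cpolys V = {f. \<forall>m \<in> Poly_Mapping.keys f. Poly_Mapping.keys m \<subseteq> V}"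

definition eval_cpoly :: "(complex \<Rightarrow> 'r) \<Rightarrow> ('v \<Rightarrow> 'r) \<Rightarrow> 'v cpoly \<Rightarrow> 'r::comm_ring_1" where
  "eval_cpoly h x f = (\<Sum>m \<in> Poly_Mapping.keys f.
     h (Poly_Mapping.lookup f m) * (\<Prod>v \<in> Poly_Mapping.keys m. x v ^ Poly_Mapping.lookup m v))"

text \<open>The residue field of every point of the arc space of a Grassmannian is generated by countably
  many elements over the complex numbers, hence embeds over them into the algebraic closure
  of the field of rational functions in countably many variables. A single field of values is
  therefore enough: every scheme point of the arc space is represented by an arc over this field.
  Arcs representing the same point satisfy the same polynomial equations with complex
  coefficients, and have the same contact orders. Arcs over this field thus map onto the arc space,
  and the Zariski closed sets, the sets of arcs with given profile, and the inclusions between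
  the closures of such sets are the same upstairs and downstairs.\<close>
type_synonym udom = "(nat cpoly) fract alg_closure"

definition udom_const :: "complex \<Rightarrow> udom" where
  "udom_const c = to_ac (Fract (Poly_Mapping.single 0 c) 1)"

definition udom_var :: "nat \<Rightarrow> udom" where
  "udom_var m = to_ac (Fract (Poly_Mapping.single (Poly_Mapping.single m 1) 1) 1)"


section \<open>Grassmannians\<close>

text \<open>Rows and columns of matrices are numbered from \<open>0\<close>. A set \<open>I \<in> col_sets k n\<close> is the
  index \<open>{i\<^sub>1 - 1, \<dots>, i\<^sub>k - 1}\<close> of the Pluecker coordinate \<open>[i\<^sub>1 \<dots> i\<^sub>k]\<close>.\<close>
definition col_sets :: "nat \<Rightarrow> nat \<Rightarrow> nat set set" where
  "col_sets k n = {I. I \<subseteq> {..<n} \<and> card I = k}"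

definition row_span :: "'a::comm_ring_1 mat \<Rightarrow> 'a vec set" where
  "row_span A = {A\<^sup>T *\<^sub>v x | x. x \<in> carrier_vec (dim_row A)}"

text \<open>For a local ring \<open>'a\<close> these are the morphisms from the spectrum of \<open>'a\<close> to \<open>G(k,n)\<close>. It is used
  for the complex numbers (the \<open>k\<close>-dimensional subspaces) and for power series over a field
  (the arcs).\<close>
definition grassmannian :: "nat \<Rightarrow> nat \<Rightarrow> 'a::comm_ring_1 vec set set" where
  "grassmannian k n =
     {row_span A | A. A \<in> carrier_mat k n \<and> (\<exists>I \<in> col_sets k n. det (submatrix A UNIV I) dvd 1)}"

text \<open>The standard affine chart where the Pluecker coordinate \<open>I\<close> is invertible. Its coordinates
  are the entries, outside the columns \<open>I\<close>, of the unique matrix that spans the point and restricts to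
  the identity matrix on the columns \<open>I\<close>.\<close>
definition chart :: "nat \<Rightarrow> nat \<Rightarrow> nat set \<Rightarrow> 'a::comm_ring_1 vec set set" where
  "chart k n I = {row_span A | A. A \<in> carrier_mat k n \<and> submatrix A UNIV I = 1\<^sub>m k}"

definition chart_mat :: "nat \<Rightarrow> nat \<Rightarrow> nat set \<Rightarrow> 'a::comm_ring_1 vec set \<Rightarrow> 'a mat" where
  "chart_mat k n I L =
     (THE A. A \<in> carrier_mat k n \<and> submatrix A UNIV I = 1\<^sub>m k \<and> row_span A = L)"

definition chart_vars :: "nat \<Rightarrow> nat \<Rightarrow> nat set \<Rightarrow> (nat \<times> nat) set" where
  "chart_vars k n I = {..<k} \<times> ({..<n} - I)"

definition chart_coord :: "nat \<Rightarrow> nat \<Rightarrow> nat set \<Rightarrow> 'a::comm_ring_1 vec set \<Rightarrow> nat \<times> nat \<Rightarrow> 'a" where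
  "chart_coord k n I L = (\<lambda>v. chart_mat k n I L $$ v)"

text \<open>The ideal, on a chart, of the reduced closed subscheme with set of complex points \<open>Y\<close>.\<close>
definition chart_ideal :: "nat \<Rightarrow> nat \<Rightarrow> nat set \<Rightarrow> complex vec set set \<Rightarrow> (nat \<times> nat) cpoly set" where
  "chart_ideal k n I Y = {f \<in> cpolys (chart_vars k n I).
     \<forall>V \<in> Y \<inter> chart k n I. eval_cpoly id (chart_coord k n I V) f = 0}"


section \<open>Schubert varieties\<close>

text \<open>Partitions and profiles are numbered from \<open>1\<close>, and only their values in the range
  \<open>1 \<le> i \<le> k\<close>, \<open>1 \<le> j \<le> n - k\<close> matter.\<close>
definition is_partition :: "nat \<Rightarrow> nat \<Rightarrow> (nat \<Rightarrow> nat) \<Rightarrow> bool" where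
  "is_partition k n lam \<longleftrightarrow> (\<forall>r \<in> {1..<k}. lam (r + 1) \<le> lam r) \<and> lam 1 \<le> n - k"

definition rectangle :: "nat \<Rightarrow> nat \<Rightarrow> nat \<Rightarrow> nat" where
  "rectangle i j r = (if r \<le> i then j else 0)"

definition flag :: "nat \<Rightarrow> nat \<Rightarrow> complex vec set" where
  "flag n i = LinearCombinations.module.span class_ring (module_vec TYPE(complex) n)
     (unit_vec n ` {n - i..<n})"

definition subspace_dim :: "nat \<Rightarrow> complex vec set \<Rightarrow> nat" where
  "subspace_dim n W = vectorspace.dim class_ring ((module_vec TYPE(complex) n)\<lparr>carrier := W\<rparr>)"

definition schubert :: "nat \<Rightarrow> nat \<Rightarrow> (nat \<Rightarrow> nat) \<Rightarrow> complex vec set set" where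
  "schubert k n lam = {V \<in> grassmannian k n. \<forall>s \<in> {1..k}.
     let i\<^sub>s = s + lam (k + 1 - s) in subspace_dim n (V \<inter> flag n (n + 1 - i\<^sub>s)) \<ge> k + 1 - s}"


section \<open>Arcs\<close>

type_synonym arc = "udom fps vec set"

definition arcs :: "nat \<Rightarrow> nat \<Rightarrow> arc set" where
  "arcs k n = grassmannian k n"

text \<open>The arcs through a chart form an infinite dimensional affine space, with coordinates the
  coefficients of the power series given by the chart coordinates. These affine spaces are an open
  cover of the arc space.\<close>
definition arc_vars :: "nat \<Rightarrow> nat \<Rightarrow> nat set \<Rightarrow> (nat \<times> nat \<times> nat) set" where
  "arc_vars k n I = {(i, j, p). (i, j) \<in> chart_vars k n I}"

definition arc_coord :: "nat \<Rightarrow> nat \<Rightarrow> nat set \<Rightarrow> arc \<Rightarrow> nat \<times> nat \<times> nat \<Rightarrow> udom" where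
  "arc_coord k n I \<Lambda> = (\<lambda>(i, j, p). fps_nth (chart_coord k n I \<Lambda> (i, j)) p)"

definition zariski_closed :: "nat \<Rightarrow> nat \<Rightarrow> arc set \<Rightarrow> bool" where
  "zariski_closed k n Z \<longleftrightarrow> Z \<subseteq> arcs k n \<and>
     (\<forall>I \<in> col_sets k n. \<exists>S \<subseteq> cpolys (arc_vars k n I).
        Z \<inter> chart k n I =
          {\<Lambda> \<in> arcs k n \<inter> chart k n I. \<forall>f \<in> S. eval_cpoly udom_const (arc_coord k n I \<Lambda>) f = 0})"

definition zariski_closure :: "nat \<Rightarrow> nat \<Rightarrow> arc set \<Rightarrow> arc set" where
  "zariski_closure k n Z = zariski_closed k n hull Z"

definition t_power :: "enat \<Rightarrow> 'a::comm_ring_1 fps" where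
  "t_power e = (case e of enat d \<Rightarrow> fps_X ^ d | \<infinity> \<Rightarrow> 0)"

definition t_order :: "'a::comm_ring_1 fps \<Rightarrow> enat" where
  "t_order f = (if f = 0 then \<infinity> else enat (subdegree f))"

text \<open>The ideal of power series generated by the pullbacks along \<open>\<Lambda>\<close> of the functions that vanish
  on \<open>Y\<close>. All charts that contain \<open>\<Lambda>\<close> generate the same ideal.\<close>
definition pullback_ideal :: "nat \<Rightarrow> nat \<Rightarrow> arc \<Rightarrow> complex vec set set \<Rightarrow> udom fps set" where
  "pullback_ideal k n \<Lambda> Y = Modules.module.span (*)
     (\<Union>I \<in> {I \<in> col_sets k n. \<Lambda> \<in> chart k n I}.
        eval_cpoly (\<lambda>c. fps_const (udom_const c)) (chart_coord k n I \<Lambda>) ` chart_ideal k n I Y)"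

definition contact_order :: "nat \<Rightarrow> nat \<Rightarrow> arc \<Rightarrow> complex vec set set \<Rightarrow> enat" where
  "contact_order k n \<Lambda> Y = (THE e. pullback_ideal k n \<Lambda> Y = {g. t_power e dvd g})"

definition contact_profile :: "nat \<Rightarrow> nat \<Rightarrow> arc \<Rightarrow> (nat \<Rightarrow> nat) \<Rightarrow> enat" where
  "contact_profile k n \<Lambda> lam = contact_order k n \<Lambda> (schubert k n lam)"

definition rect_order :: "nat \<Rightarrow> nat \<Rightarrow> arc \<Rightarrow> nat \<Rightarrow> nat \<Rightarrow> enat" where
  "rect_order k n \<Lambda> i j =
     (if i > k \<or> j > n - k then 0 else contact_profile k n \<Lambda> (rectangle i j))"

text \<open>Subtraction of extended naturals satisfies \<open>\<infinity> - x = \<infinity>\<close> and is truncated at \<open>0\<close>.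
  Truncation never occurs: the Schubert variety of a smaller rectangle is larger, so its
  contact order is at least as large.\<close>
definition invariant_factor_profile :: "nat \<Rightarrow> nat \<Rightarrow> arc \<Rightarrow> nat \<Rightarrow> nat \<Rightarrow> enat" where
  "invariant_factor_profile k n \<Lambda> i j = rect_order k n \<Lambda> i j - rect_order k n \<Lambda> (i + 1) (j + 1)"

definition plane_partition :: "nat \<Rightarrow> nat \<Rightarrow> (nat \<Rightarrow> nat \<Rightarrow> enat) \<Rightarrow> bool" where
  "plane_partition k n \<beta> \<longleftrightarrow>
     (\<forall>i \<in> {1..<k}. \<forall>j \<in> {1..n - k}. \<beta> (i + 1) j \<le> \<beta> i j) \<and>
     (\<forall>i \<in> {1..k}. \<forall>j \<in> {1..<n - k}. \<beta> i (j + 1) \<le> \<beta> i j)"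

definition contact_stratum :: "nat \<Rightarrow> nat \<Rightarrow> (nat \<Rightarrow> nat \<Rightarrow> enat) \<Rightarrow> arc set" where
  "contact_stratum k n \<beta> = {\<Lambda> \<in> arcs k n.
     \<forall>i \<in> {1..k}. \<forall>j \<in> {1..n - k}. invariant_factor_profile k n \<Lambda> i j = \<beta> i j}"


section \<open>The planar network\<close>

datatype net_vertex = Source nat | Internal nat nat | Sink nat

inductive net_edge :: "nat \<Rightarrow> nat \<Rightarrow> net_vertex \<Rightarrow> net_vertex \<Rightarrow> bool" for k n where
  "i \<in> {1..k} \<Longrightarrow> net_edge k n (Source i) (Internal i (n - k))"
| "i \<in> {1..k} \<Longrightarrow> j \<in> {1..<n - k} \<Longrightarrow> net_edge k n (Internal i (j + 1)) (Internal i j)"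
| "i \<in> {1..<k} \<Longrightarrow> j \<in> {1..n - k} \<Longrightarrow> net_edge k n (Internal i j) (Internal (i + 1) j)"
| "j \<in> {1..n - k} \<Longrightarrow> net_edge k n (Internal k j) (Sink j)"

definition net_paths :: "nat \<Rightarrow> nat \<Rightarrow> net_vertex \<Rightarrow> net_vertex \<Rightarrow> net_vertex list set" where
  "net_paths k n a b = {xs. xs \<noteq> [] \<and> hd xs = a \<and> last xs = b \<and> successively (net_edge k n) xs}"

fun vertex_weight :: "nat \<Rightarrow> nat \<Rightarrow> (nat \<Rightarrow> nat \<Rightarrow> 'r::comm_ring_1) \<Rightarrow> net_vertex \<Rightarrow> 'r" where
  "vertex_weight k n w (Internal i j) = (if k - i = n - k - j then w i j else 1)"
| "vertex_weight k n w _ = 1"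

fun edge_weight ::
  "nat \<Rightarrow> nat \<Rightarrow> (nat \<Rightarrow> nat \<Rightarrow> 'r::comm_ring_1) \<Rightarrow> net_vertex \<times> net_vertex \<Rightarrow> 'r" where
  "edge_weight k n w (Internal i j, Internal i' j') =
     (if i' = i \<and> j = j' + 1 \<and> k - i < n - k - j' then w i j'
      else if i' = i + 1 \<and> j' = j \<and> k - i > n - k - j then w i j
      else 1)"
| "edge_weight k n w _ = 1"

definition path_weight ::
  "nat \<Rightarrow> nat \<Rightarrow> (nat \<Rightarrow> nat \<Rightarrow> 'r::comm_ring_1) \<Rightarrow> net_vertex list \<Rightarrow> 'r" where
  "path_weight k n w xs =
     prod_list (map (vertex_weight k n w) xs) * prod_list (map (edge_weight k n w) (zip xs (tl xs)))"

definition net_matrix :: "nat \<Rightarrow> nat \<Rightarrow> (nat \<Rightarrow> nat \<Rightarrow> 'r::comm_ring_1) \<Rightarrow> 'r mat" where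
  "net_matrix k n w = mat k (n - k)
     (\<lambda>(a, b). \<Sum>xs \<in> net_paths k n (Source (a + 1)) (Sink (b + 1)). path_weight k n w xs)"

definition antidiag :: "nat \<Rightarrow> 'r::comm_ring_1 mat" where
  "antidiag k = mat k k (\<lambda>(a, b). if a + b + 1 = k then 1 else 0)"

definition net_arc_matrix :: "nat \<Rightarrow> nat \<Rightarrow> (nat \<Rightarrow> nat \<Rightarrow> 'r::comm_ring_1) \<Rightarrow> 'r mat" where
  "net_arc_matrix k n w = mat k n
     (\<lambda>(a, b). if b < n - k then net_matrix k n w $$ (a, b) else antidiag k $$ (a, b - (n - k)))"


section \<open>The Pluecker order\<close>

definition weight_exponent :: "nat \<Rightarrow> nat \<Rightarrow> (nat \<Rightarrow> nat \<Rightarrow> enat) \<Rightarrow> nat \<Rightarrow> nat \<Rightarrow> enat" where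
  "weight_exponent k n \<beta> i j =
     (if k - i = n - k - j then \<beta> i j
      else if k - i < n - k - j then \<beta> i j - \<beta> i (j + 1)
      else \<beta> i j - \<beta> (i + 1) j)"

text \<open>The pairing function makes the coefficients of the series \<open>u\<^sub>i\<^sub>j\<close> pairwise distinct variables.\<close>
definition generic_series :: "nat \<Rightarrow> nat \<Rightarrow> udom fps" where
  "generic_series i j = Abs_fps (\<lambda>p. udom_var (prod_encode (i, prod_encode (j, p))))"

definition generic_weight :: "nat \<Rightarrow> nat \<Rightarrow> (nat \<Rightarrow> nat \<Rightarrow> enat) \<Rightarrow> nat \<Rightarrow> nat \<Rightarrow> udom fps" where
  "generic_weight k n \<beta> i j = t_power (weight_exponent k n \<beta> i j) * generic_series i j"

definition pluecker_order :: "nat \<Rightarrow> nat \<Rightarrow> (nat \<Rightarrow> nat \<Rightarrow> enat) \<Rightarrow> nat set \<Rightarrow> enat" where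
  "pluecker_order k n \<beta> I =
     t_order (det (submatrix (net_arc_matrix k n (generic_weight k n \<beta>)) UNIV I))"

definition pluecker_le :: "nat \<Rightarrow> nat \<Rightarrow> (nat \<Rightarrow> nat \<Rightarrow> enat) \<Rightarrow> (nat \<Rightarrow> nat \<Rightarrow> enat) \<Rightarrow> bool" where
  "pluecker_le k n \<beta> \<beta>' \<longleftrightarrow>
     (\<forall>I \<in> col_sets k n. pluecker_order k n \<beta> I \<le> pluecker_order k n \<beta>' I)"

end

theory Submission
  imports Defs "Jordan_Normal_Form.Determinant" "Jordan_Normal_Form.Ring_Hom_Matrix" "Jordan_Normal_Form.DL_Rank"
begin

text \<open>Everything is read off from the orders of the maximal minors (Pluecker coordinates) of an arc.
  The arcs on which given minors have at least given orders form a Zariski closed set. So both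
  claims follow once the contact orders are known to be minima of orders of minors, and the
  minors of every arc in a stratum to have at least the orders of the corresponding minors of the
  generic network arc, which itself lies in the stratum.

  Modulo a power of \<open>t\<close>, the matrix of an arc is \<open>g N u\<close>, with \<open>N\<close> the matrix of a network and
  \<open>u\<close> upper triangular: perturb the arc so that no minor vanishes, and add generic multiples of
  columns to later ones, which only lowers orders, until the orders decrease to the right. The
  quotients of corner minors then provide the network. The orders of its weights are determined by
  the orders of the families of minors that define Schubert varieties.

  If a polynomial vanishes on a Schubert variety, its pullback to the entries of \<open>g\<close>, \<open>N\<close> and \<open>u\<close>
  vanishes with the minors of \<open>N\<close> that define the variety. These are affine in each network weight,
  so every monomial of the pullback is divisible, in the network weights, by a monomial of one of
  these minors. Hence its order is at least the minimum of the orders of the minors.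

  For the comparison with the generic network, rescaling turns \<open>N\<close> into a network with
  essential weights divisible by those of the generic one. It is a specialization of the generic
  network, and specialization can only raise orders.\<close>

section \<open>Determinants of families of columns\<close>

text \<open>The weights of the network are quotients of minors, while an arc may have vanishing
  minors and \<beta> infinite entries. So the network is found only modulo \<open>t^N\<close> for
  arbitrary \<open>N\<close>, comparisons of orders carry a \<open>min\<close> with
  \<open>N\<close>, and where \<beta> is infinite the weights are cut to 0 afterwards. The factor
  \<open>u\<close> is kept upper triangular because a Schubert variety is given by families of
  minors with at least \<open>i\<close> columns before some bound: replacing a column by an earlier
  one never leaves such a family. So the order of a family survives, up to the precision, though
  orders of single minors may drop. Corner minors have the smallest order in these families. The
  quotient of diagonally adjacent ones is, up to sign, a product of weights at the start of a row.
  This yields the weights and ties their orders to \<beta>; the exchange relation of determinants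
  makes the orders monotone. No generators of the ideal of a Schubert variety are needed beforehand:
  vanishing at complex points is enough for the argument with monomials.\<close>

definition cdet :: "nat \<Rightarrow> (nat \<Rightarrow> nat \<Rightarrow> 'a) \<Rightarrow> 'a::comm_ring_1" where
  "cdet k x = det (mat k k (\<lambda>(r, l). x l r))"

lemma cdet_cong:
  assumes "\<And>l r. l < k \<Longrightarrow> r < k \<Longrightarrow> x l r = y l r"
  shows "cdet k x = cdet k y"
  unfolding cdet_def by (rule arg_cong[of _ _ det], rule eq_matI) (auto simp: assms)

lemma cdet_expand:
  "cdet k x = (\<Sum>p | p permutes {0..<k}. signof p * (\<Prod>j<k. x j (p j)))"
  unfolding cdet_def
proof (subst det_col[of _ k])
  show "(\<Sum>p | p permutes {0..<k}. signof p * (\<Prod>j<k. mat k k (\<lambda>(r, l). x l r) $$ (p j, j))) =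
     (\<Sum>p | p permutes {0..<k}. signof p * (\<Prod>j<k. x j (p j)))"
  proof (intro sum.cong refl, goal_cases)
    case (1 p)
    then have "p permutes {0..<k}" by simp
    then have "\<And>j. j < k \<Longrightarrow> p j < k" using permutes_in_image by fastforce
    then show ?case by (intro arg_cong2[where f="(*)"] prod.cong refl) auto
  qed
qed auto

lemma cdet_sum:
  assumes l: "l < k" and x: "\<And>r. r < k \<Longrightarrow> x l r = (\<Sum>c\<in>C. a c * y c r)"
  shows "cdet k x = (\<Sum>c\<in>C. a c * cdet k (x(l := y c)))"
proof -
  let ?L = "{..<k} - {l}"
  have split: "(\<Prod>j<k. z j) = z l * (\<Prod>j\<in>?L. z j)" for z :: "nat \<Rightarrow> 'a"
    using l by (simp add: prod.remove)
  have "cdet k x = (\<Sum>p | p permutes {0..<k}. signof p * ((\<Sum>c\<in>C. a c * y c (p l)) * (\<Prod>j\<in>?L. x j (p j))))"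
    unfolding cdet_expand
  proof (intro sum.cong refl, goal_cases)
    case (1 p)
    then have "p permutes {0..<k}" by simp
    then have "p l < k" using permutes_in_image l by fastforce
    then show ?case unfolding split by (simp add: x)
  qed
  also have "\<dots> = (\<Sum>p | p permutes {0..<k}. \<Sum>c\<in>C. a c * (signof p * (\<Prod>j<k. (x(l := y c)) j (p j))))"
    unfolding split by (intro sum.cong refl) (auto simp: sum_distrib_left sum_distrib_right mult_ac)
  also have "\<dots> = (\<Sum>c\<in>C. a c * cdet k (x(l := y c)))"
    unfolding cdet_expand by (subst sum.swap) (simp add: sum_distrib_left)
  finally show ?thesis .
qed

lemma cdet_add:
  assumes "l < k" "\<And>r. r < k \<Longrightarrow> x l r = y r + a * z r"
  shows "cdet k x = cdet k (x(l := y)) + a * cdet k (x(l := z))"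
proof -
  have "cdet k x = (\<Sum>c\<in>UNIV. (if c then 1 else a) * cdet k (x(l := if c then y else z)))"
    by (rule cdet_sum[OF assms(1)]) (simp add: assms(2) UNIV_bool)
  then show ?thesis by (simp add: UNIV_bool)
qed

lemma cdet_eq_columns:
  assumes "i < k" "j < k" "i \<noteq> j" "\<And>r. r < k \<Longrightarrow> x i r = x j r"
  shows "cdet k x = 0"
  unfolding cdet_def
  by (rule det_identical_columns[of _ k i j]) (use assms in \<open>auto intro!: eq_vecI\<close>)

lemma cdet_permute:
  assumes "p permutes {0..<k}"
  shows "cdet k (\<lambda>l. x (p l)) = signof p * cdet k x"
proof -
  have lt: "\<And>l. l < k \<Longrightarrow> p l < k" using assms permutes_in_image by fastforce
  have "cdet k (\<lambda>l. x (p l)) = det (mat k k (\<lambda>(i, j). x (p i) j))"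
    unfolding cdet_def by (subst det_transpose[of _ k, symmetric]) (auto intro!: arg_cong[of _ _ det])
  also have "\<dots> = det (mat k k (\<lambda>(i, j). mat k k (\<lambda>(i, j). x i j) $$ (p i, j)))"
    by (rule arg_cong[of _ _ det], rule eq_matI) (auto simp: lt)
  also have "\<dots> = signof p * det (mat k k (\<lambda>(i, j). x i j))"
    by (rule det_permute_rows[OF _ assms]) auto
  also have "det (mat k k (\<lambda>(i, j). x i j)) = cdet k x"
    unfolding cdet_def by (subst det_transpose[of _ k, symmetric]) (auto intro!: arg_cong[of _ _ det])
  finally show ?thesis .
qed

lemma cdet_mult:
  "cdet k (\<lambda>l r. \<Sum>s<k. g $$ (r, s) * x l s) = det g * cdet k x" if "g \<in> carrier_mat k k"
proof -
  have "det g * cdet k x = det (g * mat k k (\<lambda>(r, l). x l r))"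
    unfolding cdet_def by (rule det_mult[symmetric, of _ k]) (use that in auto)
  also have "g * mat k k (\<lambda>(r, l). x l r) = mat k k (\<lambda>(r, l). \<Sum>s<k. g $$ (r, s) * x l s)"
    using that by (intro eq_matI) (auto simp: scalar_prod_def lessThan_atLeast0 intro!: sum.cong)
  finally show ?thesis unfolding cdet_def by simp
qed

lemma cdet_identity: "cdet k (\<lambda>l r. if l = r then 1 else 0) = (1 :: 'a::comm_ring_1)"
proof -
  have "mat k k (\<lambda>(r, l). if l = r then 1 else 0) = (1\<^sub>m k :: 'a mat)" by (rule eq_matI) auto
  then show ?thesis unfolding cdet_def using det_one[of k, where ?'a='a] by metis
qed

lemma cdet_dvd_span:
  assumes "finite T" "T \<subseteq> {..<k}"
    and "\<And>l. l \<in> T \<Longrightarrow> \<exists>a. \<forall>r<k. x l r = (\<Sum>c\<in>C l. a c * y c r)"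
    and "\<And>g. (\<And>l. l \<in> T \<Longrightarrow> g l \<in> C l) \<Longrightarrow> e dvd cdet k (\<lambda>l. if l \<in> T then y (g l) else x l)"
  shows "e dvd cdet k x"
  using assms
proof (induction T arbitrary: x rule: finite_induct)
  case empty
  then show ?case by simp
next
  case (insert t T)
  obtain a where a: "\<And>r. r < k \<Longrightarrow> x t r = (\<Sum>c\<in>C t. a c * y c r)"
    using insert.prems(2)[of t] by auto
  have t: "t < k" using insert.prems(1) by auto
  have "e dvd cdet k (x(t := y c))" if c: "c \<in> C t" for c
  proof (rule insert.IH)
    fix l assume "l \<in> T"
    then have "l \<noteq> t" using insert.hyps by auto
    then show "\<exists>a. \<forall>r<k. (x(t := y c)) l r = (\<Sum>c\<in>C l. a c * y c r)"
      using insert.prems(2)[of l] \<open>l \<in> T\<close> by auto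
  next
    fix g assume g: "\<And>l. l \<in> T \<Longrightarrow> g l \<in> C l"
    have "e dvd cdet k (\<lambda>l. if l \<in> insert t T then y ((g(t := c)) l) else x l)"
      by (rule insert.prems(3)) (use g c in auto)
    also have "(\<lambda>l. if l \<in> insert t T then y ((g(t := c)) l) else x l) =
        (\<lambda>l. if l \<in> T then y (g l) else (x(t := y c)) l)"
      using insert.hyps by auto
    finally show "e dvd cdet k (\<lambda>l. if l \<in> T then y (g l) else (x(t := y c)) l)" .
  qed (use insert.prems(1) in auto)
  moreover have "cdet k x = (\<Sum>c\<in>C t. a c * cdet k (x(t := y c)))"
    by (rule cdet_sum[OF t]) (rule a)
  ultimately show ?case by (auto intro!: dvd_sum)
qed

lemma cdet_dvd_prod:
  assumes "T \<subseteq> {..<k}" "\<And>l r. l \<in> T \<Longrightarrow> r < k \<Longrightarrow> e l dvd x l r"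
  shows "prod e T dvd cdet k x"
  unfolding cdet_expand
proof (rule dvd_sum)
  fix p assume "p \<in> {p. p permutes {0..<k}}"
  then have "p permutes {0..<k}" by simp
  then have lt: "\<And>l. l < k \<Longrightarrow> p l < k" using permutes_in_image by fastforce
  have "prod e T dvd (\<Prod>j\<in>T. x j (p j))"
    by (rule prod_dvd_prod) (use assms lt in auto)
  also have "\<dots> dvd (\<Prod>j<k. x j (p j))"
    by (rule prod_dvd_prod_subset) (use assms in auto)
  finally show "prod e T dvd signof p * (\<Prod>j<k. x j (p j))" by simp
qed

lemma dvd_prod_diff:
  fixes f g :: "'b \<Rightarrow> 'a::comm_ring_1"
  assumes "\<And>i. i \<in> T \<Longrightarrow> e dvd f i - g i"
  shows "e dvd prod f T - prod g T"
  using assms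
proof (induction T rule: infinite_finite_induct)
  case (insert t T)
  have "prod f (insert t T) - prod g (insert t T) = (f t - g t) * prod f T + g t * (prod f T - prod g T)"
    using insert.hyps by (simp add: algebra_simps)
  then show ?case using insert by (auto intro!: dvd_add)
qed auto

lemma cdet_dvd_diff:
  assumes "\<And>l r. l < k \<Longrightarrow> r < k \<Longrightarrow> e dvd x l r - y l r"
  shows "e dvd cdet k x - cdet k y"
  unfolding cdet_expand sum_subtractf[symmetric] right_diff_distrib[symmetric]
proof (rule dvd_sum)
  fix p assume "p \<in> {p. p permutes {0..<k}}"
  then have "p permutes {0..<k}" by simp
  then have lt: "\<And>l. l < k \<Longrightarrow> p l < k" using permutes_in_image by fastforce
  have "e dvd (\<Prod>j<k. x j (p j)) - (\<Prod>j<k. y j (p j))"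
    by (rule dvd_prod_diff) (use assms lt in auto)
  then show "e dvd signof p * ((\<Prod>j<k. x j (p j)) - (\<Prod>j<k. y j (p j)))" by simp
qed

lemma cdet_hom:
  assumes "comm_ring_hom h"
  shows "cdet k (\<lambda>l r. h (x l r)) = h (cdet k x)"
proof -
  interpret comm_ring_hom h by fact
  have "map_mat h (mat k k (\<lambda>(r, l). x l r)) = mat k k (\<lambda>(r, l). h (x l r))"
    by (rule eq_matI) auto
  then show ?thesis unfolding cdet_def by (metis hom_det)
qed

section \<open>Cramer's rule and the exchange relation\<close>

lemma cdet_cramer:
  fixes x :: "nat \<Rightarrow> nat \<Rightarrow> 'a::idom"
  assumes r: "r < k" and nz: "cdet k x \<noteq> 0"
  shows "cdet k x * v r = (\<Sum>i<k. cdet k (x(i := v)) * x i r)"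
proof -
  define M where "M = mat k k (\<lambda>(r, l). x l r)"
  have M: "M \<in> carrier_mat k k" unfolding M_def by simp
  have dM: "det M = cdet k x" unfolding M_def cdet_def ..
  define z where "z = adj_mat M *\<^sub>v vec k v"
  have z: "z \<in> carrier_vec k" unfolding z_def using adj_mat[OF M] by auto
  have Mz: "M *\<^sub>v z = det M \<cdot>\<^sub>v vec k v"
  proof -
    have "M *\<^sub>v z = (M * adj_mat M) *\<^sub>v vec k v"
      unfolding z_def using M adj_mat(1)[OF M] by (metis assoc_mult_mat_vec vec_carrier)
    also have "\<dots> = det M \<cdot>\<^sub>v vec k v" unfolding adj_mat(2)[OF M]
      by (intro eq_vecI) (auto simp: scalar_prod_def if_distrib[of "\<lambda>z. det M * z * _"] if_distrib[of "\<lambda>z. z * _"] cong: if_cong)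
    finally show ?thesis .
  qed
  \<comment> \<open>Cramer's rule determines \<open>z $ i * det M\<close>; the replaced column
    carries the factor \<open>det M\<close> once more, and it cancels in a domain.\<close>
  have zi: "z $ i = cdet k (x(i := v))" if i: "i < k" for i
  proof -
    have "z $ i * det M = det (replace_col M (det M \<cdot>\<^sub>v vec k v) i)"
      using cramer_lemma_mat[OF M z i] Mz by simp
    also have "replace_col M (det M \<cdot>\<^sub>v vec k v) i = mat k k (\<lambda>(r, l). (x(i := (\<lambda>r. det M * v r))) l r)"
      unfolding replace_col_def M_def by (rule eq_matI) (auto simp: i)
    also have "det \<dots> = cdet k (x(i := (\<lambda>r. det M * v r)))" unfolding cdet_def ..
    also have "\<dots> = det M * cdet k (x(i := v))"
      by (subst cdet_sum[OF i, where C="{()}" and a="\<lambda>_. det M" and y="\<lambda>_. v"]) auto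
    finally show ?thesis using nz dM by simp
  qed
  have "cdet k x * v r = (M *\<^sub>v z) $ r" unfolding Mz using r dM by simp
  also have "\<dots> = (\<Sum>i<k. x i r * z $ i)"
    using r z by (auto simp: M_def scalar_prod_def lessThan_atLeast0 intro!: sum.cong)
  also have "\<dots> = (\<Sum>i<k. cdet k (x(i := v)) * x i r)"
    by (intro sum.cong refl) (simp add: zi)
  finally show ?thesis .
qed

text \<open>The Pluecker relation that exchanges one column: expand column \<open>j\<close> of
  \<open>y\<close> in the columns of \<open>x\<close> by Cramer's rule. It is the source of the
  monotonicity of network orders.\<close>

lemma cdet_exchange:
  fixes x y :: "nat \<Rightarrow> nat \<Rightarrow> 'a::idom"
  assumes j: "j < k" and nz: "cdet k x \<noteq> 0"
  shows "cdet k x * cdet k y = (\<Sum>i<k. cdet k (x(i := y j)) * cdet k (y(j := x i)))"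
proof -
  have "cdet k x * cdet k y = cdet k (y(j := (\<lambda>r. cdet k x * y j r)))"
    by (subst (2) cdet_sum[OF j, where C="{()}" and a="\<lambda>_. cdet k x" and y="\<lambda>_. y j"]) auto
  also have "\<dots> = (\<Sum>i<k. cdet k (x(i := y j)) * cdet k (y(j := x i)))"
    by (subst cdet_sum[OF j, where C="{..<k}" and a="\<lambda>i. cdet k (x(i := y j))" and y="\<lambda>i. x i"])
       (auto simp: cdet_cramer[OF _ nz])
  finally show ?thesis .
qed

text \<open>The sign is chosen before \<open>x\<close>, so that it can be shared by all families of
  columns.\<close>

lemma cdet_reorder:
  assumes "bij_betw \<sigma> {..<k} {..<k}"
  shows "\<exists>s. (s = 1 \<or> s = - 1) \<and> (\<forall>x. cdet k (\<lambda>l. x (\<sigma> l)) = s * cdet k x)"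
proof -
  define p where "p l = (if l < k then \<sigma> l else l)" for l
  have "bij_betw p {0..<k} {0..<k}"
    using assms by (subst bij_betw_cong[where g = \<sigma>]) (auto simp: p_def lessThan_atLeast0)
  then have p: "p permutes {0..<k}" by (rule bij_imp_permutes) (auto simp: p_def)
  have "cdet k (\<lambda>l. x (\<sigma> l)) = signof p * cdet k x" for x :: "nat \<Rightarrow> nat \<Rightarrow> 'a"
    unfolding cdet_permute[OF p, symmetric] by (rule cdet_cong) (simp add: p_def)
  moreover have "signof p = (1::'a) \<or> signof p = (- 1::'a)" by (auto simp: sign_def)
  ultimately show ?thesis by (intro exI[of _ "signof p"] conjI allI)
qed

text \<open>All perturbations are multiples of one vector \<open>u\<close>, so terms with two
  perturbed columns vanish and the determinant stays affine in \<open>z\<close>. Varying one network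
  weight changes the columns in just this way.\<close>

lemma cdet_rank_one_perturbation:
  assumes "finite T" "T \<subseteq> {..<k}"
  shows "cdet k (\<lambda>l r. if l \<in> T then p l r + z * (g l * u r) else p l r) =
    cdet k p + z * (\<Sum>l\<in>T. g l * cdet k (p(l := u)))"
  using assms
proof (induction T arbitrary: p rule: finite_induct)
  case empty
  then show ?case by simp
next
  case (insert t T)
  let ?x = "\<lambda>p l r. if l \<in> T then p l r + z * (g l * u r) else p l r"
  have t: "t < k" and T: "T \<subseteq> {..<k}" using insert.prems by auto
  have "cdet k (\<lambda>l r. if l \<in> insert t T then p l r + z * (g l * u r) else p l r) =
     cdet k ((\<lambda>l r. if l \<in> insert t T then p l r + z * (g l * u r) else p l r)(t := p t)) +
     (z * g t) * cdet k ((\<lambda>l r. if l \<in> insert t T then p l r + z * (g l * u r) else p l r)(t := u))"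
    by (rule cdet_add[OF t]) (simp add: mult_ac)
  also have "cdet k ((\<lambda>l r. if l \<in> insert t T then p l r + z * (g l * u r) else p l r)(t := p t)) = cdet k (?x p)"
    by (rule cdet_cong) (use insert.hyps in auto)
  also have "cdet k ((\<lambda>l r. if l \<in> insert t T then p l r + z * (g l * u r) else p l r)(t := u)) = cdet k (?x (p(t := u)))"
    by (rule cdet_cong) (use insert.hyps in auto)
  also have "cdet k (?x (p(t := u))) = cdet k (p(t := u)) + z * (\<Sum>l\<in>T. g l * cdet k ((p(t := u))(l := u)))"
    by (rule insert.IH[OF T])
  also have "(\<Sum>l\<in>T. g l * cdet k ((p(t := u))(l := u))) = 0"
  proof (rule sum.neutral, rule ballI)
    fix l assume "l \<in> T"
    then have "l \<noteq> t" "l < k" using insert.hyps T by auto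
    then have "cdet k ((p(t := u))(l := u)) = 0" by (intro cdet_eq_columns[of l _ t]) (auto simp: t)
    then show "g l * cdet k ((p(t := u))(l := u)) = 0" by simp
  qed
  also have "cdet k (?x p) = cdet k p + z * (\<Sum>l\<in>T. g l * cdet k (p(l := u)))"
    by (rule insert.IH[OF T])
  finally show ?case using insert.hyps by (simp add: distrib_left mult.assoc add_ac fun_upd_def)
qed

lemma cdet_affine:
  "cdet k (\<lambda>l r. p l r + z * (g l * u r)) = cdet k p + z * (\<Sum>l<k. g l * cdet k (p(l := u)))"
  unfolding cdet_rank_one_perturbation[of "{..<k}" k p z g u, OF finite_lessThan subset_refl, symmetric]
  by (rule cdet_cong) auto

section \<open>Evaluation of polynomials\<close>

definition monom_eval :: "('v \<Rightarrow> 'r) \<Rightarrow> ('v \<Rightarrow>\<^sub>0 nat) \<Rightarrow> 'r::comm_ring_1" where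
  "monom_eval x m = (\<Prod>v \<in> Poly_Mapping.keys m. x v ^ Poly_Mapping.lookup m v)"

definition const_poly :: "complex \<Rightarrow> 'v cpoly" where
  "const_poly c = Poly_Mapping.single 0 c"

definition var_poly :: "'v \<Rightarrow> 'v cpoly" where
  "var_poly v = Poly_Mapping.single (Poly_Mapping.single v 1) 1"

definition part_poly :: "(('v \<Rightarrow>\<^sub>0 nat) \<Rightarrow> bool) \<Rightarrow> 'v cpoly \<Rightarrow> 'v cpoly" where
  "part_poly P f = (\<Sum>m\<in>{m \<in> Poly_Mapping.keys f. P m}. Poly_Mapping.single m (Poly_Mapping.lookup f m))"

lemma monom_eval_superset:
  assumes "finite S" "Poly_Mapping.keys m \<subseteq> S"
  shows "monom_eval x m = (\<Prod>v\<in>S. x v ^ Poly_Mapping.lookup m v)"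
  unfolding monom_eval_def
  by (rule prod.mono_neutral_left) (use assms in \<open>auto simp: in_keys_iff\<close>)

lemma monom_eval_zero [simp]: "monom_eval x 0 = 1"
  unfolding monom_eval_def by simp

lemma monom_eval_single [simp]: "monom_eval x (Poly_Mapping.single v d) = x v ^ d"
  by (subst monom_eval_superset[of "{v}"]) (auto split: if_splits)

lemma monom_eval_add: "monom_eval x (m + m') = monom_eval x m * monom_eval x m'"
proof -
  let ?S = "Poly_Mapping.keys m \<union> Poly_Mapping.keys m'"
  have "Poly_Mapping.keys (m + m') \<subseteq> ?S" by (rule keys_add)
  then show ?thesis
    by (simp add: monom_eval_superset[of ?S] lookup_add power_add prod.distrib)
qed

lemma eval_cpoly_superset:
  assumes "comm_ring_hom h" "finite K" "Poly_Mapping.keys f \<subseteq> K"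
  shows "eval_cpoly h x f = (\<Sum>m\<in>K. h (Poly_Mapping.lookup f m) * monom_eval x m)"
proof -
  interpret comm_ring_hom h by fact
  show ?thesis unfolding eval_cpoly_def monom_eval_def
    by (rule sum.mono_neutral_left) (use assms in \<open>auto simp: in_keys_iff\<close>)
qed

lemma eval_cpoly_single:
  assumes "comm_ring_hom h"
  shows "eval_cpoly h x (Poly_Mapping.single m c) = h c * monom_eval x m"
  by (subst eval_cpoly_superset[OF assms, of "{m}"]) auto

lemma eval_cpoly_add:
  assumes "comm_ring_hom h"
  shows "eval_cpoly h x (f + g) = eval_cpoly h x f + eval_cpoly h x g"
proof -
  interpret comm_ring_hom h by fact
  let ?S = "Poly_Mapping.keys f \<union> Poly_Mapping.keys g"
  have "Poly_Mapping.keys (f + g) \<subseteq> ?S" by (rule keys_add)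
  then show ?thesis
    by (simp add: eval_cpoly_superset[OF assms, of ?S] lookup_add hom_distribs algebra_simps sum.distrib)
qed

lemma eval_cpoly_zero [simp]: "eval_cpoly h x 0 = 0"
  unfolding eval_cpoly_def by simp

lemma eval_cpoly_sum:
  assumes "comm_ring_hom h"
  shows "eval_cpoly h x (sum F S) = (\<Sum>s\<in>S. eval_cpoly h x (F s))"
  by (induction S rule: infinite_finite_induct) (auto simp: eval_cpoly_add[OF assms])

lemma poly_mapping_eq_sum_single:
  "f = (\<Sum>m\<in>Poly_Mapping.keys f. Poly_Mapping.single m (Poly_Mapping.lookup f m))"
  by (rule poly_mapping_eqI)
     (auto simp: lookup_sum lookup_single when_def in_keys_iff)

lemma eval_cpoly_mult:
  assumes "comm_ring_hom h"
  shows "eval_cpoly h x (f * g) = eval_cpoly h x f * eval_cpoly h x g"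
proof -
  interpret comm_ring_hom h by fact
  let ?f = "\<lambda>m. Poly_Mapping.lookup f m" and ?g = "\<lambda>m. Poly_Mapping.lookup g m"
  have "f * g = (\<Sum>m\<in>Poly_Mapping.keys f. \<Sum>m'\<in>Poly_Mapping.keys g.
      Poly_Mapping.single m (?f m) * Poly_Mapping.single m' (?g m'))"
    by (subst poly_mapping_eq_sum_single[of f], subst poly_mapping_eq_sum_single[of g])
       (simp only: sum_distrib_left sum_distrib_right, rule sum.swap)
  also have "eval_cpoly h x \<dots> = (\<Sum>m\<in>Poly_Mapping.keys f. \<Sum>m'\<in>Poly_Mapping.keys g.
      (h (?f m) * monom_eval x m) * (h (?g m') * monom_eval x m'))"
    by (simp add: eval_cpoly_sum[OF assms] mult_single eval_cpoly_single[OF assms] monom_eval_add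
        hom_distribs mult_ac)
  also have "\<dots> = eval_cpoly h x f * eval_cpoly h x g"
    unfolding eval_cpoly_def monom_eval_def
    by (simp only: sum_distrib_left sum_distrib_right, rule sum.swap)
  finally show ?thesis .
qed

lemma comm_ring_hom_eval:
  assumes "comm_ring_hom h"
  shows "comm_ring_hom (eval_cpoly h x)"
proof -
  interpret comm_ring_hom h by fact
  show ?thesis
    by unfold_locales
       (auto simp: eval_cpoly_add[OF assms] eval_cpoly_mult[OF assms] single_one[symmetric]
          eval_cpoly_single[OF assms] simp del: single_one)
qed

lemma comm_ring_hom_comp:
  assumes "comm_ring_hom f" "comm_ring_hom g"
  shows "comm_ring_hom (\<lambda>x. f (g x))"
proof -
  interpret f: comm_ring_hom f by fact
  interpret g: comm_ring_hom g by fact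
  show ?thesis by unfold_locales (auto simp: f.hom_add g.hom_add f.hom_mult g.hom_mult)
qed

lemma eval_cpoly_const:
  assumes "comm_ring_hom h"
  shows "eval_cpoly h x (const_poly c) = h c"
  unfolding const_poly_def by (simp add: eval_cpoly_single[OF assms])

lemma eval_cpoly_var:
  assumes "comm_ring_hom h"
  shows "eval_cpoly h x (var_poly v) = x v"
proof -
  interpret comm_ring_hom h by fact
  show ?thesis unfolding var_poly_def by (simp add: eval_cpoly_single[OF assms])
qed

lemma eval_cpoly_hom:
  assumes "comm_ring_hom \<phi>"
  shows "\<phi> (eval_cpoly h x f) = eval_cpoly (\<lambda>c. \<phi> (h c)) (\<lambda>v. \<phi> (x v)) f"
proof -
  interpret comm_ring_hom \<phi> by fact
  show ?thesis unfolding eval_cpoly_def by (simp add: hom_distribs)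
qed

lemma eval_cpoly_subst:
  assumes "comm_ring_hom h"
  shows "eval_cpoly h x (eval_cpoly const_poly s f) = eval_cpoly h (\<lambda>v. eval_cpoly h x (s v)) f"
  unfolding eval_cpoly_hom[OF comm_ring_hom_eval[OF assms]] eval_cpoly_const[OF assms] ..

lemma prod_single_one:
  "(\<Prod>v\<in>A. Poly_Mapping.single (s v) (1::complex)) = Poly_Mapping.single (\<Sum>v\<in>A. s v) 1"
  by (induction A rule: infinite_finite_induct) (auto simp: mult_single)

lemma eval_cpoly_var_poly:
  fixes f :: "'v cpoly"
  shows "eval_cpoly const_poly var_poly f = f"
proof -
  have "eval_cpoly const_poly var_poly f =
     (\<Sum>m\<in>Poly_Mapping.keys f. Poly_Mapping.single m (Poly_Mapping.lookup f m))"
    unfolding eval_cpoly_def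
  proof (intro sum.cong refl, fold monom_eval_def)
    fix m :: "'v \<Rightarrow>\<^sub>0 nat"
    have *: "monom_eval var_poly m = Poly_Mapping.single m (1::complex)"
    proof -
      have pw: "(var_poly v :: 'v cpoly) ^ d = Poly_Mapping.single (Poly_Mapping.single v d) 1" for v d
        by (induction d) (auto simp: var_poly_def mult_single single_add[symmetric])
      have "monom_eval var_poly m = (\<Prod>v\<in>Poly_Mapping.keys m. Poly_Mapping.single (Poly_Mapping.single v (Poly_Mapping.lookup m v)) (1::complex))"
        unfolding monom_eval_def by (intro prod.cong refl pw)
      also have "\<dots> = Poly_Mapping.single (\<Sum>v\<in>Poly_Mapping.keys m. Poly_Mapping.single v (Poly_Mapping.lookup m v)) 1"
        by (rule prod_single_one)
      finally show ?thesis using poly_mapping_eq_sum_single[of m] by simp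
    qed
    show "const_poly (Poly_Mapping.lookup f m) * monom_eval var_poly m = Poly_Mapping.single m (Poly_Mapping.lookup f m)"
      unfolding * const_poly_def by (simp add: mult_single)
  qed
  then show ?thesis using poly_mapping_eq_sum_single[of f] by simp
qed

lemma eval_cpoly_cong:
  assumes "f \<in> cpolys V" "\<And>v. v \<in> V \<Longrightarrow> x v = y v"
  shows "eval_cpoly h x f = eval_cpoly h y f"
  unfolding eval_cpoly_def
  by (intro sum.cong refl arg_cong2[where f="(*)"] prod.cong) (use assms in \<open>auto simp: cpolys_def subset_iff\<close>)

lemma lookup_part_poly: "Poly_Mapping.lookup (part_poly P f) m = (if P m then Poly_Mapping.lookup f m else 0)"
  unfolding part_poly_def by (auto simp: lookup_sum lookup_single when_def in_keys_iff)

lemma eval_part_poly: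
  assumes "comm_ring_hom h"
  shows "eval_cpoly h x (part_poly P f) =
    (\<Sum>m\<in>{m \<in> Poly_Mapping.keys f. P m}. h (Poly_Mapping.lookup f m) * monom_eval x m)"
  unfolding part_poly_def by (simp add: eval_cpoly_sum[OF assms] eval_cpoly_single[OF assms])

text \<open>Turns a question about monomials with given support into one about values, where
  vanishing at all points can be tested.\<close>

lemma eval_part_poly_support:
  assumes "comm_ring_hom h"
  shows "eval_cpoly h x (part_poly (\<lambda>m. Poly_Mapping.keys m \<subseteq> V) f) =
    eval_cpoly h (\<lambda>v. if v \<in> V then x v else 0) f"
proof -
  have me: "monom_eval (\<lambda>v. if v \<in> V then x v else 0) m =
      (if Poly_Mapping.keys m \<subseteq> V then monom_eval x m else 0)" for m
  proof (cases "Poly_Mapping.keys m \<subseteq> V")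
    case True
    then show ?thesis unfolding monom_eval_def by (auto intro!: prod.cong)
  next
    case False
    then obtain v where v: "v \<in> Poly_Mapping.keys m" "v \<notin> V" by auto
    then have "monom_eval (\<lambda>v. if v \<in> V then x v else 0) m = 0" unfolding monom_eval_def
      by (intro prod_zero finite_keys bexI[of _ v]) (auto simp: in_keys_iff zero_power)
    then show ?thesis using False by simp
  qed
  show ?thesis unfolding eval_part_poly[OF assms] unfolding eval_cpoly_def monom_eval_def[symmetric] me
    by (subst sum.inter_filter) (auto intro!: sum.cong)
qed

lemma part_poly_support_in_cpolys: "part_poly (\<lambda>m. Poly_Mapping.keys m \<subseteq> V) f \<in> cpolys V"
  unfolding cpolys_def
proof (clarify)
  fix m v assume "m \<in> Poly_Mapping.keys (part_poly (\<lambda>m. Poly_Mapping.keys m \<subseteq> V) f)" "v \<in> Poly_Mapping.keys m"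
  then show "v \<in> V" by (subst (asm) in_keys_iff) (auto simp: lookup_part_poly split: if_splits)
qed

lemma comm_ring_hom_id': "comm_ring_hom (id::'a::comm_ring_1 \<Rightarrow> 'a)"
  by unfold_locales auto

lemma eval_cpoly_monom:
  "eval_cpoly h x f = (\<Sum>m\<in>Poly_Mapping.keys f. h (Poly_Mapping.lookup f m) * monom_eval x m)"
  unfolding eval_cpoly_def monom_eval_def ..

lemma monom_eval_cong: "(\<And>v. v \<in> Poly_Mapping.keys m \<Longrightarrow> x v = y v) \<Longrightarrow> monom_eval x m = monom_eval y m"
  unfolding monom_eval_def by (rule prod.cong) auto

section \<open>Coefficients with respect to one variable\<close>

definition erase_var :: "'v \<Rightarrow> ('v \<Rightarrow>\<^sub>0 nat) \<Rightarrow> ('v \<Rightarrow>\<^sub>0 nat)" where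
  "erase_var v m = Poly_Mapping.update v 0 m"

lemma lookup_erase_var: "Poly_Mapping.lookup (erase_var v m) w = (if w = v then 0 else Poly_Mapping.lookup m w)"
  unfolding erase_var_def by (simp add: lookup_update)

lemma keys_erase_var: "Poly_Mapping.keys (erase_var v m) = Poly_Mapping.keys m - {v}"
  by (auto simp: in_keys_iff lookup_erase_var split: if_splits)

lemma erase_var_inject:
  "erase_var v m = erase_var v m' \<Longrightarrow> Poly_Mapping.lookup m v = Poly_Mapping.lookup m' v \<Longrightarrow> m = m'"
  by (rule poly_mapping_eqI) (metis lookup_erase_var)

lemma monom_eval_erase_var:
  "monom_eval x m = x v ^ Poly_Mapping.lookup m v * monom_eval x (erase_var v m)"
proof -
  have "m = Poly_Mapping.single v (Poly_Mapping.lookup m v) + erase_var v m"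
    by (rule poly_mapping_eqI) (auto simp: lookup_add lookup_single lookup_erase_var when_def)
  then show ?thesis by (metis monom_eval_add monom_eval_single)
qed

definition var_coeff :: "'v \<Rightarrow> nat \<Rightarrow> 'v cpoly \<Rightarrow> 'v cpoly" where
  "var_coeff v d f = (\<Sum>m\<in>{m \<in> Poly_Mapping.keys f. Poly_Mapping.lookup m v = d}.
     Poly_Mapping.single (erase_var v m) (Poly_Mapping.lookup f m))"

lemma lookup_var_coeff:
  "Poly_Mapping.lookup (var_coeff v (Poly_Mapping.lookup m v) f) (erase_var v m) = Poly_Mapping.lookup f m"
proof -
  have "Poly_Mapping.lookup (var_coeff v (Poly_Mapping.lookup m v) f) (erase_var v m) =
    (\<Sum>m'\<in>{m' \<in> Poly_Mapping.keys f. Poly_Mapping.lookup m' v = Poly_Mapping.lookup m v}.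
      if m' = m then Poly_Mapping.lookup f m' else 0)"
    unfolding var_coeff_def lookup_sum lookup_single when_def
    by (intro sum.cong refl if_cong) (auto dest: erase_var_inject)
  then show ?thesis by (auto simp: in_keys_iff)
qed

lemma keys_var_coeff: "Poly_Mapping.keys (var_coeff v d f) \<subseteq> erase_var v ` Poly_Mapping.keys f"
proof
  fix m assume "m \<in> Poly_Mapping.keys (var_coeff v d f)"
  then have "Poly_Mapping.lookup (var_coeff v d f) m \<noteq> 0" by (simp add: in_keys_iff)
  then show "m \<in> erase_var v ` Poly_Mapping.keys f"
    unfolding var_coeff_def lookup_sum lookup_single
    by (rule contrapos_np) (auto intro!: sum.neutral simp: when_def)
qed

lemma eval_var_coeff:
  fixes f :: "'v cpoly" and x :: "'v \<Rightarrow> complex" and v :: 'v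
  defines "D \<equiv> \<Sum>m\<in>Poly_Mapping.keys f. Poly_Mapping.lookup m v"
  shows "eval_cpoly id (x(v := z)) f = (\<Sum>d\<le>D. eval_cpoly id x (var_coeff v d f) * z ^ d)"
proof -
  let ?K = "Poly_Mapping.keys f"
  have D: "(\<lambda>m. Poly_Mapping.lookup m v) ` ?K \<subseteq> {..D}"
    unfolding D_def by (auto intro!: member_le_sum)
  have "(\<Sum>d\<le>D. eval_cpoly id x (var_coeff v d f) * z ^ d) =
     (\<Sum>d\<le>D. \<Sum>m\<in>{m \<in> ?K. Poly_Mapping.lookup m v = d}.
       Poly_Mapping.lookup f m * (z ^ Poly_Mapping.lookup m v * monom_eval x (erase_var v m)))"
    unfolding var_coeff_def eval_cpoly_sum[OF comm_ring_hom_id'] eval_cpoly_single[OF comm_ring_hom_id']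
      sum_distrib_right
    by (intro sum.cong refl) auto
  also have "\<dots> = (\<Sum>m\<in>?K. Poly_Mapping.lookup f m * (z ^ Poly_Mapping.lookup m v * monom_eval x (erase_var v m)))"
    by (rule sum.group) (use D in auto)
  also have "\<dots> = eval_cpoly id (x(v := z)) f"
    unfolding eval_cpoly_monom
  proof (intro sum.cong refl)
    fix m
    have "monom_eval x (erase_var v m) = monom_eval (x(v := z)) (erase_var v m)"
      by (rule monom_eval_cong) (auto simp: keys_erase_var)
    then show "Poly_Mapping.lookup f m * (z ^ Poly_Mapping.lookup m v * monom_eval x (erase_var v m)) =
        id (Poly_Mapping.lookup f m) * monom_eval (x(v := z)) m"
      using monom_eval_erase_var[of "x(v := z)" m v] by simp
  qed
  finally show ?thesis ..
qed

text \<open>There may be infinitely many variables, but \<open>f\<close> uses finitely many; the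
  induction runs over these. As a function of one of them \<open>f\<close> is a complex polynomial
  in one variable that vanishes everywhere, so its coefficients vanish, and they are polynomials in
  the remaining variables.\<close>

lemma cpoly_eq_zero_if_vanishes:
  fixes f :: "'v cpoly"
  assumes "\<And>x. eval_cpoly id x f = 0"
  shows "f = 0"
proof -
  have "f = 0" if "finite V" "f \<in> cpolys V" "\<And>x. eval_cpoly id x f = 0" for V and f :: "'v cpoly"
    using that
  proof (induction V arbitrary: f rule: finite_induct)
    case empty
    then have "Poly_Mapping.keys f \<subseteq> {0}" unfolding cpolys_def by (auto simp: keys_eq_empty)
    then have "eval_cpoly id (\<lambda>_. 0) f = Poly_Mapping.lookup f 0"
      by (subst eval_cpoly_superset[OF comm_ring_hom_id', of "{0}"]) auto
    then have "0 \<notin> Poly_Mapping.keys f" using empty(2) by (simp add: in_keys_iff)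
    then have "Poly_Mapping.lookup f m = 0" for m using \<open>Poly_Mapping.keys f \<subseteq> {0}\<close> by (metis in_keys_iff singletonD subsetD)
    then show ?case by (intro poly_mapping_eqI) simp
  next
    case (insert v V)
    have "var_coeff v d f = 0" for d
    proof (rule insert.IH)
      show "var_coeff v d f \<in> cpolys V"
        using keys_var_coeff[of v d f] insert.prems(1) unfolding cpolys_def
        by (fastforce simp: keys_erase_var)
      fix x :: "'v \<Rightarrow> complex"
      let ?D = "\<Sum>m\<in>Poly_Mapping.keys f. Poly_Mapping.lookup m v"
      show "eval_cpoly id x (var_coeff v d f) = 0"
      proof (cases "d \<le> ?D")
        case True
        have "\<forall>z. (\<Sum>d\<le>?D. eval_cpoly id x (var_coeff v d f) * z ^ d) = 0"
          using insert.prems(2) eval_var_coeff[of x v _ f] by metis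
        then show ?thesis using True polyfun_eq_0[where n = ?D and c = "\<lambda>d. eval_cpoly id x (var_coeff v d f)"] by simp
      next
        case False
        have *: "{m \<in> Poly_Mapping.keys f. Poly_Mapping.lookup m v = d} = {}"
          using False member_le_sum[of _ "Poly_Mapping.keys f" "\<lambda>m. Poly_Mapping.lookup m v"] by force
        show ?thesis unfolding var_coeff_def * by simp
      qed
    qed
    then have "Poly_Mapping.lookup f m = 0" for m
      using lookup_var_coeff[of v m f] by simp
    then show ?case by (intro poly_mapping_eqI) simp
  qed
  moreover have "f \<in> cpolys (\<Union>m\<in>Poly_Mapping.keys f. Poly_Mapping.keys m)"
    unfolding cpolys_def by auto
  ultimately show ?thesis using assms by (metis finite_UN_I finite_keys)
qed

text \<open>By uniqueness of the coefficients in one variable, the coefficient of a higher power of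
  \<open>v\<close> vanishes at every point, hence is the zero polynomial.\<close>

lemma lookup_le_one_if_affine:
  fixes f :: "'v cpoly"
  assumes aff: "\<And>x. \<exists>a b. \<forall>z. eval_cpoly id (x(v := z)) f = a + b * z"
    and m: "m \<in> Poly_Mapping.keys f"
  shows "Poly_Mapping.lookup m v \<le> 1"
proof (rule ccontr)
  assume "\<not> Poly_Mapping.lookup m v \<le> 1"
  then have d: "Poly_Mapping.lookup m v \<ge> 2" by simp
  let ?d = "Poly_Mapping.lookup m v"
  let ?D = "\<Sum>m\<in>Poly_Mapping.keys f. Poly_Mapping.lookup m v"
  have dD: "?d \<le> ?D" by (rule member_le_sum) (use m in auto)
  have "eval_cpoly id x (var_coeff v ?d f) = 0" for x
  proof -
    obtain a b where ab: "\<And>z. eval_cpoly id (x(v := z)) f = a + b * z" using aff by metis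
    have "(\<Sum>d\<le>?D. (eval_cpoly id x (var_coeff v d f) - (if d = 0 then a else if d = 1 then b else 0)) * z ^ d) = 0" for z
    proof -
      have "(\<Sum>d\<le>?D. (if d = 0 then a else if d = 1 then b else 0) * z ^ d) =
          (\<Sum>d\<in>{0,1}. (if d = 0 then a else if d = 1 then b else 0) * z ^ d)"
        by (rule sum.mono_neutral_right) (use d dD in auto)
      then show ?thesis using ab[of z] eval_var_coeff[of x v z f]
        by (simp add: left_diff_distrib sum_subtractf)
    qed
    then have "\<forall>d\<le>?D. eval_cpoly id x (var_coeff v d f) - (if d = 0 then a else if d = 1 then b else 0) = 0"
      using polyfun_eq_0[where n = ?D and c = "\<lambda>d. eval_cpoly id x (var_coeff v d f) - (if d = 0 then a else if d = 1 then b else 0)"] by blast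
    then show ?thesis using dD d by force
  qed
  then have "var_coeff v ?d f = 0" by (rule cpoly_eq_zero_if_vanishes)
  then show False using lookup_var_coeff[of v m f] m by (simp add: in_keys_iff)
qed

section \<open>Network columns\<close>

text \<open>Reading rows and columns of a \<open>k \<times> q\<close> grid backwards and rescaling the essential weights so
  that only the horizontal edges carry one, \<open>ncol k \<rho> j i r\<close> is the weight of the paths from
  source \<open>r\<close> to the vertex \<open>(i, j - 1)\<close>.\<close>
primrec ncol :: "nat \<Rightarrow> (nat \<Rightarrow> nat \<Rightarrow> 'a::comm_ring_1) \<Rightarrow> nat \<Rightarrow> nat \<Rightarrow> nat \<Rightarrow> 'a" where
  "ncol k \<rho> 0 = (\<lambda>i r. if r = i then 1 else 0)"
| "ncol k \<rho> (Suc j) = (\<lambda>i r. \<Sum>l\<in>{i..<k}. \<rho> l j * ncol k \<rho> j l r)"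

text \<open>Truncated subtraction makes the columns from \<open>q\<close> on the identity matrix.\<close>
definition netcol :: "nat \<Rightarrow> nat \<Rightarrow> (nat \<Rightarrow> nat \<Rightarrow> 'a::comm_ring_1) \<Rightarrow> nat \<Rightarrow> nat \<Rightarrow> 'a" where
  "netcol k q \<rho> c = ncol k \<rho> (q - c) (c - q)"

lemma ncol_step: "i < k \<Longrightarrow> ncol k \<rho> (Suc j) i r = ncol k \<rho> (Suc j) (Suc i) r + \<rho> i j * ncol k \<rho> j i r"
  by (simp add: sum.atLeast_Suc_lessThan)

lemma ncol_support: "r < i \<Longrightarrow> ncol k \<rho> j i r = 0"
  by (induction j arbitrary: i) (auto intro!: sum.neutral)

lemma ncol_diagonal_step: "i < k \<Longrightarrow> ncol k \<rho> (Suc j) i i = \<rho> i j * ncol k \<rho> j i i"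
  by (subst ncol_step) (auto simp: ncol_support simp del: ncol.simps)

text \<open>Paths never pass to a row of larger index, so from source \<open>i\<close> only the
  straight path ends in row \<open>i\<close>.\<close>

lemma ncol_diagonal: "i < k \<Longrightarrow> ncol k \<rho> j i i = (\<Prod>l<j. \<rho> i l)"
  by (induction j) (auto simp: ncol_diagonal_step mult.commute simp del: ncol.simps(2))

lemma netcol_identity: "netcol k q \<rho> (q + l) r = (if r = l then 1 else 0)"
  unfolding netcol_def by simp

lemma ncol_hom:
  assumes "comm_ring_hom h"
  shows "ncol k (\<lambda>l j. h (\<rho> l j)) m i r = h (ncol k \<rho> m i r)"
proof -
  interpret comm_ring_hom h by fact
  show ?thesis by (induction m arbitrary: i) (auto simp: hom_distribs)
qed

text \<open>\<open>d i j\<close> bounds from below every path to row \<open>i\<close> at level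
  \<open>j\<close>. A path may come from a row of larger index, but the bound there is a multiple.
  In the applications \<open>d\<close> consists of powers of \<open>t\<close>.\<close>

lemma ncol_dvd:
  fixes d :: "nat \<Rightarrow> nat \<Rightarrow> 'a::comm_ring_1"
  assumes d0: "\<And>i. d i 0 = 1"
    and di: "\<And>i j. Suc i < k \<Longrightarrow> j \<le> q \<Longrightarrow> d i j dvd d (Suc i) j"
    and dj: "\<And>i j. i < k \<Longrightarrow> j < q \<Longrightarrow> d i (Suc j) dvd \<rho> i j * d i j"
    and "j \<le> q" "i < k"
  shows "d i j dvd ncol k \<rho> j i r"
  using \<open>j \<le> q\<close> \<open>i < k\<close>
proof (induction j arbitrary: i)
  case 0
  then show ?case by (simp add: d0)
next
  case (Suc j)
  have mono: "d i (Suc j) dvd d l (Suc j)" if "i \<le> l" "l < k" for l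
    using that(1,2)
  proof (induction l rule: dec_induct)
    case (step l)
    then show ?case using di[of l "Suc j"] Suc.prems by (meson Suc_lessD dvd_trans)
  qed simp
  have "d i (Suc j) dvd \<rho> l j * ncol k \<rho> j l r" if l: "l \<in> {i..<k}" for l
  proof -
    have "d l (Suc j) dvd \<rho> l j * d l j" using dj[of l j] l Suc.prems by auto
    also have "\<dots> dvd \<rho> l j * ncol k \<rho> j l r"
      using Suc.IH[of l] l Suc.prems by (intro mult_dvd_mono) auto
    finally show ?thesis using mono[of l] l by (auto intro: dvd_trans)
  qed
  then show ?case by (auto intro!: dvd_sum)
qed

text \<open>In a chain of divisors the first \<open>i\<close> factors are the cheapest. With
  \<open>Suc i\<close> elements in \<open>R\<close> the largest one is at least \<open>i\<close>, so
  its factor is a multiple of the last of them; the rest follows by induction.\<close>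

lemma prod_chain_dvd:
  fixes D :: "nat \<Rightarrow> 'a::comm_monoid_mult"
  assumes "\<And>r. Suc r < k \<Longrightarrow> D r dvd D (Suc r)" "R \<subseteq> {..<k}" "i \<le> card R"
  shows "(\<Prod>r<i. D r) dvd prod D R"
  using assms(2,3)
proof (induction i arbitrary: R)
  case 0
  then show ?case by simp
next
  case (Suc i)
  have fin: "finite R" using Suc.prems finite_subset by auto
  have ne: "R \<noteq> {}" using Suc.prems by auto
  define m where "m = Max R"
  have m: "m \<in> R" unfolding m_def using fin ne by simp
  then have mk: "m < k" using Suc.prems by auto
  have "R \<subseteq> {..m}" unfolding m_def using fin by auto
  then have "card R \<le> Suc m" by (metis card_atMost card_mono finite_atMost)
  then have "i \<le> m" using Suc.prems by simp
  then have "D i dvd D m" using mk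
  proof (induction m rule: dec_induct)
    case (step l)
    then show ?case using assms(1)[of l] by (meson Suc_lessD dvd_trans)
  qed simp
  moreover have "(\<Prod>r<i. D r) dvd prod D (R - {m})"
    by (rule Suc.IH) (use Suc.prems m fin in auto)
  ultimately have "(\<Prod>r<i. D r) * D i dvd prod D (R - {m}) * D m" by (rule mult_dvd_mono[rotated])
  then show ?case using m fin by (simp add: prod.remove[of R m] mult.commute)
qed

lemma sum_unit_coeff:
  "finite S \<Longrightarrow> (\<Sum>u\<in>S. (if u = s then 1 else 0) * f u) = (if s \<in> S then f s else (0::'a::comm_ring_1))"
  by (simp add: if_distrib[of "\<lambda>z. z * _"] cong: if_cong)

text \<open>The vertices \<open>(u, j + 1 + u - i)\<close> form a line, and every vertex beyond it
  has both its predecessors on the line or beyond it. So \<open>ncol_step\<close> can be iterated,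
  by induction on the level and, inside, on the distance of the row from \<open>k\<close>. Where the
  truncated subtraction gives level 0, the line consists of unit vectors.\<close>

lemma ncol_span:
  assumes "s < k" "m \<le> q" "j + 1 + s \<le> m + i"
  shows "\<exists>a. \<forall>r. ncol k \<rho> m s r = (\<Sum>u<min k (q + i - j). a u * ncol k \<rho> (j + 1 + u - i) u r)"
  using assms
proof (induction m arbitrary: s)
  case 0
  then have "ncol k \<rho> 0 s r = (\<Sum>u<min k (q + i - j). (if u = s then 1 else 0) * ncol k \<rho> (j + 1 + u - i) u r)" for r
    by (subst sum_unit_coeff) auto
  then show ?case by (intro exI[of _ "\<lambda>u. if u = s then 1 else 0"] allI)
next
  case (Suc m)
  let ?K = "{..<min k (q + i - j)}"
  show ?case using Suc.prems
  proof (induction "k - s" arbitrary: s rule: less_induct)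
    case less
    show ?case
    proof (cases "j + 1 + s - i = Suc m")
      case True
      have "ncol k \<rho> (Suc m) s r = (\<Sum>u\<in>?K. (if u = s then 1 else 0) * ncol k \<rho> (j + 1 + u - i) u r)" for r
        by (subst sum_unit_coeff) (use less.prems True in \<open>auto simp del: ncol.simps\<close>)
      then show ?thesis by (intro exI[of _ "\<lambda>u. if u = s then 1 else 0"] allI)
    next
      case False
      then have le: "j + 1 + s \<le> m + i" using less.prems by linarith
      obtain a where a: "\<And>r. ncol k \<rho> m s r = (\<Sum>u\<in>?K. a u * ncol k \<rho> (j + 1 + u - i) u r)"
        using Suc.IH[OF less.prems(1) _ le] less.prems(2) by auto
      obtain a' where a': "\<And>r. ncol k \<rho> (Suc m) (Suc s) r = (\<Sum>u\<in>?K. a' u * ncol k \<rho> (j + 1 + u - i) u r)"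
      proof (cases "Suc s < k")
        case True
        then have "\<exists>a. \<forall>r. ncol k \<rho> (Suc m) (Suc s) r = (\<Sum>u\<in>?K. a u * ncol k \<rho> (j + 1 + u - i) u r)"
          using le less.prems by (intro less.hyps) auto
        then show ?thesis using that by blast
      next
        case False
        then show ?thesis using that[of "\<lambda>_. 0"] by simp
      qed
      have "ncol k \<rho> (Suc m) s r = (\<Sum>u\<in>?K. (a' u + \<rho> s m * a u) * ncol k \<rho> (j + 1 + u - i) u r)" for r
        unfolding ncol_step[OF less.prems(1)] a a' by (simp add: algebra_simps sum.distrib sum_distrib_left)
      then show ?thesis by (intro exI[of _ "\<lambda>u. a' u + \<rho> s m * a u"] allI)
    qed
  qed
qed

text \<open>All paths to sinks before column \<open>q - j + i\<close> cross the line of vertices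
  \<open>(r, j - i + r)\<close>, and disjoint paths cross it at different vertices.\<close>
lemma net_minor_dvd:
  fixes d :: "nat \<Rightarrow> nat \<Rightarrow> 'a::comm_ring_1"
  assumes d0: "\<And>i. d i 0 = 1"
    and di: "\<And>i j. Suc i < k \<Longrightarrow> j \<le> q \<Longrightarrow> d i j dvd d (Suc i) j"
    and dj: "\<And>i j. i < k \<Longrightarrow> j < q \<Longrightarrow> d i (Suc j) dvd \<rho> i j * d i j"
    and dd: "\<And>i j. i < k \<Longrightarrow> j < q \<Longrightarrow> d i j dvd d i (Suc j)"
    and i: "i \<le> k" and j: "j \<le> q" and q: "\<And>l. l < k \<Longrightarrow> g l < q + k"
    and card: "i \<le> card {l. l < k \<and> g l + j < q + i}"
  shows "(\<Prod>r<i. d r (j + 1 + r - i)) dvd cdet k (\<lambda>l. netcol k q \<rho> (g l))"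
proof -
  obtain T where T: "T \<subseteq> {l. l < k \<and> g l + j < q + i}" "card T = i"
    using card by (meson obtain_subset_with_card_n)
  have Tk: "T \<subseteq> {..<k}" and fin: "finite T" using T(1) by (auto intro: finite_subset)
  let ?K = "min k (q + i - j)"
  let ?D = "\<lambda>r. d r (j + 1 + r - i)"
  let ?y = "\<lambda>r. ncol k \<rho> (j + 1 + r - i) r"
  show ?thesis
  proof (rule cdet_dvd_span[OF fin Tk, where C = "\<lambda>_. {..<?K}" and y = ?y])
    fix l assume l: "l \<in> T"
    then have gl: "l < k" "g l + j < q + i" using T by auto
    have "\<exists>a. \<forall>r. ncol k \<rho> (q - g l) (g l - q) r = (\<Sum>u<?K. a u * ?y u r)"
      by (rule ncol_span) (use gl q[of l] in auto)
    then show "\<exists>a. \<forall>r<k. netcol k q \<rho> (g l) r = (\<Sum>u<?K. a u * ?y u r)"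
      unfolding netcol_def by blast
  next
    fix f assume f: "\<And>l. l \<in> T \<Longrightarrow> f l \<in> {..<?K}"
    let ?x = "\<lambda>l. if l \<in> T then ?y (f l) else netcol k q \<rho> (g l)"
    show "(\<Prod>r<i. ?D r) dvd cdet k ?x"
    proof (cases "inj_on f T")
      case True
      have "(\<Prod>r<i. ?D r) dvd prod ?D (f ` T)"
      proof (rule prod_chain_dvd[of ?K])
        fix r assume r: "Suc r < ?K"
        show "?D r dvd ?D (Suc r)"
        proof (cases "j + 1 + r \<ge> i")
          case True
          then have "?D r dvd d (Suc r) (j + 1 + r - i)" using di[of r "j + 1 + r - i"] r by auto
          also have "\<dots> dvd d (Suc r) (Suc (j + 1 + r - i))" using dd[of "Suc r" "j + 1 + r - i"] r True by auto
          finally show ?thesis using True by (simp add: Suc_diff_le)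
        next
          case False
          then show ?thesis by (simp add: d0)
        qed
      qed (use f T True in \<open>auto simp: card_image\<close>)
      also have "prod ?D (f ` T) = (\<Prod>l\<in>T. ?D (f l))" using True by (simp add: prod.reindex)
      also have "\<dots> dvd cdet k ?x"
      proof (rule cdet_dvd_prod[OF Tk])
        fix l r assume "l \<in> T" "r < k"
        then show "?D (f l) dvd ?x l r"
          using ncol_dvd[of d k q \<rho> "j + 1 + f l - i" "f l" r] d0 di dj f[of l] by auto
      qed
      finally show ?thesis .
    next
      case False
      then obtain l l' where l: "l \<in> T" "l' \<in> T" "l \<noteq> l'" "f l = f l'" by (auto simp: inj_on_def)
      then have "cdet k ?x = 0" using Tk by (intro cdet_eq_columns[of l _ l']) auto
      then show ?thesis by simp
    qed
  qed
qed

text \<open>\<open>corner q i j\<close> lists the columns of the smallest minor among those that use at least \<open>i\<close> of the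
  columns before \<open>q - j + i\<close>.\<close>
definition corner :: "nat \<Rightarrow> nat \<Rightarrow> nat \<Rightarrow> nat \<Rightarrow> nat" where
  "corner q i j l = (if l < i then q - j + l else q + l)"

text \<open>The columns of \<open>corner q i j\<close> with the identity column \<open>q + i\<close>
  moved to the front. For \<open>j < q\<close> they agree with
  \<open>corner q (Suc i) (Suc j)\<close> everywhere but in position 0.\<close>

definition corner_rot :: "nat \<Rightarrow> nat \<Rightarrow> nat \<Rightarrow> nat \<Rightarrow> nat" where
  "corner_rot q i j l = (if l = 0 then q + i else if l \<le> i then q - j + (l - 1) else q + l)"

lemma corner_rot_sign:
  assumes "i < k"
  shows "\<exists>s. (s = 1 \<or> s = - 1) \<and>
    (\<forall>a. cdet k (\<lambda>l. a (corner_rot q i j l)) = s * cdet k (\<lambda>l. a (corner q i j l) :: nat \<Rightarrow> 'a::comm_ring_1))"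
proof -
  let ?\<sigma> = "\<lambda>l. if l = 0 then i else if l \<le> i then l - 1 else l"
  have b: "bij_betw ?\<sigma> {..<k} {..<k}"
    by (rule bij_betw_byWitness[where f' = "\<lambda>l. if l = i then 0 else if l < i then Suc l else l"])
       (use assms in \<open>auto split: if_splits\<close>)
  have "corner_rot q i j l = corner q i j (?\<sigma> l)" for l
    by (auto simp: corner_def corner_rot_def)
  then show ?thesis using cdet_reorder[OF b, where ?'a = 'a] by auto
qed

text \<open>The unit columns after position \<open>i\<close> clear the entries of \<delta> in rows
  after \<open>i\<close>, and those in rows before \<open>i\<close> are zero.\<close>

lemma cdet_reduce_first:
  assumes i: "i < k"
    and unit: "\<And>l r. i < l \<Longrightarrow> l < k \<Longrightarrow> r < k \<Longrightarrow> x l r = (if r = l then 1 else 0)"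
    and \<delta>: "\<And>r. r < i \<Longrightarrow> \<delta> r = 0"
  shows "cdet k (x(0 := \<delta>)) = \<delta> i * cdet k (x(0 := (\<lambda>r. if r = i then 1 else 0)))"
proof -
  let ?e = "\<lambda>c r. if r = c then 1 else 0"
  have "cdet k (x(0 := \<delta>)) = (\<Sum>c\<in>{i..<k}. \<delta> c * cdet k ((x(0 := \<delta>))(0 := ?e c)))"
  proof (rule cdet_sum)
    fix r assume r: "r < k"
    have "(\<Sum>c\<in>{i..<k}. \<delta> c * ?e c r) = (\<Sum>c\<in>{i..<k}. if c = r then \<delta> c else 0)"
      by (intro sum.cong) auto
    then show "(x(0 := \<delta>)) 0 r = (\<Sum>c\<in>{i..<k}. \<delta> c * ?e c r)" using r \<delta>[of r] by auto
  qed (use i in auto)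
  also have "\<dots> = (\<Sum>c\<in>{i..<k}. if c = i then \<delta> i * cdet k (x(0 := ?e i)) else 0)"
  proof (intro sum.cong refl)
    fix c assume c: "c \<in> {i..<k}"
    have "cdet k (x(0 := ?e c)) = 0" if "c \<noteq> i"
      by (rule cdet_eq_columns[of 0 _ c]) (use c that unit in auto)
    then show "\<delta> c * cdet k ((x(0 := \<delta>))(0 := ?e c)) = (if c = i then \<delta> i * cdet k (x(0 := ?e i)) else 0)"
      by auto
  qed
  finally show ?thesis using i by simp
qed

text \<open>\<open>ncol_step\<close> solved for the next row: it recovers the path sums at inner
  vertices from actual columns of the matrix.\<close>

lemma ncol_span_columns:
  assumes "l < k" "j \<le> q"
  shows "\<exists>a. \<forall>r. ncol k \<rho> j l r = (\<Sum>u\<le>l. a u * netcol k q \<rho> (q - j + u) r)"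
  using assms
proof (induction l arbitrary: j)
  case 0
  have "ncol k \<rho> j 0 r = (\<Sum>u\<le>0. 1 * netcol k q \<rho> (q - j + u) r)" for r
    using 0 by (simp add: netcol_def del: ncol.simps)
  then show ?case by (intro exI[of _ "\<lambda>_. 1"]) blast
next
  case (Suc l)
  show ?case
  proof (cases j)
    case 0
    have "ncol k \<rho> j (Suc l) r = (\<Sum>u\<le>Suc l. (if u = Suc l then 1 else 0) * netcol k q \<rho> (q - j + u) r)" for r
    proof -
      have "(\<Sum>u\<le>Suc l. (if u = Suc l then 1 else 0) * netcol k q \<rho> (q - j + u) r) =
        (\<Sum>u\<le>Suc l. if u = Suc l then netcol k q \<rho> (q - j + u) r else 0)" by (intro sum.cong) auto
      also have "\<dots> = netcol k q \<rho> (q + Suc l) r" using 0 by simp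
      finally show ?thesis using 0 netcol_identity[of k q \<rho> "Suc l" r] by simp
    qed
    then show ?thesis by (intro exI[of _ "\<lambda>u. if u = Suc l then 1 else 0"] allI)
  next
    case (Suc j')
    obtain a where a: "\<And>r. ncol k \<rho> j l r = (\<Sum>u\<le>l. a u * netcol k q \<rho> (q - j + u) r)"
      using Suc.IH[of j] Suc.prems by auto
    obtain a' where a': "\<And>r. ncol k \<rho> j' l r = (\<Sum>u\<le>l. a' u * netcol k q \<rho> (q - j' + u) r)"
      using Suc.IH[of j'] Suc.prems Suc by auto
    have sh: "q - j' + u = q - j + Suc u" for u using Suc Suc.prems by simp
    have "ncol k \<rho> j (Suc l) r = ncol k \<rho> j l r - \<rho> l j' * ncol k \<rho> j' l r" for r
      using ncol_step[of l k \<rho> j' r] Suc Suc.prems by (simp del: ncol.simps)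
    also have "\<dots> r = (\<Sum>u\<le>Suc l. ((if u \<le> l then a u else 0) - (if u = 0 then 0 else \<rho> l j' * a' (u - 1)))
         * netcol k q \<rho> (q - j + u) r)" for r
    proof -
      have 1: "(\<Sum>u\<le>l. a u * netcol k q \<rho> (q - j + u) r) = (\<Sum>u\<le>Suc l. (if u \<le> l then a u else 0) * netcol k q \<rho> (q - j + u) r)"
        by (simp add: sum.atMost_Suc)
      have 2: "\<rho> l j' * (\<Sum>u\<le>l. a' u * netcol k q \<rho> (q - j' + u) r) = 
         (\<Sum>u\<le>Suc l. (if u = 0 then 0 else \<rho> l j' * a' (u - 1)) * netcol k q \<rho> (q - j + u) r)"
        unfolding sum.atMost_Suc_shift sh by (simp add: sum_distrib_left mult_ac)
      show ?thesis unfolding a a' 1 2 left_diff_distrib sum_subtractf ..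
    qed
    finally show ?thesis
      by (intro exI[of _ "\<lambda>u. (if u \<le> l then a u else 0) - (if u = 0 then 0 else \<rho> l j' * a' (u - 1))"] allI)
  qed
qed

text \<open>The part of the first column that comes through rows before \<open>i\<close> lies in the
  span of the next \<open>i\<close> columns. What remains has no entries before row
  \<open>i\<close>, so \<open>cdet_reduce_first\<close> applies. By \<open>ncol_diagonal\<close> the
  factor is the product of the first \<open>Suc j\<close> weights of row \<open>i\<close>.\<close>

lemma net_corner_minor:
  assumes i: "i < k" and j: "j < q"
  shows "cdet k (\<lambda>l. netcol k q \<rho> (corner q (Suc i) (Suc j) l)) =
    ncol k \<rho> (Suc j) i i * cdet k (\<lambda>l. netcol k q \<rho> (corner_rot q i j l))"
proof -
  let ?x = "\<lambda>l. netcol k q \<rho> (corner q (Suc i) (Suc j) l)"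
  have x: "?x (Suc u) = netcol k q \<rho> (q - j + u)" if "u < i" for u
    using that i j by (auto simp: corner_def Suc_diff_Suc)
  obtain b where b: "\<And>l r. l < i \<Longrightarrow> ncol k \<rho> j l r = (\<Sum>u<i. b l u * ?x (Suc u) r)"
  proof -
    have "\<exists>b. \<forall>r. ncol k \<rho> j l r = (\<Sum>u<i. b u * ?x (Suc u) r)" if l: "l < i" for l
    proof -
      obtain a where a: "\<And>r. ncol k \<rho> j l r = (\<Sum>u\<le>l. a u * netcol k q \<rho> (q - j + u) r)"
        using ncol_span_columns[of l k j q \<rho>] l i j by auto
      have "ncol k \<rho> j l r = (\<Sum>u<i. (if u \<le> l then a u else 0) * ?x (Suc u) r)" for r
      proof -
        have "(\<Sum>u\<le>l. a u * netcol k q \<rho> (q - j + u) r) = (\<Sum>u<i. if u \<in> {..l} then a u * ?x (Suc u) r else 0)"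
          by (subst sum.inter_restrict[symmetric]) (use l x in \<open>auto intro!: sum.cong simp: Int_absorb1 subset_iff\<close>)
        then show ?thesis unfolding a by (auto intro!: sum.cong)
      qed
      then show ?thesis by (intro exI[of _ "\<lambda>u. if u \<le> l then a u else 0"] allI)
    qed
    then show ?thesis using that by metis
  qed
  define c where "c u = (\<Sum>l<i. \<rho> l j * b l u)" for u
  have col: "?x 0 r = ncol k \<rho> (Suc j) i r + (\<Sum>u<i. c u * ?x (Suc u) r)" for r
  proof -
    have "?x 0 r = ncol k \<rho> (Suc j) 0 r" using j by (simp add: corner_def netcol_def del: ncol.simps)
    also have "\<dots> = ncol k \<rho> (Suc j) i r + (\<Sum>l<i. \<rho> l j * ncol k \<rho> j l r)"
      using i by (simp add: lessThan_atLeast0 sum.atLeastLessThan_concat[symmetric, of 0 i k])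
    also have "(\<Sum>l<i. \<rho> l j * ncol k \<rho> j l r) = (\<Sum>u<i. c u * ?x (Suc u) r)"
      unfolding c_def by (subst sum_distrib_right, subst sum.swap) (simp add: b sum_distrib_left mult.assoc)
    finally show ?thesis .
  qed
  have "cdet k ?x = (\<Sum>u<Suc i. (if u < i then c u else 1) *
     cdet k (?x(0 := (if u < i then ?x (Suc u) else ncol k \<rho> (Suc j) i))))"
    by (rule cdet_sum) (use i in \<open>auto simp: col\<close>)
  also have "\<dots> = cdet k (?x(0 := ncol k \<rho> (Suc j) i))"
  proof -
    have "cdet k (?x(0 := ?x (Suc u))) = 0" if "u < i" for u
      by (rule cdet_eq_columns[of 0 _ "Suc u"]) (use that i in auto)
    then show ?thesis by (simp del: ncol.simps)
  qed
  also have "\<dots> = ncol k \<rho> (Suc j) i i * cdet k (?x(0 := (\<lambda>r. if r = i then 1 else 0)))"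
    by (rule cdet_reduce_first[OF i])
       (auto simp: ncol_support corner_def netcol_identity simp del: ncol.simps)
  also have "cdet k (?x(0 := (\<lambda>r. if r = i then 1 else 0))) = cdet k (\<lambda>l. netcol k q \<rho> (corner_rot q i j l))"
    by (rule cdet_cong) (use i j in \<open>auto simp: corner_def corner_rot_def netcol_identity Suc_diff_Suc\<close>)
  finally show ?thesis .
qed

text \<open>The matrix is recovered from right to left, and within a column from row 0 on. Once the
  columns to the right and the earlier entries agree, the equation for the corner minor says that
  the discrepancy in row \<open>i\<close> times a nonzero minor is 0.\<close>

lemma net_unique:
  fixes a :: "nat \<Rightarrow> nat \<Rightarrow> 'a::idom"
  assumes unit: "\<And>l r. l < k \<Longrightarrow> r < k \<Longrightarrow> a (q + l) r = (if r = l then 1 else 0)"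
    and eq: "\<And>i j. i < k \<Longrightarrow> j < q \<Longrightarrow> cdet k (\<lambda>l. a (corner q (Suc i) (Suc j) l)) =
       ncol k \<rho> (Suc j) i i * cdet k (\<lambda>l. a (corner_rot q i j l))"
    and nz: "\<And>i j. i < k \<Longrightarrow> j < q \<Longrightarrow> cdet k (\<lambda>l. a (corner_rot q i j l)) \<noteq> 0"
    and c: "c < q + k" and r: "r < k"
  shows "a c r = netcol k q \<rho> c r"
proof -
  have "a (q - j + u) r = netcol k q \<rho> (q - j + u) r" if "j \<le> q" "u < j + k" "r < k" for j u r
    using that
  proof (induction j arbitrary: u r)
    case 0
    then show ?case by (simp add: unit netcol_identity)
  next
    case (Suc j)
    have IH: "a c r = netcol k q \<rho> c r" if "q - j \<le> c" "c < q + k" "r < k" for c r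
      using Suc.IH[of "c - (q - j)" r] that Suc.prems(1) by auto
    show ?case
    proof (cases u)
      case (Suc v)
      then show ?thesis using IH[of "q - Suc j + u" r] Suc.prems by auto
    next
      case u: 0
      define \<delta> where "\<delta> r = a (q - Suc j) r - netcol k q \<rho> (q - Suc j) r" for r
      have "\<delta> i = 0" if "i < k" for i
        using that
      proof (induction i rule: less_induct)
        case (less i)
        let ?x = "\<lambda>l. a (corner q (Suc i) (Suc j) l)" and ?y = "\<lambda>l. netcol k q \<rho> (corner q (Suc i) (Suc j) l)"
        have j: "j < q" using Suc.prems by simp
        have rot: "cdet k (\<lambda>l. a (corner_rot q i j l)) = cdet k (\<lambda>l. netcol k q \<rho> (corner_rot q i j l))"
          by (rule cdet_cong, rule IH) (use less.prems j in \<open>auto simp: corner_rot_def\<close>)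
        have rot': "cdet k (?x(0 := (\<lambda>r. if r = i then 1 else 0))) = cdet k (\<lambda>l. a (corner_rot q i j l))"
          by (rule cdet_cong) (use less.prems j in \<open>auto simp: corner_def corner_rot_def unit Suc_diff_Suc\<close>)
        have "cdet k ?x = cdet k (?x(0 := netcol k q \<rho> (q - Suc j))) + 1 * cdet k (?x(0 := \<delta>))"
          by (rule cdet_add) (use less.prems in \<open>auto simp: corner_def \<delta>_def\<close>)
        also have "cdet k (?x(0 := netcol k q \<rho> (q - Suc j))) = cdet k ?y"
        proof (rule cdet_cong)
          fix l r assume "l < k" "r < k"
          then show "(?x(0 := netcol k q \<rho> (q - Suc j))) l r = ?y l r"
            using IH[of "corner q (Suc i) (Suc j) l" r] less.prems j by (auto simp: corner_def)
        qed
        also have "cdet k (?x(0 := \<delta>)) = \<delta> i * cdet k (\<lambda>l. a (corner_rot q i j l))"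
          unfolding rot'[symmetric]
          by (rule cdet_reduce_first[OF less.prems])
             (use less in \<open>auto simp: corner_def unit\<close>)
        finally have "\<delta> i * cdet k (\<lambda>l. a (corner_rot q i j l)) = 0"
          using eq[OF less.prems j] net_corner_minor[OF less.prems j, of \<rho>] rot by simp
        then show ?case using nz[OF less.prems j] by simp
      qed
      then show ?thesis using u Suc.prems by (simp add: \<delta>_def)
    qed
  qed
  from this[of q c r] c r show ?thesis by simp
qed

section \<open>Orders of power series\<close>

lemma t_order_eq_infinity [simp]: "t_order x = \<infinity> \<longleftrightarrow> x = 0"
  unfolding t_order_def by simp

lemma t_order_0 [simp]: "t_order 0 = \<infinity>"
  unfolding t_order_def by simp

lemma t_order_nonzero: "x \<noteq> 0 \<Longrightarrow> t_order x = enat (subdegree x)"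
  unfolding t_order_def by simp

lemma t_power_add: "t_power (d + e) = (t_power d * t_power e :: 'a::comm_ring_1 fps)"
  unfolding t_power_def by (cases d; cases e) (auto simp: power_add)

lemma t_power_0 [simp]: "t_power 0 = 1"
  unfolding t_power_def by (simp add: zero_enat_def)

lemma t_power_infinity [simp]: "t_power \<infinity> = 0"
  unfolding t_power_def by simp

lemma t_power_enat: "t_power (enat d) = fps_X ^ d"
  unfolding t_power_def by simp

lemma t_power_sum: "t_power (sum f A) = (\<Prod>i\<in>A. t_power (f i) :: 'a::comm_ring_1 fps)" if "finite A"
  using that by (induction A rule: finite_induct) (auto simp: t_power_add)

lemma t_power_mono_dvd: "d \<le> e \<Longrightarrow> (t_power d :: 'a::comm_ring_1 fps) dvd t_power e"
  by (metis dvd_triv_left le_iff_add t_power_add)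

lemma t_power_dvd_iff_nth:
  fixes x :: "'a::comm_ring_1 fps"
  shows "t_power e dvd x \<longleftrightarrow> (\<forall>p. enat p < e \<longrightarrow> fps_nth x p = 0)"
proof (cases e)
  case (enat d)
  have "fps_X ^ d dvd x \<longleftrightarrow> (\<forall>p<d. fps_nth x p = 0)"
  proof
    assume "fps_X ^ d dvd x"
    then show "\<forall>p<d. fps_nth x p = 0" by (auto elim!: dvdE simp: fps_X_power_mult_nth)
  next
    assume "\<forall>p<d. fps_nth x p = 0"
    then have "x = fps_X ^ d * fps_shift d x" by (intro fps_ext) (auto simp: fps_X_power_mult_nth)
    then show "fps_X ^ d dvd x" by (metis dvd_triv_left)
  qed
  then show ?thesis using enat by (simp add: t_power_enat)
next
  case infinity
  then show ?thesis by (auto intro: fps_ext)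
qed

lemma t_power_dvd_iff:
  fixes x :: "'a::comm_ring_1 fps"
  shows "t_power e dvd x \<longleftrightarrow> e \<le> t_order x"
proof (cases "x = 0")
  case False
  have "(\<forall>p. enat p < e \<longrightarrow> fps_nth x p = 0) \<longleftrightarrow> e \<le> enat (subdegree x)"
    using False by (metis enat_ord_simps(2) leD leI nth_less_subdegree_zero nth_subdegree_nonzero order_less_le_trans)
  then show ?thesis unfolding t_power_dvd_iff_nth using False by (simp add: t_order_nonzero)
qed simp

lemma t_order_mult: "t_order (x * y) = t_order x + t_order (y :: 'a::idom fps)"
  by (cases "x = 0"; cases "y = 0") (auto simp: t_order_nonzero)

lemma t_order_one [simp]: "t_order (1 :: 'a::comm_ring_1 fps) = 0"
  by (simp add: t_order_nonzero zero_enat_def)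

lemma t_order_minus [simp]: "t_order (- x) = t_order (x :: 'a::comm_ring_1 fps)"
  by (cases "x = 0") (auto simp: t_order_nonzero)

lemma t_order_t_power [simp]: "t_order (t_power e :: 'a::idom fps) = e"
  by (cases e) (auto simp: t_power_enat t_order_nonzero subdegree_power)

lemma t_order_sign: "s = 1 \<or> s = -1 \<Longrightarrow> t_order (s * x) = t_order (x :: 'a::comm_ring_1 fps)"
  by auto

text \<open>Power series over a field form a valuation ring. This turns inequalities between orders
  of minors into the quotients that serve as network weights.\<close>

lemma dvd_iff_t_order: "x dvd y \<longleftrightarrow> t_order x \<le> t_order (y :: 'a::field fps)"
  by (cases "x = 0"; cases "y = 0") (auto simp: t_order_nonzero fps_dvd_iff)

lemma t_order_unit_iff: "t_order x = 0 \<longleftrightarrow> (x :: 'a::field fps) dvd 1"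
  unfolding dvd_iff_t_order by simp

text \<open>Orders below \<open>N\<close> are visible modulo \<open>t^N\<close>; the
  \<open>min\<close> takes care of larger and infinite ones.\<close>

lemma t_order_min_diff:
  assumes "t_power (enat N) dvd x - (y :: 'a::comm_ring_1 fps)"
  shows "min (enat N) (t_order x) \<le> t_order y"
proof -
  let ?e = "min (enat N) (t_order x)"
  have "t_power ?e dvd x" by (simp add: t_power_dvd_iff)
  moreover have "t_power ?e dvd x - y"
    using assms t_power_mono_dvd[of ?e "enat N"] by (auto intro: dvd_trans)
  ultimately have "t_power ?e dvd y" by (metis diff_diff_eq2 add_diff_cancel_left' dvd_diff)
  then show ?thesis by (simp add: t_power_dvd_iff)
qed

section \<open>Generic column operations\<close>

definition minor :: "nat \<Rightarrow> (nat \<Rightarrow> nat \<Rightarrow> 'a) \<Rightarrow> (nat \<Rightarrow> nat) \<Rightarrow> 'a::comm_ring_1" where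
  "minor k a f = cdet k (\<lambda>l. a (f l))"

definition selections :: "nat \<Rightarrow> nat \<Rightarrow> (nat \<Rightarrow> nat) set" where
  "selections k n = {f \<in> {..<k} \<rightarrow>\<^sub>E {..<n}. inj_on f {..<k}}"

definition col_op :: "nat \<Rightarrow> nat \<Rightarrow> 'a \<Rightarrow> (nat \<Rightarrow> nat \<Rightarrow> 'a) \<Rightarrow> nat \<Rightarrow> nat \<Rightarrow> 'a::comm_ring_1" where
  "col_op c m z a = a(c := (\<lambda>r. a c r + z * a m r))"

lemma finite_selections: "finite (selections k n)"
  unfolding selections_def by (rule finite_subset[of _ "{..<k} \<rightarrow>\<^sub>E {..<n}"]) (auto intro: finite_PiE)

lemma minor_cong: "(\<And>l. l < k \<Longrightarrow> f l = g l) \<Longrightarrow> minor k a f = minor k a g"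
  unfolding minor_def by (rule cdet_cong) auto

lemma minor_restrict: "minor k a (restrict f {..<k}) = minor k a f"
  by (rule minor_cong) auto

lemma minor_not_inj: "\<not> inj_on f {..<k} \<Longrightarrow> minor k a f = 0"
  unfolding minor_def inj_on_def by (auto intro: cdet_eq_columns)

lemma restrict_selections: "inj_on f {..<k} \<Longrightarrow> (\<And>l. l < k \<Longrightarrow> f l < n) \<Longrightarrow> restrict f {..<k} \<in> selections k n"
  unfolding selections_def by auto

lemma minor_col_op:
  assumes f: "inj_on f {..<k}" and l: "l < k" "f l = c"
  shows "minor k (col_op c m z a) f = minor k a f + z * minor k a (f(l := m))"
proof -
  have ne: "f l' \<noteq> c" if "l' < k" "l' \<noteq> l" for l' using f l that by (auto simp: inj_on_def)
  have "minor k (col_op c m z a) f = cdet k ((\<lambda>l. col_op c m z a (f l))(l := a c))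
      + z * cdet k ((\<lambda>l. col_op c m z a (f l))(l := a m))"
    unfolding minor_def by (rule cdet_add) (use l in \<open>auto simp: col_op_def\<close>)
  also have "cdet k ((\<lambda>l. col_op c m z a (f l))(l := a c)) = minor k a f"
    unfolding minor_def by (rule cdet_cong) (use l ne in \<open>auto simp: col_op_def\<close>)
  also have "cdet k ((\<lambda>l. col_op c m z a (f l))(l := a m)) = minor k a (f(l := m))"
    unfolding minor_def by (rule cdet_cong) (use l ne in \<open>auto simp: col_op_def\<close>)
  finally show ?thesis .
qed

lemma minor_col_op_unchanged:
  "(\<And>l. l < k \<Longrightarrow> f l \<noteq> c) \<Longrightarrow> minor k (col_op c m z a) f = minor k a f"
  unfolding minor_def by (rule cdet_cong) (auto simp: col_op_def)

text \<open>At the smaller of the two orders the coefficient of the sum is a nonzero affine function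
  of the scalar, with at most one zero.\<close>

lemma finite_bad_scalars:
  fixes x y :: "'a::field fps"
  assumes "x \<noteq> 0 \<or> y \<noteq> 0"
  shows "finite {\<epsilon>. \<not> (x + fps_const \<epsilon> * y \<noteq> 0 \<and> t_order (x + fps_const \<epsilon> * y) \<le> t_order x \<and>
     t_order (x + fps_const \<epsilon> * y) \<le> t_order y)}"
proof -
  define e where "e = min (t_order x) (t_order y)"
  have "e \<noteq> \<infinity>" using assms by (cases "t_order x"; cases "t_order y") (auto simp: e_def)
  then obtain d where d: "e = enat d" by (cases e) auto
  have nz: "fps_nth x d \<noteq> 0 \<or> fps_nth y d \<noteq> 0"
  proof (cases "t_order x \<le> t_order y")
    case True
    then have "t_order x = enat d" using d e_def by auto
    then show ?thesis by (cases "x = 0") (auto simp: t_order_nonzero)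
  next
    case False
    then have "t_order y = enat d" using d e_def by (auto simp: min_def)
    then show ?thesis by (cases "y = 0") (auto simp: t_order_nonzero)
  qed
  have good: "x + fps_const \<epsilon> * y \<noteq> 0 \<and> t_order (x + fps_const \<epsilon> * y) \<le> t_order x \<and>
     t_order (x + fps_const \<epsilon> * y) \<le> t_order y" if "fps_nth x d + \<epsilon> * fps_nth y d \<noteq> 0" for \<epsilon>
  proof -
    have c: "fps_nth (x + fps_const \<epsilon> * y) d \<noteq> 0" using that by simp
    then have n: "x + fps_const \<epsilon> * y \<noteq> 0" by (metis fps_zero_nth)
    have "t_order (x + fps_const \<epsilon> * y) \<le> enat d"
      unfolding t_order_nonzero[OF n] using c by (simp add: subdegree_leI)
    then show ?thesis using n d e_def by (auto simp: min_def split: if_splits)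
  qed
  have "finite {\<epsilon>. fps_nth x d + \<epsilon> * fps_nth y d = 0}"
  proof (cases "fps_nth y d = 0")
    case True
    then show ?thesis using nz by simp
  next
    case False
    have "{\<epsilon>. fps_nth x d + \<epsilon> * fps_nth y d = 0} \<subseteq> {- fps_nth x d / fps_nth y d}"
      using False by (auto simp: field_simps add_eq_0_iff)
    then show ?thesis by (rule finite_subset) simp
  qed
  then show ?thesis by (rule finite_subset[rotated]) (use good in blast)
qed

text \<open>All scalars but finitely many keep every minor from cancelling.\<close>
lemma exists_good_scalar:
  fixes a :: "nat \<Rightarrow> nat \<Rightarrow> 'a::field fps"
  assumes inf: "infinite (UNIV :: 'a set)" and z: "z \<noteq> 0"
  shows "\<exists>\<epsilon>. \<forall>f \<in> selections k n. \<forall>l<k. f l = c \<longrightarrow>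
     (minor k a f \<noteq> 0 \<or> minor k a (f(l := m)) \<noteq> 0) \<longrightarrow>
     minor k (col_op c m (fps_const \<epsilon> * z) a) f \<noteq> 0 \<and>
     t_order (minor k (col_op c m (fps_const \<epsilon> * z) a) f) \<le> t_order (minor k a f) \<and>
     t_order (minor k (col_op c m (fps_const \<epsilon> * z) a) f) \<le> t_order (z * minor k a (f(l := m)))"
proof -
  let ?S = "{(f, l). f \<in> selections k n \<and> l < k \<and> (minor k a f \<noteq> 0 \<or> z * minor k a (f(l := m)) \<noteq> 0)}"
  let ?bad = "\<lambda>(f, l). {\<epsilon>. \<not> (minor k a f + fps_const \<epsilon> * (z * minor k a (f(l := m))) \<noteq> 0 \<and>
     t_order (minor k a f + fps_const \<epsilon> * (z * minor k a (f(l := m)))) \<le> t_order (minor k a f) \<and>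
     t_order (minor k a f + fps_const \<epsilon> * (z * minor k a (f(l := m)))) \<le> t_order (z * minor k a (f(l := m))))}"
  have "finite ?S"
    by (rule finite_subset[of _ "selections k n \<times> {..<k}"]) (auto simp: finite_selections)
  moreover have "finite (?bad p)" if "p \<in> ?S" for p
  proof -
    obtain f l where p: "p = (f, l)" by (cases p)
    have "minor k a f \<noteq> 0 \<or> z * minor k a (f(l := m)) \<noteq> 0" using that p by simp
    from finite_bad_scalars[OF this] show ?thesis unfolding p by simp
  qed
  ultimately have fin: "finite (\<Union>p\<in>?S. ?bad p)" by (rule finite_UN_I)
  obtain \<epsilon> where \<epsilon>: "\<epsilon> \<notin> (\<Union>p\<in>?S. ?bad p)" by (rule exE[OF ex_new_if_finite[OF inf fin]])
  show ?thesis
  proof (intro exI[of _ \<epsilon>] ballI allI impI)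
    fix f l assume f: "f \<in> selections k n" and l: "l < k" "f l = c"
      and nz: "minor k a f \<noteq> 0 \<or> minor k a (f(l := m)) \<noteq> 0"
    have eq: "minor k (col_op c m (fps_const \<epsilon> * z) a) f = minor k a f + fps_const \<epsilon> * (z * minor k a (f(l := m)))"
      using f l by (subst minor_col_op[of _ _ l]) (auto simp: selections_def mult.assoc)
    have "(f, l) \<in> ?S" using f l nz z by auto
    then have "\<epsilon> \<notin> ?bad (f, l)" using \<epsilon> by blast
    then show "minor k (col_op c m (fps_const \<epsilon> * z) a) f \<noteq> 0 \<and>
     t_order (minor k (col_op c m (fps_const \<epsilon> * z) a) f) \<le> t_order (minor k a f) \<and>
     t_order (minor k (col_op c m (fps_const \<epsilon> * z) a) f) \<le> t_order (z * minor k a (f(l := m)))"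
      unfolding eq by simp
  qed
qed

text \<open>Change \<open>g\<close> into \<open>f\<close> one column at a time and stop at the first
  nonzero minor. If the wanted column already occurs elsewhere in \<open>g\<close>, two columns of
  \<open>f\<close> are swapped instead: this only changes the sign of its minor and also lowers the
  number of differences.\<close>

lemma exists_neighbour_minor:
  fixes a :: "nat \<Rightarrow> nat \<Rightarrow> 'a::comm_ring_1"
  assumes f: "f \<in> selections k n" "minor k a f \<noteq> 0" and g: "g \<in> selections k n" "minor k a g = 0"
  shows "\<exists>g\<in>selections k n. \<exists>l<k. \<exists>m<n. minor k a g = 0 \<and> minor k a (g(l := m)) \<noteq> 0"
  using assms
proof (induction "card {l. l < k \<and> f l \<noteq> g l}" arbitrary: f g rule: less_induct)
  case less
  have "\<exists>l<k. f l \<noteq> g l" using less.prems minor_cong[of k f g a] by metis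
  then obtain l where l: "l < k" "f l \<noteq> g l" by blast
  have fl: "f l < n" using less.prems(1) l(1) by (auto simp: selections_def)
  show ?case
  proof (cases "f l \<in> g ` {..<k}")
    case True
    then obtain l' where l': "l' < k" "g l' = f l" by auto
    have ll': "l' \<noteq> l" using l l' by auto
    let ?\<tau> = "transpose l l'"
    have b: "bij_betw ?\<tau> {..<k} {..<k}"
      using l l' by (intro bij_betw_byWitness[where f' = ?\<tau>]) (auto simp: transpose_def)
    let ?f = "restrict (\<lambda>i. f (?\<tau> i)) {..<k}"
    have sel: "?f \<in> selections k n"
    proof (rule restrict_selections)
      show "inj_on (\<lambda>i. f (?\<tau> i)) {..<k}"
        using comp_inj_on[of ?\<tau> "{..<k}" f] b less.prems(1) by (auto simp: selections_def bij_betw_def comp_def)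
      show "f (?\<tau> i) < n" if "i < k" for i
        using that l l' less.prems(1) by (auto simp: selections_def transpose_def)
    qed
    obtain s :: 'a where s: "s = 1 \<or> s = -1" "\<And>x. cdet k (\<lambda>l. x (?\<tau> l)) = s * cdet k x"
      using cdet_reorder[OF b] by blast
    have "minor k a ?f = s * minor k a f"
      unfolding minor_restrict unfolding minor_def by (rule s(2))
    then have nz: "minor k a ?f \<noteq> 0" using less.prems(2) s(1) by auto
    have "f l' \<noteq> f l" using less.prems(1) l l' ll' by (auto simp: selections_def inj_on_def)
    then have "l' \<in> {i. i < k \<and> f i \<noteq> g i}" using l' by simp
    moreover have "l' \<notin> {i. i < k \<and> ?f i \<noteq> g i}" using l' by simp
    moreover have "{i. i < k \<and> ?f i \<noteq> g i} \<subseteq> {i. i < k \<and> f i \<noteq> g i}"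
    proof
      fix i assume i: "i \<in> {i. i < k \<and> ?f i \<noteq> g i}"
      show "i \<in> {i. i < k \<and> f i \<noteq> g i}"
      proof (cases "i = l \<or> i = l'")
        case True
        then show ?thesis using i l l' by auto
      next
        case False
        then show ?thesis using i by (auto simp: transpose_def split: if_splits)
      qed
    qed
    ultimately have "{i. i < k \<and> ?f i \<noteq> g i} \<subset> {i. i < k \<and> f i \<noteq> g i}" by blast
    then have "card {i. i < k \<and> ?f i \<noteq> g i} < card {i. i < k \<and> f i \<noteq> g i}"
      by (intro psubset_card_mono) auto
    then show ?thesis using less.hyps[OF _ sel nz less.prems(3,4)] by blast
  next
    case False
    let ?g = "g(l := f l)"
    show ?thesis
    proof (cases "minor k a ?g = 0")
      case True
      have sel: "?g \<in> selections k n"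
        using less.prems(3) \<open>f l \<notin> g ` {..<k}\<close> l fl
        by (auto simp: selections_def PiE_iff extensional_def intro!: inj_on_fun_updI)
      have "{i. i < k \<and> f i \<noteq> ?g i} \<subset> {i. i < k \<and> f i \<noteq> g i}" using l by auto
      then have "card {i. i < k \<and> f i \<noteq> ?g i} < card {i. i < k \<and> f i \<noteq> g i}"
        by (intro psubset_card_mono) auto
      then show ?thesis using less.hyps[OF _ less.prems(1,2) sel True] by blast
    next
      case False
      then show ?thesis using less.prems(3,4) l fl by blast
    qed
  qed
qed

text \<open>Each step adds a generic multiple of \<open>t^N\<close> times one column to another.
  This makes a zero minor with a nonzero neighbour nonzero and keeps all nonzero ones.\<close>

lemma perturb_minors_nonzero:
  fixes a :: "nat \<Rightarrow> nat \<Rightarrow> 'a::field fps"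
  assumes inf: "infinite (UNIV :: 'a set)"
    and f: "f \<in> selections k n" "minor k a f \<noteq> 0"
  shows "\<exists>a'. (\<forall>g\<in>selections k n. minor k a' g \<noteq> 0) \<and> (\<forall>c r. fps_X ^ N dvd a' c r - a c r)"
  using f
proof (induction "card {g \<in> selections k n. minor k a g = 0}" arbitrary: a rule: less_induct)
  case less
  show ?case
  proof (cases "\<forall>g\<in>selections k n. minor k a g \<noteq> 0")
    case True
    then show ?thesis by (intro exI[of _ a]) simp
  next
    case False
    then obtain g l m where g: "g \<in> selections k n" "l < k" "minor k a g = 0" "minor k a (g(l := m)) \<noteq> 0"
      using exists_neighbour_minor[OF less.prems] by blast
    obtain \<epsilon> where \<epsilon>: "\<And>f' l'. f' \<in> selections k n \<Longrightarrow> l' < k \<Longrightarrow> f' l' = g l \<Longrightarrow>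
       minor k a f' \<noteq> 0 \<or> minor k a (f'(l' := m)) \<noteq> 0 \<Longrightarrow>
       minor k (col_op (g l) m (fps_const \<epsilon> * fps_X ^ N) a) f' \<noteq> 0"
      using exists_good_scalar[OF inf, of "fps_X ^ N" k n "g l" a m] by auto
    let ?a = "col_op (g l) m (fps_const \<epsilon> * fps_X ^ N) a"
    have keep: "minor k ?a f' \<noteq> 0" if "f' \<in> selections k n" "minor k a f' \<noteq> 0" for f'
    proof (cases "\<exists>l'<k. f' l' = g l")
      case True
      then show ?thesis using \<epsilon> that by blast
    next
      case False
      then have "minor k ?a f' = minor k a f'" by (intro minor_col_op_unchanged) auto
      then show ?thesis using that by simp
    qed
    have "{f' \<in> selections k n. minor k ?a f' = 0} \<subset> {f' \<in> selections k n. minor k a f' = 0}"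
      using keep \<epsilon>[OF g(1,2) refl] g by blast
    then have "card {f' \<in> selections k n. minor k ?a f' = 0} < card {f' \<in> selections k n. minor k a f' = 0}"
      by (intro psubset_card_mono) (auto simp: finite_selections)
    then obtain a' where a': "\<forall>g\<in>selections k n. minor k a' g \<noteq> 0" "\<forall>c r. fps_X ^ N dvd a' c r - ?a c r"
      using less.hyps[of ?a] less.prems(1) keep[OF less.prems] by blast
    have "fps_X ^ N dvd a' c r - a c r" for c r
    proof -
      have "fps_X ^ N dvd ?a c r - a c r" by (simp add: col_op_def)
      then have "fps_X ^ N dvd (a' c r - ?a c r) + (?a c r - a c r)" using a'(2) by (blast intro: dvd_add)
      then show ?thesis by simp
    qed
    then show ?thesis using a'(1) by blast
  qed
qed

text \<open>A column that moves one step to the left never lowers the order. If it runs into another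
  column of the minor, the minor is 0 and the condition is void.\<close>

definition descending :: "nat \<Rightarrow> nat \<Rightarrow> (nat \<Rightarrow> nat \<Rightarrow> 'a::comm_ring_1 fps) \<Rightarrow> bool" where
  "descending k n a \<longleftrightarrow> (\<forall>f\<in>selections k n. \<forall>l<k. \<forall>m. f l = Suc m \<longrightarrow>
     t_order (minor k a f) \<le> t_order (minor k a (f(l := m))))"

text \<open>A violation is removed by adding a generic multiple of column \<open>m\<close> to column
  \<open>Suc m\<close>. No order rises and one falls, so the sum of the orders makes the process
  end. The last clause is kept because \<open>m\<close> lies before every bound that
  \<open>Suc m\<close> lies before, so the minor added belongs to the same family.\<close>

lemma exists_descending:
  fixes a :: "nat \<Rightarrow> nat \<Rightarrow> 'a::field fps"
  assumes inf: "infinite (UNIV :: 'a set)"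
    and nz: "\<forall>f\<in>selections k n. minor k a f \<noteq> 0"
  shows "\<exists>a' b. descending k n a' \<and> (\<forall>f\<in>selections k n. minor k a' f \<noteq> 0 \<and>
      t_order (minor k a' f) \<le> t_order (minor k a f)) \<and>
    (\<forall>c c'. c < c' \<longrightarrow> b c' c = 0) \<and> (\<forall>c r. c < n \<longrightarrow> a c r = (\<Sum>c'<n. b c' c * a' c' r)) \<and>
    (\<forall>i B e. (\<forall>f\<in>selections k n. i \<le> card {l. l < k \<and> f l < B} \<longrightarrow> e \<le> t_order (minor k a f)) \<longrightarrow>
      (\<forall>f\<in>selections k n. i \<le> card {l. l < k \<and> f l < B} \<longrightarrow> e \<le> t_order (minor k a' f)))"
  using nz
proof (induction "\<Sum>f\<in>selections k n. subdegree (minor k a f)" arbitrary: a rule: less_induct)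
  case less
  show ?case
  proof (cases "descending k n a")
    case True
    have "(\<Sum>c'<n. (if c' = c then 1 else 0) * a c' r) = a c r" if "c < n" for c r
      using that by (subst sum_unit_coeff) auto
    then show ?thesis using True less.prems
      by (intro exI[of _ a] exI[of _ "\<lambda>c' c. if c' = c then 1 else 0"]) auto
  next
    case False
    then obtain g l m where g: "g \<in> selections k n" "l < k" "g l = Suc m"
      "\<not> t_order (minor k a g) \<le> t_order (minor k a (g(l := m)))"
      unfolding descending_def by blast
    have "g l < n" using g(1,2) by (simp add: selections_def PiE_iff)
    then have gn: "Suc m < n" using g(3) by simp
    obtain \<epsilon> where \<epsilon>: "\<And>f' l'. f' \<in> selections k n \<Longrightarrow> l' < k \<Longrightarrow> f' l' = Suc m \<Longrightarrow>
       minor k (col_op (Suc m) m (fps_const \<epsilon>) a) f' \<noteq> 0 \<and>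
       t_order (minor k (col_op (Suc m) m (fps_const \<epsilon>) a) f') \<le> t_order (minor k a f') \<and>
       t_order (minor k (col_op (Suc m) m (fps_const \<epsilon>) a) f') \<le> t_order (minor k a (f'(l' := m)))"
      using exists_good_scalar[OF inf, of 1 k n "Suc m" a m] less.prems by auto
    let ?a = "col_op (Suc m) m (fps_const \<epsilon>) a"
    have keep: "minor k ?a f' \<noteq> 0 \<and> t_order (minor k ?a f') \<le> t_order (minor k a f')"
      if "f' \<in> selections k n" for f'
    proof (cases "\<exists>l'<k. f' l' = Suc m")
      case True
      then show ?thesis using \<epsilon> that by blast
    next
      case False
      then have "minor k ?a f' = minor k a f'" by (intro minor_col_op_unchanged) auto
      then show ?thesis using that less.prems by simp
    qed
    have le: "subdegree (minor k ?a f') \<le> subdegree (minor k a f')" if "f' \<in> selections k n" for f'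
      using keep[OF that] less.prems that by (auto simp: t_order_nonzero)
    have "t_order (minor k ?a g) < t_order (minor k a g)"
      using \<epsilon>[OF g(1-3)] g(4) by (meson le_less_trans not_le)
    then have "subdegree (minor k ?a g) < subdegree (minor k a g)"
      using keep[OF g(1)] less.prems g(1) by (simp add: t_order_nonzero)
    then have "(\<Sum>f\<in>selections k n. subdegree (minor k ?a f)) < (\<Sum>f\<in>selections k n. subdegree (minor k a f))"
      using le g(1) by (intro sum_strict_mono_ex1) (auto simp: finite_selections)
    from less.hyps[OF this] keep have "\<exists>a' (b :: nat \<Rightarrow> nat \<Rightarrow> 'a fps). descending k n a' \<and> (\<forall>f\<in>selections k n. minor k a' f \<noteq> 0 \<and>
        t_order (minor k a' f) \<le> t_order (minor k ?a f)) \<and>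
      (\<forall>c c'. c < c' \<longrightarrow> b c' c = 0) \<and> (\<forall>c r. c < n \<longrightarrow> ?a c r = (\<Sum>c'<n. b c' c * a' c' r)) \<and>
      (\<forall>i B e. (\<forall>f\<in>selections k n. i \<le> card {l. l < k \<and> f l < B} \<longrightarrow> e \<le> t_order (minor k ?a f)) \<longrightarrow>
      (\<forall>f\<in>selections k n. i \<le> card {l. l < k \<and> f l < B} \<longrightarrow> e \<le> t_order (minor k a' f)))" by simp
    then obtain a' b where ih0: "descending k n a' \<and> (\<forall>f\<in>selections k n. minor k a' f \<noteq> 0 \<and>
        t_order (minor k a' f) \<le> t_order (minor k ?a f)) \<and>
      (\<forall>c c'. c < c' \<longrightarrow> b c' c = 0) \<and> (\<forall>c r. c < n \<longrightarrow> ?a c r = (\<Sum>c'<n. b c' c * a' c' r)) \<and>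
      (\<forall>i B e. (\<forall>f\<in>selections k n. i \<le> card {l. l < k \<and> f l < B} \<longrightarrow> e \<le> t_order (minor k ?a f)) \<longrightarrow>
      (\<forall>f\<in>selections k n. i \<le> card {l. l < k \<and> f l < B} \<longrightarrow> e \<le> t_order (minor k a' f)))"
      by (elim exE)
    then have ih: "descending k n a'"
      "\<And>f. f \<in> selections k n \<Longrightarrow> minor k a' f \<noteq> 0 \<and> t_order (minor k a' f) \<le> t_order (minor k ?a f)"
      "\<And>c c'. c < c' \<Longrightarrow> b c' c = 0" "\<And>c r. c < n \<Longrightarrow> ?a c r = (\<Sum>c'<n. b c' c * a' c' r)"
      "(\<forall>i B e. (\<forall>f\<in>selections k n. i \<le> card {l. l < k \<and> f l < B} \<longrightarrow> e \<le> t_order (minor k ?a f)) \<longrightarrow>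
      (\<forall>f\<in>selections k n. i \<le> card {l. l < k \<and> f l < B} \<longrightarrow> e \<le> t_order (minor k a' f)))"
      by simp_all
    have "e \<le> t_order (minor k ?a f)" if cl: "\<forall>f\<in>selections k n. i \<le> card {l. l < k \<and> f l < B} \<longrightarrow> e \<le> t_order (minor k a f)"
      and f: "f \<in> selections k n" "i \<le> card {l. l < k \<and> f l < B}" for i B e f
    proof (cases "\<exists>l<k. f l = Suc m")
      case True
      then obtain l where l: "l < k" "f l = Suc m" by blast
      have inj: "inj_on f {..<k}" using f by (simp add: selections_def)
      have "e \<le> t_order (minor k a (f(l := m)))"
      proof (cases "inj_on (f(l := m)) {..<k}")
        case True
        have "f(l := m) \<in> selections k n"
          using True f(1) l gn by (auto simp: selections_def PiE_iff extensional_def)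
        moreover have "card {l. l < k \<and> f l < B} \<le> card {l'. l' < k \<and> (f(l := m)) l' < B}"
          by (rule card_mono) (use l in auto)
        ultimately show ?thesis using cl f(2) by auto
      next
        case False
        then show ?thesis by (simp add: minor_not_inj)
      qed
      then have "t_power e dvd minor k a f + fps_const \<epsilon> * minor k a (f(l := m))"
        using cl f by (intro dvd_add dvd_mult) (auto simp: t_power_dvd_iff)
      then show ?thesis unfolding minor_col_op[OF inj l] by (simp only: t_power_dvd_iff)
    next
      case False
      then have "minor k ?a f = minor k a f" by (intro minor_col_op_unchanged) auto
      then show ?thesis using cl f by auto
    qed
    then have "(\<forall>i B e. (\<forall>f\<in>selections k n. i \<le> card {l. l < k \<and> f l < B} \<longrightarrow> e \<le> t_order (minor k a f)) \<longrightarrow>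
      (\<forall>f\<in>selections k n. i \<le> card {l. l < k \<and> f l < B} \<longrightarrow> e \<le> t_order (minor k a' f)))" using ih(5) by blast
    note classes = this
    \<comment> \<open>Undoes the operation: column \<open>Suc m\<close> of \<open>a\<close> is that
      of \<open>?a\<close> minus \<epsilon> times column \<open>m\<close>, which is
      unchanged.\<close>
    define b' where "b' c' c = b c' c - (if c = Suc m then fps_const \<epsilon> * b c' m else 0)" for c' c
    have "a c r = (\<Sum>c'<n. b' c' c * a' c' r)" if c: "c < n" for c r
    proof (cases "c = Suc m")
      case True
      have "a c r = ?a c r - fps_const \<epsilon> * ?a m r" using True by (simp add: col_op_def)
      also have "\<dots> = (\<Sum>c'<n. b' c' c * a' c' r)"
        using ih(4)[OF c] ih(4)[of m] gn True
        by (simp add: b'_def sum_subtractf left_diff_distrib sum_distrib_left mult.assoc)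
      finally show ?thesis .
    next
      case False
      then have "a c r = ?a c r" by (simp add: col_op_def)
      then show ?thesis using ih(4)[OF c] False by (simp add: b'_def)
    qed
    moreover have "b' c' c = 0" if "c < c'" for c' c using that ih(3) by (auto simp: b'_def)
    moreover have "minor k a' f \<noteq> 0 \<and> t_order (minor k a' f) \<le> t_order (minor k a f)"
      if "f \<in> selections k n" for f
      using ih(2)[OF that] keep[OF that] by (meson order_trans)
    ultimately show ?thesis using ih(1) classes by (intro exI[of _ a'] exI[of _ b']) simp
  qed
qed

section \<open>Minimality of corner minors\<close>

lemma upward_closed_interval:
  assumes "U \<subseteq> {..<b}" "\<And>m. m \<in> U \<Longrightarrow> Suc m < b \<Longrightarrow> Suc m \<in> U"
  shows "U = {b - card U..<b}"
proof (cases "U = {}")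
  case False
  have fin: "finite U" using assms(1) finite_subset by blast
  define m where "m = Min U"
  have m: "m \<in> U" unfolding m_def using fin False by simp
  have up: "x \<in> U" if "m \<le> x" "x < b" for x
    using that
  proof (induction x rule: dec_induct)
    case (step x)
    then show ?case using assms(2)[of x] by simp
  qed (rule m)
  have "U = {m..<b}" using up assms(1) fin unfolding m_def by auto
  then show ?thesis using m by auto
qed simp

lemma corner_image:
  assumes "i \<le> k" "j \<le> q"
  shows "corner q i j ` {..<k} = {q - j..<q - j + i} \<union> {q + i..<q + k}"
proof
  show "corner q i j ` {..<k} \<subseteq> {q - j..<q - j + i} \<union> {q + i..<q + k}"
    by (auto simp: corner_def)
  show "{q - j..<q - j + i} \<union> {q + i..<q + k} \<subseteq> corner q i j ` {..<k}"
  proof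
    fix c assume "c \<in> {q - j..<q - j + i} \<union> {q + i..<q + k}"
    then show "c \<in> corner q i j ` {..<k}"
    proof
      assume "c \<in> {q - j..<q - j + i}"
      then show ?thesis using assms by (intro image_eqI[of _ _ "c - (q - j)"]) (auto simp: corner_def)
    next
      assume "c \<in> {q + i..<q + k}"
      then show ?thesis using assms by (intro image_eqI[of _ _ "c - q"]) (auto simp: corner_def)
    qed
  qed
qed

lemma corner_inj: "j \<le> q \<Longrightarrow> inj_on (corner q i j) {..<k}"
  by (auto simp: inj_on_def corner_def split: if_splits)

lemma corner_less: "l < k \<Longrightarrow> j \<le> q \<Longrightarrow> corner q i j l < q + k"
  by (auto simp: corner_def)

lemma minor_same_image:
  assumes g: "inj_on g {..<k}" and f: "inj_on f {..<k}" and im: "g ` {..<k} = f ` {..<k}"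
  shows "\<exists>s. (s = 1 \<or> s = - 1) \<and> (\<forall>a. minor k a g = s * minor k a f)"
proof -
  let ?\<sigma> = "\<lambda>l. inv_into {..<k} f (g l)"
  have in': "g l \<in> f ` {..<k}" if "l < k" for l using im that by auto
  have b: "bij_betw ?\<sigma> {..<k} {..<k}"
  proof (rule bij_betwI')
    fix x y assume "x \<in> {..<k}" "y \<in> {..<k}"
    then show "(?\<sigma> x = ?\<sigma> y) = (x = y)" using in' g by (metis f_inv_into_f inj_onD lessThan_iff)
  next
    fix x assume "x \<in> {..<k}"
    then show "?\<sigma> x \<in> {..<k}" by (intro inv_into_into in') simp
  next
    fix y assume y: "y \<in> {..<k}"
    then obtain x where "x \<in> {..<k}" "g x = f y" using im by (metis imageE image_eqI)
    then show "\<exists>x\<in>{..<k}. y = ?\<sigma> x" using y f by (intro bexI[of _ x]) auto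
  qed
  have fs: "f (?\<sigma> l) = g l" if "l < k" for l using in'[OF that] f_inv_into_f by metis
  obtain s :: 'a where s: "s = 1 \<or> s = -1" "\<forall>x. cdet k (\<lambda>l. x (?\<sigma> l)) = s * cdet k x"
    using cdet_reorder[OF b, where ?'a = 'a] by (elim exE conjE)
  have "minor k a g = s * minor k a f" for a
    unfolding minor_def s(2)[rule_format, symmetric] by (rule cdet_cong) (simp add: fs)
  then show ?thesis using s(1) by (intro exI[of _ s]) simp
qed

text \<open>Single columns are pushed to the right as long as the family is not left; by
  \<open>descending\<close> no push raises the order. A selection that admits no push fills an
  interval just before the bound and one at the end, hence is the corner up to the order of its
  columns.\<close>

lemma corner_order_minimal:
  fixes a :: "nat \<Rightarrow> nat \<Rightarrow> 'a::comm_ring_1 fps"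
  assumes desc: "descending k (q + k) a" and i: "i \<le> k" and j: "j \<le> q"
    and g: "\<And>l. l < k \<Longrightarrow> g l < q + k" and card: "i \<le> card {l. l < k \<and> g l + j < q + i}"
  shows "t_order (minor k a (corner q i j)) \<le> t_order (minor k a g)"
  using g card
proof (induction "\<Sum>l<k. q + k - g l" arbitrary: g rule: less_induct)
  case less
  show ?case
  proof (cases "inj_on g {..<k}")
    case False
    then show ?thesis by (simp add: minor_not_inj)
  next
    case inj: True
    let ?n = "q + k" and ?B = "q - j + i" and ?S = "g ` {..<k}"
    let ?cnt = "\<lambda>g. {l. l < k \<and> g l + j < q + i}"
    show ?thesis
    proof (cases "\<exists>l<k. Suc (g l) < ?n \<and> Suc (g l) \<notin> ?S \<and> i \<le> card (?cnt (g(l := Suc (g l))))")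
      case True
      then obtain l where l: "l < k" "Suc (g l) < ?n" "Suc (g l) \<notin> ?S" "i \<le> card (?cnt (g(l := Suc (g l))))"
        by blast
      let ?g = "g(l := Suc (g l))"
      have inj': "inj_on ?g {..<k}" using inj l(3) by (auto intro!: inj_on_fun_updI)
      have "(\<Sum>l<k. ?n - ?g l) < (\<Sum>l<k. ?n - g l)"
        by (rule sum_strict_mono_ex1) (use l in auto)
      then have "t_order (minor k a (corner q i j)) \<le> t_order (minor k a ?g)"
        using l less.prems by (intro less.hyps) auto
      also have "\<dots> = t_order (minor k a (restrict ?g {..<k}))" by (simp only: minor_restrict)
      also have "\<dots> \<le> t_order (minor k a ((restrict ?g {..<k})(l := g l)))"
      proof -
        have "restrict ?g {..<k} \<in> selections k ?n"
          by (rule restrict_selections[OF inj']) (use l less.prems in auto)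
        then show ?thesis using desc l(1) unfolding descending_def by simp
      qed
      also have "minor k a ((restrict ?g {..<k})(l := g l)) = minor k a g" by (rule minor_cong) auto
      finally show ?thesis .
    next
      case False
      let ?S1 = "?S \<inter> {..<?B}" and ?S2 = "?S \<inter> {?B..}"
      have Sn: "?S \<subseteq> {..<?n}" using less.prems by auto
      have cardS: "card ?S = k" using inj by (simp add: card_image)
      have cntS1: "card (?cnt g) = card ?S1"
      proof -
        have "?S1 = g ` ?cnt g" using j by auto
        moreover have "inj_on g (?cnt g)" using inj by (rule inj_on_subset) auto
        ultimately show ?thesis by (simp add: card_image)
      qed
      \<comment> \<open>A gap after \<open>m\<close> can only occur at the bound, and only if no
        column before the bound can be spared.\<close>
      have stuck: "Suc m = ?B \<and> card ?S1 = i" if m: "m \<in> ?S" "Suc m < ?n" "Suc m \<notin> ?S" for m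
      proof -
        obtain l where l: "l < k" "m = g l" using m by auto
        have lt: "card (?cnt (g(l := Suc (g l)))) < i" 
        proof (rule ccontr)
          assume "\<not> card (?cnt (g(l := Suc (g l)))) < i"
          then have "l < k \<and> Suc (g l) < ?n \<and> Suc (g l) \<notin> ?S \<and> i \<le> card (?cnt (g(l := Suc (g l))))"
            using l m by simp
          then show False by (rule notE[OF False, OF exI])
        qed
        show ?thesis
        proof (rule ccontr)
          assume no: "\<not> (Suc m = ?B \<and> card ?S1 = i)"
          show False
          proof (cases "Suc m = ?B")
            case True
            then have "card ?S1 > i" using no less.prems(2) cntS1 by linarith
            moreover have "?cnt g - {l} \<subseteq> ?cnt (g(l := Suc (g l)))" by auto
            then have "card (?cnt g - {l}) \<le> card (?cnt (g(l := Suc (g l))))" by (intro card_mono) auto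
            ultimately show False using lt cntS1 by (simp add: card_Diff_singleton_if split: if_splits)
          next
            case False
            have "?cnt g \<subseteq> ?cnt (g(l := Suc (g l)))"
              using False l(2) j by (auto split: if_splits)
            then have "card (?cnt g) \<le> card (?cnt (g(l := Suc (g l))))" by (intro card_mono) auto
            then show False using lt less.prems(2) by simp
          qed
        qed
      qed
      have S12: "?S = ?S1 \<union> ?S2" by auto
      have S1: "?S1 = {?B - card ?S1..<?B}"
      proof (rule upward_closed_interval)
        fix m assume m: "m \<in> ?S1" "Suc m < ?B"
        moreover have "Suc m < ?n" using m i j by simp
        ultimately have "Suc m \<in> ?S" using stuck[of m] by (metis IntD1 less_irrefl)
        then show "Suc m \<in> ?S1" using m by simp
      qed auto
      \<comment> \<open>With a column to spare there would be no gap at all. The selection would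
        consist of the last \<open>k\<close> columns, of which at most \<open>i\<close> lie before
        the bound.\<close>
      have card1: "card ?S1 = i"
      proof (rule ccontr)
        assume ne: "card ?S1 \<noteq> i"
        have "?S = {?n - card ?S..<?n}"
          by (rule upward_closed_interval[OF Sn]) (use stuck ne in blast)
        then have "?S = {q..<?n}" using cardS by simp
        then have "?S1 = {q..<min ?n ?B}" by auto
        then have "card ?S1 \<le> i" by simp
        then show False using ne less.prems(2) cntS1 by simp
      qed
      have "?S1 \<inter> ?S2 = {}" "finite ?S1" "finite ?S2" by auto
      then have "card ?S = card ?S1 + card ?S2" using S12 by (metis card_Un_disjoint)
      then have card2: "card ?S2 = k - i" using cardS card1 by simp
      have "?S2 = {?n - card ?S2..<?n}"
      proof (rule upward_closed_interval)
        fix m assume "m \<in> ?S2" "Suc m < ?n"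
        then show "Suc m \<in> ?S2" using stuck[of m] by auto
      qed (use Sn in auto)
      then have "?S = {q - j..<q - j + i} \<union> {q + i..<q + k}"
        using S12 S1 card1 card2 i by simp
      then have im: "?S = corner q i j ` {..<k}" using corner_image[OF i j] by simp
      obtain s :: "'a fps" where s: "s = 1 \<or> s = -1" "\<forall>a. minor k a g = s * minor k a (corner q i j)"
        using minor_same_image[OF inj corner_inj[OF j] im, where ?'a = "'a fps"] by (elim exE conjE)
      then show ?thesis by (auto simp: t_order_sign)
    qed
  qed
qed

section \<open>Exchange inequalities for corner minors\<close>

lemma minor_repeated: "u < k \<Longrightarrow> v < k \<Longrightarrow> u \<noteq> v \<Longrightarrow> f u = f v \<Longrightarrow> minor k a f = 0"
  by (rule minor_not_inj) (auto simp: inj_on_def)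

lemma t_order_sum_ge:
  fixes f :: "'b \<Rightarrow> 'a::comm_ring_1 fps"
  assumes "\<And>x. x \<in> A \<Longrightarrow> e \<le> t_order (f x)"
  shows "e \<le> t_order (sum f A)"
  using assms unfolding t_power_dvd_iff[symmetric] by (rule dvd_sum)

text \<open>The identity column \<open>q + i\<close> of the corner \<open>(i, j)\<close> is
  exchanged. Every nonzero term is a product of minors from the families of the two corners on the
  left, which are minimal there. For the differences of diagonally adjacent corner orders this means
  monotonicity in the row.\<close>

lemma corner_exchange_rows:
  fixes a :: "nat \<Rightarrow> nat \<Rightarrow> 'a::field fps"
  assumes desc: "descending k (q + k) a" and nz: "minor k a (corner q (Suc (Suc i)) (Suc j)) \<noteq> 0"
    and i: "Suc (Suc i) \<le> k" and j: "Suc j \<le> q"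
  shows "t_order (minor k a (corner q (Suc i) (Suc j))) + t_order (minor k a (corner q (Suc i) j)) \<le>
    t_order (minor k a (corner q (Suc (Suc i)) (Suc j))) + t_order (minor k a (corner q i j))"
proof -
  let ?x = "corner q (Suc (Suc i)) (Suc j)" and ?y = "corner q i j"
  let ?e = "t_order (minor k a (corner q (Suc i) (Suc j))) + t_order (minor k a (corner q (Suc i) j))"
  have upd: "cdet k ((\<lambda>l. a (f l))(u := a c)) = minor k a (f(u := c))" for f u c
    unfolding minor_def by (rule cdet_cong) auto
  have "minor k a ?x * minor k a ?y =
      (\<Sum>u<k. minor k a (?x(u := ?y i)) * minor k a (?y(i := ?x u)))"
    using cdet_exchange[of i k "\<lambda>l. a (?x l)" "\<lambda>l. a (?y l)"] nz i
    unfolding upd by (simp add: minor_def)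
  also have "?e \<le> t_order \<dots>"
  proof (rule t_order_sum_ge)
    fix u assume "u \<in> {..<k}"
    then have u: "u < k" by simp
    have bound: "(f(v := c)) l < q + k" if "l < k" "c < q + k" "f = ?x \<or> f = ?y" for f v c l
      using that corner_less[of l k _ q] i j by auto
    have main: "e1 + e2 \<le> t_order (p1 * p2)" if "e1 \<le> t_order p1" "e2 \<le> t_order p2" for e1 e2 and p1 p2 :: "'a fps"
      using that by (simp add: t_order_mult add_mono)
    \<comment> \<open>Only the two ends of the shifted block of \<open>?x\<close> contribute: its
      other columns and the identity columns after it already occur in \<open>?y\<close>.\<close>
    consider "u = 0" | "0 < u" "u \<le> i" | "u = Suc i" | "Suc i < u" by linarith
    then show "?e \<le> t_order (minor k a (?x(u := ?y i)) * minor k a (?y(i := ?x u)))"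
    proof cases
      case 1
      have "t_order (minor k a (corner q (Suc i) j)) \<le> t_order (minor k a (?x(u := ?y i)))"
      proof (rule corner_order_minimal[OF desc])
        have "{1..<Suc (Suc i)} \<subseteq> {l. l < k \<and> (?x(u := ?y i)) l + j < q + Suc i}"
          using 1 i j by (auto simp: corner_def)
        from card_mono[OF _ this] show "Suc i \<le> card {l. l < k \<and> (?x(u := ?y i)) l + j < q + Suc i}" by simp
      qed (use i j in \<open>auto intro!: bound simp: corner_less\<close>)
      moreover have "t_order (minor k a (corner q (Suc i) (Suc j))) \<le> t_order (minor k a (?y(i := ?x u)))"
      proof (rule corner_order_minimal[OF desc])
        have "{..<Suc i} \<subseteq> {l. l < k \<and> (?y(i := ?x u)) l + Suc j < q + Suc i}"
          using 1 i j by (auto simp: corner_def)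
        from card_mono[OF _ this] show "Suc i \<le> card {l. l < k \<and> (?y(i := ?x u)) l + Suc j < q + Suc i}" by simp
      qed (use i j u in \<open>auto intro!: bound simp: corner_less\<close>)
      ultimately show ?thesis using main by (metis add.commute)
    next
      case 2
      have "minor k a (?y(i := ?x u)) = 0"
        by (rule minor_repeated[of i _ "u - 1"]) (use 2 i j in \<open>auto simp: corner_def\<close>)
      then show ?thesis by simp
    next
      case 3
      have "t_order (minor k a (corner q (Suc i) (Suc j))) \<le> t_order (minor k a (?x(u := ?y i)))"
      proof (rule corner_order_minimal[OF desc])
        have "{..<Suc i} \<subseteq> {l. l < k \<and> (?x(u := ?y i)) l + Suc j < q + Suc i}"
          using 3 i j by (auto simp: corner_def)
        from card_mono[OF _ this] show "Suc i \<le> card {l. l < k \<and> (?x(u := ?y i)) l + Suc j < q + Suc i}" by simp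
      qed (use i j in \<open>auto intro!: bound simp: corner_less\<close>)
      moreover have "t_order (minor k a (corner q (Suc i) j)) \<le> t_order (minor k a (?y(i := ?x u)))"
      proof (rule corner_order_minimal[OF desc])
        have "{..<Suc i} \<subseteq> {l. l < k \<and> (?y(i := ?x u)) l + j < q + Suc i}"
          using 3 i j by (auto simp: corner_def)
        from card_mono[OF _ this] show "Suc i \<le> card {l. l < k \<and> (?y(i := ?x u)) l + j < q + Suc i}" by simp
      qed (use i j u in \<open>auto intro!: bound simp: corner_less\<close>)
      ultimately show ?thesis using main by metis
    next
      case 4
      have "minor k a (?y(i := ?x u)) = 0"
        by (rule minor_repeated[of i _ u]) (use 4 u in \<open>auto simp: corner_def\<close>)
      then show ?thesis by simp
    qed
  qed
  finally show ?thesis by (simp add: t_order_mult)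
qed

text \<open>Now the last shifted column of the corner \<open>(i, j)\<close> is exchanged, which
  gives monotonicity in the column. For \<open>i = 0\<close> there is no such column, and minimality
  of the corner suffices.\<close>

lemma corner_exchange_columns:
  fixes a :: "nat \<Rightarrow> nat \<Rightarrow> 'a::field fps"
  assumes desc: "descending k (q + k) a" and nz: "minor k a (corner q (Suc i) (Suc (Suc j))) \<noteq> 0"
    and i: "Suc i \<le> k" and j: "Suc (Suc j) \<le> q"
  shows "t_order (minor k a (corner q (Suc i) (Suc j))) + t_order (minor k a (corner q i (Suc j))) \<le>
    t_order (minor k a (corner q (Suc i) (Suc (Suc j)))) + t_order (minor k a (corner q i j))"
proof (cases i)
  case 0
  have "minor k a (corner q 0 (Suc j)) = minor k a (corner q 0 j)" by (rule minor_cong) (simp add: corner_def)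
  moreover have "t_order (minor k a (corner q (Suc 0) (Suc j))) \<le> t_order (minor k a (corner q (Suc 0) (Suc (Suc j))))"
  proof (rule corner_order_minimal[OF desc])
    have "{..<Suc 0} \<subseteq> {l. l < k \<and> corner q (Suc 0) (Suc (Suc j)) l + Suc j < q + Suc 0}"
      using i j by (auto simp: corner_def)
    from card_mono[OF _ this] show "Suc 0 \<le> card {l. l < k \<and> corner q (Suc 0) (Suc (Suc j)) l + Suc j < q + Suc 0}" by simp
  qed (use i j in \<open>auto intro!: corner_less\<close>)
  ultimately show ?thesis using 0 by (simp add: add_right_mono)
next
  case (Suc i')
  let ?x = "corner q (Suc i) (Suc (Suc j))" and ?y = "corner q i j"
  let ?e = "t_order (minor k a (corner q (Suc i) (Suc j))) + t_order (minor k a (corner q i (Suc j)))"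
  have upd: "cdet k ((\<lambda>l. a (f l))(u := a c)) = minor k a (f(u := c))" for f u c
    unfolding minor_def by (rule cdet_cong) auto
  have "minor k a ?x * minor k a ?y =
      (\<Sum>u<k. minor k a (?x(u := ?y i')) * minor k a (?y(i' := ?x u)))"
    using cdet_exchange[of i' k "\<lambda>l. a (?x l)" "\<lambda>l. a (?y l)"] nz i Suc
    unfolding upd by (simp add: minor_def)
  also have "?e \<le> t_order \<dots>"
  proof (rule t_order_sum_ge)
    fix u assume "u \<in> {..<k}"
    then have u: "u < k" by simp
    have bound: "(f(v := c)) l < q + k" if "l < k" "c < q + k" "f = ?x \<or> f = ?y" for f v c l
      using that corner_less[of l k _ q] i j by auto
    have main: "e1 + e2 \<le> t_order (p1 * p2)" if "e1 \<le> t_order p1" "e2 \<le> t_order p2" for e1 e2 and p1 p2 :: "'a fps"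
      using that by (simp add: t_order_mult add_mono)
    \<comment> \<open>Only the first two columns of \<open>?x\<close> are missing in
      \<open>?y\<close>.\<close>
    consider "u < 2" | "2 \<le> u" "u \<le> i" | "i < u" by linarith
    then show "?e \<le> t_order (minor k a (?x(u := ?y i')) * minor k a (?y(i' := ?x u)))"
    proof cases
      case 1
      have "t_order (minor k a (corner q (Suc i) (Suc j))) \<le> t_order (minor k a (?x(u := ?y i')))"
      proof (rule corner_order_minimal[OF desc])
        have "{..<Suc i} \<subseteq> {l. l < k \<and> (?x(u := ?y i')) l + Suc j < q + Suc i}"
          using 1 i j Suc by (auto simp: corner_def)
        from card_mono[OF _ this] show "Suc i \<le> card {l. l < k \<and> (?x(u := ?y i')) l + Suc j < q + Suc i}" by simp
      qed (use i j Suc in \<open>auto intro!: bound simp: corner_less\<close>)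
      moreover have "t_order (minor k a (corner q i (Suc j))) \<le> t_order (minor k a (?y(i' := ?x u)))"
      proof (rule corner_order_minimal[OF desc])
        have "{..<i} \<subseteq> {l. l < k \<and> (?y(i' := ?x u)) l + Suc j < q + i}"
          using 1 i j Suc by (auto simp: corner_def)
        from card_mono[OF _ this] show "i \<le> card {l. l < k \<and> (?y(i' := ?x u)) l + Suc j < q + i}" by simp
      qed (use i j u in \<open>auto intro!: bound simp: corner_less\<close>)
      ultimately show ?thesis using main by metis
    next
      case 2
      have "minor k a (?y(i' := ?x u)) = 0"
        by (rule minor_repeated[of i' _ "u - 2"]) (use 2 i j Suc in \<open>auto simp: corner_def\<close>)
      then show ?thesis by simp
    next
      case 3
      have "minor k a (?y(i' := ?x u)) = 0"
        by (rule minor_repeated[of i' _ u]) (use 3 u Suc in \<open>auto simp: corner_def\<close>)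
      then show ?thesis by simp
    qed
  qed
  finally show ?thesis by (simp add: t_order_mult)
qed

section \<open>Network form of an arc\<close>

text \<open>Cramer's rule; as the determinant of the last \<open>k\<close> columns is a unit, no
  order changes.\<close>

lemma exists_normalization:
  fixes a :: "nat \<Rightarrow> nat \<Rightarrow> 'a::field fps"
  assumes unit: "t_order (minor k a (\<lambda>l. q + l)) = 0"
  shows "\<exists>a'. (\<forall>c r. r < k \<longrightarrow> a c r = (\<Sum>s<k. a (q + s) r * a' c s)) \<and>
    (\<forall>l<k. \<forall>r<k. a' (q + l) r = (if r = l then 1 else 0)) \<and>
    (\<forall>f. t_order (minor k a f) = t_order (minor k a' f))"
proof -
  let ?x = "\<lambda>l. a (q + l)"
  let ?D = "cdet k ?x"
  have "?D dvd 1" using unit by (simp add: minor_def t_order_unit_iff)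
  then obtain w where w: "1 = ?D * w" by blast
  have D0: "?D \<noteq> 0" using w by auto
  define a' where "a' c s = w * cdet k (?x(s := a c))" for c s
  have a: "a c r = (\<Sum>s<k. a (q + s) r * a' c s)" if "r < k" for c r
  proof -
    have "a c r = w * (?D * a c r)" using w by (metis mult.assoc mult.commute mult_1)
    also have "\<dots> = (\<Sum>s<k. a (q + s) r * a' c s)"
      unfolding cdet_cramer[OF that D0] a'_def by (simp add: sum_distrib_left mult_ac)
    finally show ?thesis .
  qed
  have id: "a' (q + l) r = (if r = l then 1 else 0)" if "l < k" "r < k" for l r
  proof (cases "r = l")
    case True
    then have "?x(r := a (q + l)) = ?x" by auto
    then show ?thesis using True w unfolding a'_def by (simp add: mult.commute)
  next
    case False
    have "cdet k (?x(r := a (q + l))) = 0" by (rule cdet_eq_columns[of r _ l]) (use that False in auto)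
    then show ?thesis using False unfolding a'_def by simp
  qed
  define g where "g = mat k k (\<lambda>(r, s). a (q + s) r)"
  have dg: "det g = ?D" unfolding g_def cdet_def ..
  have md: "minor k a f = det g * minor k a' f" for f
  proof -
    have "minor k a f = cdet k (\<lambda>l r. \<Sum>s<k. g $$ (r, s) * a' (f l) s)"
      unfolding minor_def
    proof (rule cdet_cong)
      fix l r assume "l < k" "r < k"
      then show "a (f l) r = (\<Sum>s<k. g $$ (r, s) * a' (f l) s)"
        by (subst a) (auto simp: g_def)
    qed
    then show ?thesis unfolding minor_def by (simp add: cdet_mult g_def)
  qed
  have "t_order (det g) = 0" using unit unfolding dg minor_def .
  then have ord: "t_order (minor k a f) = t_order (minor k a' f)" for f
    unfolding md t_order_mult by simp
  show ?thesis by (intro exI[of _ a'] conjI allI impI) (rule ord | rule a id, assumption+)+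
qed

text \<open>\<open>h i j\<close> is made to be the product of the first \<open>j\<close> weights of
  row \<open>i\<close>: it is a quotient of corner minors, and the weights are quotients of
  consecutive \<open>h\<close>. Monotonicity of the orders makes all these divisions possible, and
  \<open>net_unique\<close> identifies the normalized matrix with the resulting network.\<close>

lemma network_of_descending:
  fixes a :: "nat \<Rightarrow> nat \<Rightarrow> 'a::field fps"
  assumes desc: "descending k (q + k) a" and nz: "\<forall>f\<in>selections k (q + k). minor k a f \<noteq> 0"
    and unit: "\<exists>f\<in>selections k (q + k). t_order (minor k a f) = 0"
  shows "\<exists>\<rho> (b :: nat \<Rightarrow> nat \<Rightarrow> nat) g. (\<forall>c r. c < q + k \<longrightarrow> r < k \<longrightarrow> a c r = (\<Sum>s<k. g r s * netcol k q \<rho> c s)) \<and>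
    (\<forall>i. b i 0 = 0) \<and> (\<forall>i j. Suc i < k \<longrightarrow> j \<le> q \<longrightarrow> b i j \<le> b (Suc i) j) \<and>
    (\<forall>i j. i < k \<longrightarrow> j < q \<longrightarrow> b i j \<le> b i (Suc j)) \<and>
    (\<forall>i j. i < k \<longrightarrow> j < q \<longrightarrow> t_order (\<rho> i j) = enat (b i (Suc j) - b i j)) \<and>
    (\<forall>f. (\<forall>l<k. f l < q + k) \<longrightarrow> t_order (minor k (netcol k q \<rho>) f) = t_order (minor k a f)) \<and>
    (\<forall>i j. i \<le> k \<longrightarrow> j \<le> q \<longrightarrow> t_order (minor k a (corner q i j)) = enat (\<Sum>r<i. b r (j + 1 + r - i)))"
proof -
  let ?n = "q + k"
  define A where "A i j = subdegree (minor k a (corner q i j))" for i j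
  have nzc: "minor k a (corner q i j) \<noteq> 0" if "i \<le> k" "j \<le> q" for i j
  proof -
    have "restrict (corner q i j) {..<k} \<in> selections k ?n"
      using that by (intro restrict_selections corner_inj corner_less) auto
    then show ?thesis using nz minor_restrict[of k a] by metis
  qed
  have ordA: "t_order (minor k a (corner q i j)) = enat (A i j)" if "i \<le> k" "j \<le> q" for i j
    using nzc[OF that] by (simp add: t_order_nonzero A_def)
  have corner0: "minor k a (corner q 0 j) = minor k a (\<lambda>l. q + l)"
       "minor k a (corner q i 0) = minor k a (\<lambda>l. q + l)" for i j
    by (rule minor_cong, simp add: corner_def)+
  have unit': "t_order (minor k a (\<lambda>l. q + l)) = 0"
  proof -
    obtain f where f: "f \<in> selections k ?n" "t_order (minor k a f) = 0" using unit by blast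
    have "f l < ?n" if "l < k" for l using f(1) that by (simp add: selections_def PiE_iff)
    then have "t_order (minor k a (corner q 0 0)) \<le> t_order (minor k a f)"
      by (intro corner_order_minimal[OF desc]) auto
    then show ?thesis using f(2) corner0 by simp
  qed
  have A0: "A 0 j = 0" "A i 0 = 0" for i j
    using unit' by (auto simp: A_def corner0 t_order_def zero_enat_def split: if_splits)
  have Amono: "A i j \<le> A (Suc i) (Suc j)" if "i < k" "j < q" for i j
  proof -
    have "t_order (minor k a (corner q i j)) \<le> t_order (minor k a (corner q (Suc i) (Suc j)))"
    proof (rule corner_order_minimal[OF desc])
      have "{..<i} \<subseteq> {l. l < k \<and> corner q (Suc i) (Suc j) l + j < q + i}" using that by (auto simp: corner_def)
      from card_mono[OF _ this] show "i \<le> card {l. l < k \<and> corner q (Suc i) (Suc j) l + j < q + i}" by simp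
    qed (use that in \<open>auto intro!: corner_less\<close>)
    then show ?thesis using ordA that by simp
  qed
  have ex1: "A (Suc i) (Suc j) + A (Suc i) j \<le> A (Suc (Suc i)) (Suc j) + A i j" if "Suc i < k" "j < q" for i j
    using corner_exchange_rows[OF desc nzc, of i j] that by (simp add: ordA)
  have ex2: "A (Suc i) (Suc j) + A i (Suc j) \<le> A (Suc i) (Suc (Suc j)) + A i j" if "i < k" "Suc j < q" for i j
    using corner_exchange_columns[OF desc nzc, of i j] that by (simp add: ordA)
  \<comment> \<open>The order of the quotient of diagonally adjacent corners, that is, of the
    product of the first \<open>j\<close> weights of row \<open>i\<close>.\<close>
  define b where "b i j = (case j of 0 \<Rightarrow> 0 | Suc j \<Rightarrow> A (Suc i) (Suc j) - A i j)" for i j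
  have b0: "b i 0 = 0" for i by (simp add: b_def)
  have bS: "A (Suc i) (Suc j) = A i j + b i (Suc j)" if "i < k" "j < q" for i j
    using Amono[OF that] by (simp add: b_def)
  have b1: "b i j \<le> b (Suc i) j" if "Suc i < k" "j \<le> q" for i j
  proof (cases j)
    case (Suc j')
    then show ?thesis using ex1[of i j'] bS[of i j'] bS[of "Suc i" j'] that by simp
  qed (simp add: b0)
  have b2: "b i j \<le> b i (Suc j)" if "i < k" "j < q" for i j
  proof (cases j)
    case (Suc j')
    then show ?thesis using ex2[of i j'] bS[of i j'] bS[of i "Suc j'"] that by simp
  qed (simp add: b0)
  obtain a' where a': "\<And>c r. r < k \<Longrightarrow> a c r = (\<Sum>s<k. a (q + s) r * a' c s)"
     "\<And>l r. l < k \<Longrightarrow> r < k \<Longrightarrow> a' (q + l) r = (if r = l then 1 else 0)"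
     "\<And>f. t_order (minor k a f) = t_order (minor k a' f)"
    using exists_normalization[OF unit'] by blast
  have ord': "t_order (minor k a' (corner q i j)) = enat (A i j)" if "i \<le> k" "j \<le> q" for i j
    using a'(3) ordA[OF that] by simp
  have ordrot: "t_order (minor k a' (corner_rot q i j)) = enat (A i j)" if ij: "i < k" "j \<le> q" for i j
  proof -
    obtain s :: "'a fps" where s: "s = 1 \<or> s = -1"
      "\<forall>a. cdet k (\<lambda>l. a (corner_rot q i j l)) = s * cdet k (\<lambda>l. a (corner q i j l))"
      using corner_rot_sign[OF ij(1), where ?'a = "'a fps" and q = q and j = j] by (elim exE conjE)
    then have "minor k a' (corner_rot q i j) = s * minor k a' (corner q i j)"
      unfolding minor_def by simp
    then show ?thesis using s(1) ord'[of i j] ij by (auto simp: t_order_sign)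
  qed
  have "\<exists>h. minor k a' (corner q (Suc i) (Suc j)) = minor k a' (corner_rot q i j) * h" if "i < k" "j < q" for i j
  proof -
    have "minor k a' (corner_rot q i j) dvd minor k a' (corner q (Suc i) (Suc j))"
      unfolding dvd_iff_t_order using that by (simp add: ord' ordrot bS)
    then show ?thesis by blast
  qed
  then obtain h0 where h0: "\<And>i j. i < k \<Longrightarrow> j < q \<Longrightarrow>
      minor k a' (corner q (Suc i) (Suc j)) = minor k a' (corner_rot q i j) * h0 i j"
    by metis
  define h where "h i j = (case j of 0 \<Rightarrow> 1 | Suc j \<Rightarrow> h0 i j)" for i j
  have hord: "t_order (h i j) = enat (b i j)" if "i < k" "j \<le> q" for i j
  proof (cases j)
    case 0
    then show ?thesis by (simp add: h_def b0 zero_enat_def)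
  next
    case (Suc j')
    have "enat (A i j' + b i j) = enat (A i j') + t_order (h0 i j')"
      using h0[of i j'] ord'[of "Suc i" j] ordrot[of i j'] bS[of i j'] that Suc by (simp add: t_order_mult)
    then show ?thesis using Suc by (cases "t_order (h0 i j')") (auto simp: h_def)
  qed
  have "\<exists>\<rho>. h i (Suc j) = h i j * \<rho>" if "i < k" "j < q" for i j
  proof -
    have "h i j dvd h i (Suc j)" unfolding dvd_iff_t_order using that b2[OF that] by (simp add: hord)
    then show ?thesis by blast
  qed
  then obtain \<rho> where \<rho>: "\<And>i j. i < k \<Longrightarrow> j < q \<Longrightarrow> h i (Suc j) = h i j * \<rho> i j" by metis
  have \<rho>ord: "t_order (\<rho> i j) = enat (b i (Suc j) - b i j)" if "i < k" "j < q" for i j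
  proof -
    have "enat (b i (Suc j)) = enat (b i j) + t_order (\<rho> i j)"
      using \<rho>[OF that] hord[of i j] hord[of i "Suc j"] that by (simp add: t_order_mult)
    then show ?thesis by (cases "t_order (\<rho> i j)") auto
  qed
  have diag: "ncol k \<rho> j i i = h i j" if "i < k" "j \<le> q" for i j
    using that(2)
  proof (induction j)
    case 0
    then show ?case by (simp add: h_def)
  next
    case (Suc j)
    then show ?case using ncol_diagonal_step[OF that(1), of \<rho> j] \<rho>[of i j] that by (simp add: mult.commute)
  qed
  have net: "a' c r = netcol k q \<rho> c r" if "c < ?n" "r < k" for c r
  proof (rule net_unique[OF _ _ _ that])
    show "a' (q + l) r = (if r = l then 1 else 0)" if "l < k" "r < k" for l r using a'(2) that .
    fix i j assume ij: "i < k" "j < q"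
    show "cdet k (\<lambda>l. a' (corner q (Suc i) (Suc j) l)) = ncol k \<rho> (Suc j) i i * cdet k (\<lambda>l. a' (corner_rot q i j l))"
      using h0[OF ij] diag[of i "Suc j"] ij by (simp add: minor_def h_def mult.commute)
    show "cdet k (\<lambda>l. a' (corner_rot q i j l)) \<noteq> 0"
      using ordrot[of i j] ij by (auto simp: minor_def)
  qed
  have fin1: "a c r = (\<Sum>s<k. a (q + s) r * netcol k q \<rho> c s)" if "c < ?n" "r < k" for c r
    using a'(1)[OF that(2), of c] net[OF that(1)] by simp
  have fin2: "t_order (minor k (netcol k q \<rho>) f) = t_order (minor k a f)" if "\<forall>l<k. f l < ?n" for f
  proof -
    have "minor k (netcol k q \<rho>) f = minor k a' f"
      unfolding minor_def by (rule cdet_cong) (use net that in auto)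
    then show ?thesis using a'(3) by simp
  qed
  \<comment> \<open>Telescoping along a diagonal. After the diagonal has left the grid the truncated
    subtraction gives level 0, where \<open>b\<close> is 0.\<close>
  have AB: "A i j = (\<Sum>r<i. b r (j + 1 + r - i))" if "i \<le> k" "j \<le> q" for i j
    using that
  proof (induction i arbitrary: j)
    case 0
    then show ?case by (simp add: A0)
  next
    case (Suc i)
    show ?case
    proof (cases j)
      case 0
      have "(\<Sum>r<Suc i. b r (j + 1 + r - Suc i)) = 0" using 0 by (auto intro!: sum.neutral simp: b0)
      then show ?thesis using 0 by (simp add: A0)
    next
      case (Suc j')
      then show ?thesis using Suc.IH[of j'] Suc.prems bS[of i j'] by simp
    qed
  qed
  have fin3: "t_order (minor k a (corner q i j)) = enat (\<Sum>r<i. b r (j + 1 + r - i))" if "i \<le> k" "j \<le> q" for i j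
    unfolding ordA[OF that] AB[OF that] ..
  show ?thesis
    by (intro exI[of _ \<rho>] exI[of _ b] exI[of _ "\<lambda>r s. a (q + s) r"] conjI allI impI)
       (rule b0 | rule fin1 fin2 fin3 b1 b2 \<rho>ord, assumption+)+
qed

section \<open>Vanishing polynomials at network arcs\<close>

text \<open>A path uses the edge of weight \<open>z\<close> at most once. \<open>P\<close> collects
  the paths that avoid it, \<open>u\<close> those up to the edge, \<open>G\<close> the continuations
  after it. The vector \<open>u\<close> is common to all vertices, as \<open>cdet_affine\<close>
  requires.\<close>

lemma ncol_affine:
  fixes \<rho> :: "nat \<Rightarrow> nat \<Rightarrow> 'a::comm_ring_1"
  shows "\<exists>P G u. \<forall>z m s r. ncol k (\<lambda>l' j'. if l' = l \<and> j' = j then z else \<rho> l' j') m s r = P m s r + z * (G m s * u r)"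
proof -
  define \<rho>0 where "\<rho>0 l' j' = (if l' = l \<and> j' = j then 0 else \<rho> l' j')" for l' j'
  define u where "u = ncol k \<rho>0 j l"
  define G :: "nat \<Rightarrow> nat \<Rightarrow> 'a" where
    "G = rec_nat (\<lambda>s. 0) (\<lambda>m G s. \<Sum>l'\<in>{s..<k}. \<rho>0 l' m * G l' + (if m = j \<and> l' = l then 1 else 0))"
  have G0: "G 0 s = 0" for s by (simp add: G_def)
  have GS: "G (Suc m) s = (\<Sum>l'\<in>{s..<k}. \<rho>0 l' m * G m l' + (if m = j \<and> l' = l then 1 else 0))" for m s
    by (simp add: G_def)
  have Gz: "m \<le> j \<Longrightarrow> G m s = 0" for m s
    by (induction m arbitrary: s) (auto simp: G0 GS)
  have "ncol k (\<lambda>l' j'. if l' = l \<and> j' = j then z else \<rho> l' j') m s r = ncol k \<rho>0 m s r + z * (G m s * u r)" for z m s r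
  proof (induction m arbitrary: s)
    case 0
    then show ?case by (simp add: G0)
  next
    case (Suc m)
    let ?\<rho> = "\<lambda>l' j'. if l' = l \<and> j' = j then z else \<rho> l' j'"
    have "ncol k ?\<rho> (Suc m) s r = (\<Sum>l'\<in>{s..<k}. ?\<rho> l' m * (ncol k \<rho>0 m l' r + z * (G m l' * u r)))"
      unfolding ncol.simps Suc.IH ..
    also have "\<dots> = (\<Sum>l'\<in>{s..<k}. \<rho>0 l' m * ncol k \<rho>0 m l' r +
        z * ((\<rho>0 l' m * G m l' + (if m = j \<and> l' = l then 1 else 0)) * u r))"
    proof (intro sum.cong refl)
      fix l'
      show "?\<rho> l' m * (ncol k \<rho>0 m l' r + z * (G m l' * u r)) = \<rho>0 l' m * ncol k \<rho>0 m l' r +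
        z * ((\<rho>0 l' m * G m l' + (if m = j \<and> l' = l then 1 else 0)) * u r)"
      proof (cases "m = j \<and> l' = l")
        case True
        then show ?thesis using Gz[of m l'] by (simp add: \<rho>0_def u_def)
      next
        case False
        then have *: "?\<rho> l' m = \<rho>0 l' m" "(if m = j \<and> l' = l then 1 else 0) = (0 :: 'a)"
          by (auto simp: \<rho>0_def)
        show ?thesis unfolding * by (simp add: algebra_simps)
      qed
    qed
    also have "\<dots> = ncol k \<rho>0 (Suc m) s r + z * (G (Suc m) s * u r)"
      by (subst sum.distrib) (simp only: GS ncol.simps sum_distrib_left sum_distrib_right)
    finally show ?case .
  qed
  then show ?thesis
    by (intro exI[of _ "ncol k \<rho>0"] exI[of _ G] exI[of _ u] allI)
qed

lemma minor_net_affine: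
  fixes \<rho> :: "nat \<Rightarrow> nat \<Rightarrow> 'a::comm_ring_1"
  shows "\<exists>a b. \<forall>z. minor k (netcol k q (\<lambda>l' j'. if l' = l \<and> j' = j then z else \<rho> l' j')) f = a + b * z"
proof -
  obtain P G u where *: "\<forall>z m s r. ncol k (\<lambda>l' j'. if l' = l \<and> j' = j then z else \<rho> l' j') m s r = P m s r + z * (G m s * u r)"
    using ncol_affine[of k l j \<rho>] by (elim exE)
  have "minor k (netcol k q (\<lambda>l' j'. if l' = l \<and> j' = j then z else \<rho> l' j')) f =
     cdet k (\<lambda>i. P (q - f i) (f i - q)) + (\<Sum>i<k. G (q - f i) (f i - q) *
       cdet k ((\<lambda>i. P (q - f i) (f i - q))(i := u))) * z" for z
    unfolding minor_def netcol_def *[rule_format] cdet_affine by (simp add: mult.commute)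
  then show ?thesis by (intro exI allI)
qed

section \<open>Weights of monomials\<close>

definition monom_weight :: "('v \<Rightarrow> nat) \<Rightarrow> ('v \<Rightarrow>\<^sub>0 nat) \<Rightarrow> nat" where
  "monom_weight w m = (\<Sum>v\<in>Poly_Mapping.keys m. w v * Poly_Mapping.lookup m v)"

lemma monom_weight_mono:
  assumes "\<And>v. Poly_Mapping.lookup m' v \<le> Poly_Mapping.lookup m v"
  shows "monom_weight w m' \<le> monom_weight w m"
proof -
  have "v \<in> Poly_Mapping.keys m" if "v \<in> Poly_Mapping.keys m'" for v
    using that assms[of v] by (auto simp: in_keys_iff)
  then have "monom_weight w m' \<le> (\<Sum>v\<in>Poly_Mapping.keys m. w v * Poly_Mapping.lookup m' v)"
    unfolding monom_weight_def by (intro sum_mono2) auto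
  also have "\<dots> \<le> monom_weight w m"
    unfolding monom_weight_def by (intro sum_mono mult_left_mono assms) simp
  finally show ?thesis .
qed

lemma monom_eval_dvd:
  assumes "\<And>v. v \<in> Poly_Mapping.keys m \<Longrightarrow> z ^ w v dvd x v"
  shows "z ^ monom_weight w m dvd monom_eval x m"
  unfolding monom_weight_def monom_eval_def power_sum
  by (rule prod_dvd_prod) (auto simp: power_mult intro!: dvd_power_same assms)

lemma comm_ring_hom_fps_const: "comm_ring_hom fps_const"
  by unfold_locales (auto simp: fps_const_add[symmetric] fps_const_mult[symmetric] simp del: fps_const_add fps_const_mult)

lemma fps_const_prod: "(\<Prod>i\<in>A. fps_const (f i)) = fps_const (\<Prod>i\<in>A. f i :: 'a::comm_ring_1)"
  by (induction A rule: infinite_finite_induct) auto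

text \<open>The coefficient of \<open>t^d\<close> after the substitution is the part of
  \<open>f\<close> of weight \<open>d\<close>. For \<open>d < E\<close> it vanishes at all complex
  points, so this part is zero.\<close>

lemma weight_of_divisible:
  fixes f :: "'v cpoly"
  assumes dvd: "\<And>x. fps_X ^ E dvd eval_cpoly fps_const (\<lambda>v. fps_X ^ w v * fps_const (x v)) f"
    and m: "m \<in> Poly_Mapping.keys f"
  shows "E \<le> monom_weight w m"
proof (rule ccontr)
  assume "\<not> E \<le> monom_weight w m"
  then have lt: "monom_weight w m < E" by simp
  let ?d = "monom_weight w m"
  have "eval_cpoly id x (part_poly (\<lambda>m'. monom_weight w m' = ?d) f) = 0" for x :: "'v \<Rightarrow> complex"
  proof -
    have mon: "monom_eval (\<lambda>v. fps_X ^ w v * fps_const (x v)) m' = fps_X ^ monom_weight w m' * fps_const (monom_eval x m')" for m'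
    proof -
      have "monom_eval (\<lambda>v. fps_X ^ w v * fps_const (x v)) m' =
        (\<Prod>v\<in>Poly_Mapping.keys m'. fps_X ^ (w v * Poly_Mapping.lookup m' v)) *
        (\<Prod>v\<in>Poly_Mapping.keys m'. fps_const (x v ^ Poly_Mapping.lookup m' v))"
        unfolding monom_eval_def prod.distrib[symmetric]
        by (intro prod.cong refl) (simp add: power_mult_distrib power_mult fps_const_power)
      also have "(\<Prod>v\<in>Poly_Mapping.keys m'. fps_const (x v ^ Poly_Mapping.lookup m' v)) = fps_const (monom_eval x m')"
        unfolding monom_eval_def
        by (rule fps_const_prod)
      finally show ?thesis unfolding monom_weight_def power_sum .
    qed
    have "t_power (enat E) dvd eval_cpoly fps_const (\<lambda>v. fps_X ^ w v * fps_const (x v)) f"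
      using dvd[of x] by (simp only: t_power_enat)
    from t_power_dvd_iff_nth[THEN iffD1, OF this] lt
    have "0 = fps_nth (eval_cpoly fps_const (\<lambda>v. fps_X ^ w v * fps_const (x v)) f) ?d" by simp
    also have "\<dots> = (\<Sum>m'\<in>Poly_Mapping.keys f. if monom_weight w m' = ?d then
        Poly_Mapping.lookup f m' * monom_eval x m' else 0)"
      unfolding eval_cpoly_monom mon fps_sum_nth
      by (intro sum.cong refl) (auto simp: fps_X_power_mult_nth mult.left_commute[of "fps_const _"])
    also have "\<dots> = eval_cpoly id x (part_poly (\<lambda>m'. monom_weight w m' = ?d) f)"
      unfolding eval_part_poly[OF comm_ring_hom_id'] id_apply by (subst sum.inter_filter) auto
    finally show ?thesis by simp
  qed
  then have "part_poly (\<lambda>m'. monom_weight w m' = ?d) f = 0" by (rule cpoly_eq_zero_if_vanishes)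
  then have "Poly_Mapping.lookup f m = 0"
    using lookup_part_poly[of "\<lambda>m'. monom_weight w m' = ?d" f m] by simp
  then show False using m by (simp add: in_keys_iff)
qed

definition net_class :: "nat \<Rightarrow> nat \<Rightarrow> nat \<Rightarrow> nat \<Rightarrow> (nat \<Rightarrow> nat) set" where
  "net_class k q i j = {f. (\<forall>l<k. f l < q + k) \<and> i \<le> card {l. l < k \<and> f l + j < q + i}}"

text \<open>The variables are indexed by row and column, the entries of \<open>a\<close> by column and row.\<close>
definition vanishing_polys :: "nat \<Rightarrow> nat \<Rightarrow> (nat \<times> nat) set \<Rightarrow> (nat \<times> nat) cpoly set" where
  "vanishing_polys k q J = {F. \<forall>a :: nat \<Rightarrow> nat \<Rightarrow> complex.
     (\<forall>(i, j)\<in>J. \<forall>f\<in>net_class k q i j. minor k a f = 0) \<longrightarrow> eval_cpoly id (\<lambda>(r, c). a c r) F = 0}"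

text \<open>Column \<open>g l\<close> expands into columns not after it, so the multilinear
  expansion stays in the family.\<close>

lemma minor_upper_dvd:
  assumes a: "\<And>c r. c < q + k \<Longrightarrow> r < k \<Longrightarrow> a c r = (\<Sum>c'<q + k. u c' c * a' c' r)"
    and u: "\<And>c c'. c < c' \<Longrightarrow> u c' c = 0"
    and dvd: "\<And>f. f \<in> net_class k q i j \<Longrightarrow> e dvd minor k a' f"
    and g: "g \<in> net_class k q i j"
  shows "e dvd minor k a g"
  unfolding minor_def
proof (rule cdet_dvd_span[where T = "{..<k}" and C = "\<lambda>l. {..g l}" and y = a'])
  fix l assume "l \<in> {..<k}"
  then have gl: "g l < q + k" using g by (auto simp: net_class_def)
  have "a (g l) r = (\<Sum>c'\<le>g l. u c' (g l) * a' c' r)" if "r < k" for r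
    unfolding a[OF gl that] by (rule sum.mono_neutral_right) (use gl u in auto)
  then show "\<exists>b. \<forall>r<k. a (g l) r = (\<Sum>c\<in>{..g l}. b c * a' c r)"
    by (intro exI[of _ "\<lambda>c'. u c' (g l)"]) simp
next
  fix f assume f: "\<And>l. l \<in> {..<k} \<Longrightarrow> f l \<in> {..g l}"
  have "card {l. l < k \<and> g l + j < q + i} \<le> card {l. l < k \<and> f l + j < q + i}"
    by (rule card_mono) (use f in fastforce)+
  then have "f \<in> net_class k q i j" using g f by (fastforce simp: net_class_def)
  then have "e dvd minor k a' f" by (rule dvd)
  also have "minor k a' f = cdet k (\<lambda>l. if l \<in> {..<k} then a' (f l) else a (g l))"
    unfolding minor_def by (rule cdet_cong) simp
  finally show "e dvd cdet k (\<lambda>l. if l \<in> {..<k} then a' (f l) else a (g l))" .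
qed auto

lemma minor_left_mult:
  "(\<And>c r. c < n \<Longrightarrow> r < k \<Longrightarrow> a c r = (\<Sum>s<k. g r s * a' c s)) \<Longrightarrow> (\<And>l. l < k \<Longrightarrow> f l < n) \<Longrightarrow>
    minor k a f = det (mat k k (\<lambda>(r, s). g r s)) * minor k a' f"
proof -
  assume *: "\<And>c r. c < n \<Longrightarrow> r < k \<Longrightarrow> a c r = (\<Sum>s<k. g r s * a' c s)" "\<And>l. l < k \<Longrightarrow> f l < n"
  have "minor k a f = cdet k (\<lambda>l r. \<Sum>s<k. mat k k (\<lambda>(r, s). g r s) $$ (r, s) * a' (f l) s)"
    unfolding minor_def
  proof (rule cdet_cong)
    fix l r assume "l < k" "r < k"
    then show "a (f l) r = (\<Sum>s<k. mat k k (\<lambda>(r, s). g r s) $$ (r, s) * a' (f l) s)"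
      by (subst *(1)) (auto simp: *(2))
  qed
  also have "\<dots> = det (mat k k (\<lambda>(r, s). g r s)) * minor k a' f"
    unfolding minor_def by (rule cdet_mult) simp
  finally show ?thesis .
qed

section \<open>Arcs in network form with variable entries\<close>

datatype arc_var = Left nat nat | Inner nat nat | Right nat nat

definition arc_form :: "nat \<Rightarrow> nat \<Rightarrow> (arc_var \<Rightarrow> 'a::comm_ring_1) \<Rightarrow> nat \<Rightarrow> nat \<Rightarrow> 'a" where
  "arc_form k q x c r = (\<Sum>c'<q + k. (if c' \<le> c then x (Right c' c) else 0) *
     (\<Sum>s<k. x (Left r s) * netcol k q (\<lambda>l j. x (Inner l j)) c' s))"

lemma arc_form_hom:
  assumes "comm_ring_hom h"
  shows "arc_form k q (\<lambda>v. h (x v)) c r = h (arc_form k q x c r)"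
proof -
  interpret comm_ring_hom h by fact
  show ?thesis unfolding arc_form_def netcol_def
    by (auto simp: hom_distribs ncol_hom[OF assms] intro!: sum.cong)
qed

lemma minor_net_hom:
  assumes "comm_ring_hom h"
  shows "minor k (netcol k q (\<lambda>l j. h (\<rho> l j))) f = h (minor k (netcol k q \<rho>) f)"
  unfolding minor_def netcol_def ncol_hom[OF assms] by (rule cdet_hom[OF assms])

lemma arc_form_class_vanishes:
  assumes "\<And>f. f \<in> net_class k q i j \<Longrightarrow> minor k (netcol k q (\<lambda>l j. x (Inner l j))) f = 0"
    and "g \<in> net_class k q i j"
  shows "minor k (arc_form k q x) g = 0"
proof -
  let ?a = "\<lambda>c r. \<Sum>s<k. x (Left r s) * netcol k q (\<lambda>l j. x (Inner l j)) c s"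
  have "0 dvd minor k (arc_form k q x) g"
  proof (rule minor_upper_dvd[where a' = ?a and u = "\<lambda>c' c. if c' \<le> c then x (Right c' c) else 0"])
    fix f assume f: "f \<in> net_class k q i j"
    have "minor k ?a f = det (mat k k (\<lambda>(r, s). x (Left r s))) * minor k (netcol k q (\<lambda>l j. x (Inner l j))) f"
      by (rule minor_left_mult[where n = "q + k"]) (use f in \<open>auto simp: net_class_def\<close>)
    then show "0 dvd minor k ?a f" using assms(1)[OF f] by simp
  qed (use assms(2) in \<open>auto simp: arc_form_def\<close>)
  then show ?thesis by simp
qed

lemma vanishing_poly_order:
  fixes x :: "arc_var \<Rightarrow> 'a::comm_ring_1 fps" and b :: "nat \<Rightarrow> nat \<Rightarrow> nat"
  assumes F: "F \<in> vanishing_polys k q J" and J: "J \<subseteq> {..k} \<times> {..q}"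
    and h: "comm_ring_hom h"
    and b0: "\<And>i. b i 0 = 0"
    and bi: "\<And>i j. Suc i < k \<Longrightarrow> j \<le> q \<Longrightarrow> b i j \<le> b (Suc i) j"
    and bj: "\<And>i j. i < k \<Longrightarrow> j < q \<Longrightarrow> b i j \<le> b i (Suc j)"
    and x: "\<And>i j. i < k \<Longrightarrow> j < q \<Longrightarrow> fps_X ^ (b i (Suc j) - b i j) dvd x (Inner i j)"
    and e: "\<And>i j. (i, j) \<in> J \<Longrightarrow> e \<le> enat (\<Sum>r<i. b r (j + 1 + r - i))"
  shows "t_power e dvd eval_cpoly h (\<lambda>(r, c). arc_form k q x c r) F"
proof -
  define V :: "arc_var \<Rightarrow> arc_var cpoly" where "V = var_poly"
  define G where "G = eval_cpoly const_poly (\<lambda>(r, c). arc_form k q V c r) F"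
  define P where "P f = minor k (netcol k q (\<lambda>l j. V (Inner l j))) f" for f
  define w where "w v = (case v of Inner i j \<Rightarrow> if i < k \<and> j < q then b i (Suc j) - b i j else 0 | _ \<Rightarrow> 0)" for v
  have evalG: "eval_cpoly h' y G = eval_cpoly h' (\<lambda>(r, c). arc_form k q y c r) F"
    if h': "comm_ring_hom h'" for h' :: "complex \<Rightarrow> 'c::comm_ring_1" and y
    unfolding G_def eval_cpoly_subst[OF h']
    by (intro arg_cong2[where f = "eval_cpoly h'"] refl ext)
       (auto simp: arc_form_hom[OF comm_ring_hom_eval[OF h'], symmetric] V_def eval_cpoly_var[OF h'])
  have evalP: "eval_cpoly h' y (P f) = minor k (netcol k q (\<lambda>l j. y (Inner l j))) f"
    if h': "comm_ring_hom h'" for h' :: "complex \<Rightarrow> 'c::comm_ring_1" and y f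
    unfolding P_def minor_net_hom[OF comm_ring_hom_eval[OF h'], symmetric] V_def eval_cpoly_var[OF h'] ..
  have affP: "\<exists>c d. \<forall>z. eval_cpoly id (y(v := z)) (P f) = c + d * z" for y v f
  proof (cases v)
    case (Inner l j)
    have *: "(\<lambda>l' j'. (y(v := z)) (Inner l' j')) = (\<lambda>l' j'. if l' = l \<and> j' = j then z else y (Inner l' j'))" for z
      using Inner by auto
    show ?thesis unfolding evalP[OF comm_ring_hom_id'] * by (rule minor_net_affine)
  next
    case (Left l j)
    show ?thesis unfolding evalP[OF comm_ring_hom_id'] Left
      by (intro exI[of _ "minor k (netcol k q (\<lambda>l j. y (Inner l j))) f"] exI[of _ 0]) simp
  next
    case (Right l j)
    show ?thesis unfolding evalP[OF comm_ring_hom_id'] Right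
      by (intro exI[of _ "minor k (netcol k q (\<lambda>l j. y (Inner l j))) f"] exI[of _ 0]) simp
  qed
  have weightP: "(\<Sum>r<i. b r (j + 1 + r - i)) \<le> monom_weight w m"
    if ij: "(i, j) \<in> J" and f: "f \<in> net_class k q i j" and m: "m \<in> Poly_Mapping.keys (P f)" for i j f m
  proof (rule weight_of_divisible[OF _ m])
    fix y :: "arc_var \<Rightarrow> complex"
    let ?\<rho> = "\<lambda>l j. fps_X ^ w (Inner l j) * fps_const (y (Inner l j))"
    have "(\<Prod>r<i. fps_X ^ b r (j + 1 + r - i)) dvd cdet k (\<lambda>l. netcol k q ?\<rho> (f l))"
    proof (rule net_minor_dvd[where d = "\<lambda>i j. fps_X ^ b i j"])
      show "fps_X ^ b i (Suc j) dvd ?\<rho> i j * fps_X ^ b i j" if "i < k" "j < q" for i j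
      proof -
        have "fps_X ^ b i (Suc j) = (fps_X ^ (b i (Suc j) - b i j) * fps_X ^ b i j :: complex fps)"
          using bj[OF that] by (simp flip: power_add)
        moreover have "?\<rho> i j * fps_X ^ b i j =
            (fps_X ^ (b i (Suc j) - b i j) * fps_X ^ b i j) * fps_const (y (Inner i j))"
          using that by (simp add: w_def mult_ac)
        ultimately show ?thesis by (simp only: dvd_triv_left)
      qed
    qed (use b0 bi bj ij f J in \<open>auto simp: net_class_def le_imp_power_dvd\<close>)
    then show "fps_X ^ (\<Sum>r<i. b r (j + 1 + r - i)) dvd eval_cpoly fps_const (\<lambda>v. fps_X ^ w v * fps_const (y v)) (P f)"
      unfolding evalP[OF comm_ring_hom_fps_const] minor_def power_sum .
  qed
  have weightG: "e \<le> enat (monom_weight w m)" if m: "m \<in> Poly_Mapping.keys G" for m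
  proof -
    \<comment> \<open>Otherwise, setting the variables outside \<open>m\<close> to 0 would kill all
      these minors and with them the pullback \<open>G\<close>, although the monomial
      \<open>m\<close> survives this substitution.\<close>
    have "\<exists>i j f m'. (i, j) \<in> J \<and> f \<in> net_class k q i j \<and> m' \<in> Poly_Mapping.keys (P f) \<and>
       Poly_Mapping.keys m' \<subseteq> Poly_Mapping.keys m"
    proof (rule ccontr)
      assume no: "\<not> ?thesis"
      have "eval_cpoly id y (part_poly (\<lambda>m'. Poly_Mapping.keys m' \<subseteq> Poly_Mapping.keys m) G) = 0" for y
      proof -
        let ?y = "\<lambda>v. if v \<in> Poly_Mapping.keys m then y v else 0"
        have "minor k (netcol k q (\<lambda>l j. ?y (Inner l j))) f = 0" if "(i, j) \<in> J" "f \<in> net_class k q i j" for i j f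
        proof -
          have "part_poly (\<lambda>m'. Poly_Mapping.keys m' \<subseteq> Poly_Mapping.keys m) (P f) = 0"
          proof (rule poly_mapping_eqI)
            fix m'
            show "Poly_Mapping.lookup (part_poly (\<lambda>m'. Poly_Mapping.keys m' \<subseteq> Poly_Mapping.keys m) (P f)) m' =
               Poly_Mapping.lookup 0 m'"
              using no that by (auto simp: lookup_part_poly in_keys_iff)
          qed
          then have "eval_cpoly id ?y (P f) = 0"
            using eval_part_poly_support[OF comm_ring_hom_id', of y "Poly_Mapping.keys m" "P f"] by simp
          then show ?thesis unfolding evalP[OF comm_ring_hom_id'] .
        qed
        then have "\<forall>(i, j)\<in>J. \<forall>g\<in>net_class k q i j. minor k (arc_form k q ?y) g = 0"
          using arc_form_class_vanishes[of k q _ _ ?y] by blast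
        then have "eval_cpoly id (\<lambda>(r, c). arc_form k q ?y c r) F = 0"
          using F unfolding vanishing_polys_def by blast
        then show ?thesis unfolding eval_part_poly_support[OF comm_ring_hom_id'] evalG[OF comm_ring_hom_id'] .
      qed
      then have "part_poly (\<lambda>m'. Poly_Mapping.keys m' \<subseteq> Poly_Mapping.keys m) G = 0"
        by (rule cpoly_eq_zero_if_vanishes)
      then have "Poly_Mapping.lookup G m = 0"
        using lookup_part_poly[of "\<lambda>m'. Poly_Mapping.keys m' \<subseteq> Poly_Mapping.keys m" G m] by simp
      then show False using m by (simp add: in_keys_iff)
    qed
    then obtain i j f m' where ij: "(i, j) \<in> J" and f: "f \<in> net_class k q i j"
      and m': "m' \<in> Poly_Mapping.keys (P f)" "Poly_Mapping.keys m' \<subseteq> Poly_Mapping.keys m" by blast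
    \<comment> \<open>So far only the supports are comparable; since \<open>m'\<close> is
      squarefree, this is already divisibility.\<close>
    have "Poly_Mapping.lookup m' v \<le> Poly_Mapping.lookup m v" for v
    proof (cases "v \<in> Poly_Mapping.keys m'")
      case True
      have "Poly_Mapping.lookup m' v \<le> 1" by (rule lookup_le_one_if_affine[OF affP m'(1)])
      moreover have "Poly_Mapping.lookup m v \<noteq> 0" using True m'(2) by (meson in_keys_iff subsetD)
      ultimately show ?thesis by simp
    next
      case False
      then show ?thesis by (simp add: in_keys_iff)
    qed
    then have "monom_weight w m' \<le> monom_weight w m" by (rule monom_weight_mono)
    then have "(\<Sum>r<i. b r (j + 1 + r - i)) \<le> monom_weight w m" using weightP[OF ij f m'(1)] by simp
    then show ?thesis using e[OF ij] by (meson enat_ord_simps(1) order_trans)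
  qed
  have "t_power e dvd eval_cpoly h x G"
    unfolding eval_cpoly_monom
  proof (intro dvd_sum dvd_mult)
    fix m assume m: "m \<in> Poly_Mapping.keys G"
    have "t_power e dvd (t_power (enat (monom_weight w m)) :: 'a fps)"
      by (rule t_power_mono_dvd[OF weightG[OF m]])
    also have "\<dots> = fps_X ^ monom_weight w m" by (simp add: t_power_enat)
    also have "\<dots> dvd monom_eval x m"
    proof (rule monom_eval_dvd)
      fix v
      show "fps_X ^ w v dvd x v" by (cases v) (auto simp: w_def x)
    qed
    finally show "t_power e dvd monom_eval x m" .
  qed
  then show ?thesis unfolding evalG[OF h] .
qed

section \<open>Approximation of arcs by network arcs\<close>

lemma eval_cpoly_dvd_diff:
  fixes x y :: "'v \<Rightarrow> 'a::comm_ring_1"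
  assumes "\<And>v. t dvd x v - y v"
  shows "t dvd eval_cpoly h x F - eval_cpoly h y F"
proof -
  have "t dvd x v ^ d - y v ^ d" for v d
    using dvd_prod_diff[of "{..<d}" t "\<lambda>_. x v" "\<lambda>_. y v"] assms[of v] by simp
  then have "t dvd monom_eval x m - monom_eval y m" for m
    unfolding monom_eval_def by (rule dvd_prod_diff)
  then show ?thesis
    unfolding eval_cpoly_monom sum_subtractf[symmetric] right_diff_distrib[symmetric]
    by (intro dvd_sum dvd_mult)
qed

lemma net_class_selection:
  assumes "f \<in> net_class k q i j" "inj_on f {..<k}"
  shows "restrict f {..<k} \<in> selections k (q + k)"
  using assms by (intro restrict_selections) (auto simp: net_class_def)

text \<open>Chains perturbation, descending form and network form. The last two clauses compare the
  corner orders of the network with the orders of the families of \<open>a\<close> up to the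
  precision \<open>N\<close>. For single minors there is only an inequality, because generic column
  operations may lower their order.\<close>

lemma network_approximation:
  fixes a :: "nat \<Rightarrow> nat \<Rightarrow> 'a::field fps"
  assumes inf: "infinite (UNIV :: 'a set)"
    and unit: "\<exists>f\<in>selections k (q + k). t_order (minor k a f) = 0" and N: "0 < N"
  shows "\<exists>\<rho> (b :: nat \<Rightarrow> nat \<Rightarrow> nat) g u.
    (\<forall>c r. c < q + k \<longrightarrow> r < k \<longrightarrow> fps_X ^ N dvd (\<Sum>c'<q + k. u c' c * (\<Sum>s<k. g r s * netcol k q \<rho> c' s)) - a c r) \<and>
    (\<forall>c c'. c < c' \<longrightarrow> u c' c = 0) \<and>
    (\<forall>i. b i 0 = 0) \<and> (\<forall>i j. Suc i < k \<longrightarrow> j \<le> q \<longrightarrow> b i j \<le> b (Suc i) j) \<and>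
    (\<forall>i j. i < k \<longrightarrow> j < q \<longrightarrow> b i j \<le> b i (Suc j)) \<and>
    (\<forall>i j. i < k \<longrightarrow> j < q \<longrightarrow> t_order (\<rho> i j) = enat (b i (Suc j) - b i j)) \<and>
    (\<forall>f\<in>selections k (q + k). min (enat N) (t_order (minor k (netcol k q \<rho>) f)) \<le> t_order (minor k a f)) \<and>
    (\<forall>i j e. i \<le> k \<longrightarrow> j \<le> q \<longrightarrow> (\<forall>f\<in>net_class k q i j. e \<le> t_order (minor k a f)) \<longrightarrow>
       min (enat N) e \<le> enat (\<Sum>r<i. b r (j + 1 + r - i))) \<and>
    (\<forall>i j. \<forall>f\<in>net_class k q i j. i \<le> k \<longrightarrow> j \<le> q \<longrightarrow> t_order (minor k a f) < enat N \<longrightarrow>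
       enat (\<Sum>r<i. b r (j + 1 + r - i)) \<le> t_order (minor k a f))"
proof -
  let ?n = "q + k"
  let ?S = "selections k ?n"
  obtain f0 where f0: "f0 \<in> ?S" "t_order (minor k a f0) = 0" using unit by blast
  then have "minor k a f0 \<noteq> 0" by auto
  from perturb_minors_nonzero[OF inf f0(1) this, of N]
  obtain a1 where a1: "\<forall>f\<in>?S. minor k a1 f \<noteq> 0" "\<forall>c r. fps_X ^ N dvd a1 c r - a c r"
    by (elim exE conjE)
  have close: "t_power (enat N) dvd minor k a1 f - minor k a f" for f
    unfolding minor_def by (rule cdet_dvd_diff) (use a1(2) in \<open>simp add: t_power_enat\<close>)
  have close1: "min (enat N) (t_order (minor k a1 f)) \<le> t_order (minor k a f)" for f
    by (rule t_order_min_diff[OF close])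
  have close2: "min (enat N) (t_order (minor k a f)) \<le> t_order (minor k a1 f)" for f
    by (rule t_order_min_diff) (metis close dvd_minus_iff minus_diff_eq)
  obtain a2 u where a2: "descending k ?n a2 \<and> (\<forall>f\<in>?S. minor k a2 f \<noteq> 0 \<and>
      t_order (minor k a2 f) \<le> t_order (minor k a1 f)) \<and>
    (\<forall>c c'. c < c' \<longrightarrow> u c' c = 0) \<and> (\<forall>c r. c < ?n \<longrightarrow> a1 c r = (\<Sum>c'<?n. u c' c * a2 c' r)) \<and>
    (\<forall>i B e. (\<forall>f\<in>?S. i \<le> card {l. l < k \<and> f l < B} \<longrightarrow> e \<le> t_order (minor k a1 f)) \<longrightarrow>
      (\<forall>f\<in>?S. i \<le> card {l. l < k \<and> f l < B} \<longrightarrow> e \<le> t_order (minor k a2 f)))"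
    using exists_descending[OF inf a1(1)] by (elim exE)
  then have desc: "descending k ?n a2" and nz2: "\<forall>f\<in>?S. minor k a2 f \<noteq> 0"
    and le2: "\<And>f. f \<in> ?S \<Longrightarrow> t_order (minor k a2 f) \<le> t_order (minor k a1 f)"
    and u: "\<And>c c'. c < c' \<Longrightarrow> u c' c = 0"
    and a1u: "\<And>c r. c < ?n \<Longrightarrow> a1 c r = (\<Sum>c'<?n. u c' c * a2 c' r)"
    and cl2: "\<And>i B e f. \<forall>f\<in>?S. i \<le> card {l. l < k \<and> f l < B} \<longrightarrow> e \<le> t_order (minor k a1 f) \<Longrightarrow>
       f \<in> ?S \<Longrightarrow> i \<le> card {l. l < k \<and> f l < B} \<Longrightarrow> e \<le> t_order (minor k a2 f)"
    by blast+
  \<comment> \<open>As \<open>0 < N\<close>, the perturbation cannot destroy the unit minor.\<close>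
  have "min (enat N) (t_order (minor k a1 f0)) \<le> 0" using close1[of f0] f0(2) by simp
  then have "t_order (minor k a1 f0) = 0" using N
    by (cases "t_order (minor k a1 f0)") (auto simp: min_def zero_enat_def split: if_splits)
  then have "t_order (minor k a2 f0) = 0" using le2[OF f0(1)] by simp
  then have unit2: "\<exists>f\<in>?S. t_order (minor k a2 f) = 0" using f0(1) by blast
  obtain \<rho> b g where net: "(\<forall>c r. c < q + k \<longrightarrow> r < k \<longrightarrow> a2 c r = (\<Sum>s<k. g r s * netcol k q \<rho> c s)) \<and>
    (\<forall>i. b i 0 = 0) \<and> (\<forall>i j. Suc i < k \<longrightarrow> j \<le> q \<longrightarrow> b i j \<le> b (Suc i) j) \<and>
    (\<forall>i j. i < k \<longrightarrow> j < q \<longrightarrow> b i j \<le> b i (Suc j)) \<and>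
    (\<forall>i j. i < k \<longrightarrow> j < q \<longrightarrow> t_order (\<rho> i j) = enat (b i (Suc j) - b i j)) \<and>
    (\<forall>f. (\<forall>l<k. f l < q + k) \<longrightarrow> t_order (minor k (netcol k q \<rho>) f) = t_order (minor k a2 f)) \<and>
    (\<forall>i j. i \<le> k \<longrightarrow> j \<le> q \<longrightarrow> t_order (minor k a2 (corner q i j)) = enat (\<Sum>r<i. b r (j + 1 + r - i)))"
    using network_of_descending[OF desc nz2 unit2] by (elim exE)
  then have a2g: "\<And>c r. c < q + k \<Longrightarrow> r < k \<Longrightarrow> a2 c r = (\<Sum>s<k. g r s * netcol k q \<rho> c s)"
    and bs: "\<forall>i. b i 0 = 0" "\<forall>i j. Suc i < k \<longrightarrow> j \<le> q \<longrightarrow> b i j \<le> b (Suc i) j"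
      "\<forall>i j. i < k \<longrightarrow> j < q \<longrightarrow> b i j \<le> b i (Suc j)"
      "\<forall>i j. i < k \<longrightarrow> j < q \<longrightarrow> t_order (\<rho> i j) = enat (b i (Suc j) - b i j)"
    and netord: "\<And>f. \<forall>l<k. f l < q + k \<Longrightarrow> t_order (minor k (netcol k q \<rho>) f) = t_order (minor k a2 f)"
    and cornerord: "\<And>i j. i \<le> k \<Longrightarrow> j \<le> q \<Longrightarrow> t_order (minor k a2 (corner q i j)) = enat (\<Sum>r<i. b r (j + 1 + r - i))"
    by blast+
  have "fps_X ^ N dvd (\<Sum>c'<q + k. u c' c * (\<Sum>s<k. g r s * netcol k q \<rho> c' s)) - a c r"
    if "c < ?n" "r < k" for c r
  proof -
    have "(\<Sum>c'<q + k. u c' c * (\<Sum>s<k. g r s * netcol k q \<rho> c' s)) = a1 c r"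
      unfolding a1u[OF that(1)] by (intro sum.cong refl) (simp add: a2g[OF _ that(2)])
    then show ?thesis using a1(2) by simp
  qed
  moreover have "min (enat N) (t_order (minor k (netcol k q \<rho>) f)) \<le> t_order (minor k a f)" if "f \<in> ?S" for f
  proof -
    have "\<forall>l<k. f l < ?n" using that by (simp add: selections_def PiE_iff)
    then have "t_order (minor k (netcol k q \<rho>) f) \<le> t_order (minor k a1 f)" using netord le2[OF that] by simp
    then show ?thesis using close1[of f] by (meson min.mono order.trans order.refl)
  qed
  moreover have "min (enat N) e \<le> enat (\<Sum>r<i. b r (j + 1 + r - i))"
    if ij: "i \<le> k" "j \<le> q" and e: "\<forall>f\<in>net_class k q i j. e \<le> t_order (minor k a f)" for i j e
  proof -
    have eqB: "(c + j < q + i) = (c < q + i - j)" for c using ij by auto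
    have c1: "\<forall>f\<in>?S. i \<le> card {l. l < k \<and> f l < q + i - j} \<longrightarrow> min (enat N) e \<le> t_order (minor k a1 f)"
    proof (intro ballI impI)
      fix f assume "f \<in> ?S" "i \<le> card {l. l < k \<and> f l < q + i - j}"
      then have "f \<in> net_class k q i j" by (simp add: net_class_def eqB selections_def PiE_iff)
      then have "e \<le> t_order (minor k a f)" using e by blast
      then show "min (enat N) e \<le> t_order (minor k a1 f)" using close2[of f] by (meson min.mono order.trans order.refl)
    qed
    have sel: "restrict (corner q i j) {..<k} \<in> ?S"
      using ij by (intro restrict_selections corner_inj corner_less) auto
    have "{..<i} \<subseteq> {l. l < k \<and> restrict (corner q i j) {..<k} l < q + i - j}"
      using ij by (auto simp: corner_def)
    from card_mono[OF _ this] have "i \<le> card {l. l < k \<and> restrict (corner q i j) {..<k} l < q + i - j}" by simp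
    from cl2[OF c1 sel this] show ?thesis unfolding minor_restrict cornerord[OF ij] .
  qed
  moreover have "enat (\<Sum>r<i. b r (j + 1 + r - i)) \<le> t_order (minor k a f)"
    if f: "f \<in> net_class k q i j" and ij: "i \<le> k" "j \<le> q" and lt: "t_order (minor k a f) < enat N" for i j f
  proof -
    have "inj_on f {..<k}" using lt minor_not_inj[of f k a] by (cases "inj_on f {..<k}") auto
    then have sel: "restrict f {..<k} \<in> ?S" by (rule net_class_selection[OF f])
    have "t_order (minor k a1 f) \<le> t_order (minor k a f)"
      using close1[of f] lt by (auto simp: min_def split: if_splits)
    moreover have "t_order (minor k a2 f) \<le> t_order (minor k a1 f)"
      using le2[OF sel] unfolding minor_restrict .
    moreover have "t_order (minor k a2 (corner q i j)) \<le> t_order (minor k a2 f)"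
      by (rule corner_order_minimal[OF desc ij]) (use f in \<open>auto simp: net_class_def\<close>)
    ultimately show ?thesis unfolding cornerord[OF ij] by simp
  qed
  ultimately show ?thesis
    using u bs by (intro exI[of _ \<rho>] exI[of _ b] exI[of _ g] exI[of _ u]) simp
qed

text \<open>The bound holds up to every precision. If the value had finite order \<open>d\<close>
  below \<open>e\<close>, precision \<open>Suc d\<close> would give a contradiction.\<close>

lemma vanishing_poly_order_arc:
  fixes a :: "nat \<Rightarrow> nat \<Rightarrow> 'a::field fps"
  assumes inf: "infinite (UNIV :: 'a set)"
    and unit: "\<exists>f\<in>selections k (q + k). t_order (minor k a f) = 0"
    and F: "F \<in> vanishing_polys k q J" "F \<in> cpolys ({..<k} \<times> {..<q + k})" and J: "J \<subseteq> {..k} \<times> {..q}"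
    and h: "comm_ring_hom h"
    and e: "\<And>i j f. (i, j) \<in> J \<Longrightarrow> f \<in> net_class k q i j \<Longrightarrow> e \<le> t_order (minor k a f)"
  shows "e \<le> t_order (eval_cpoly h (\<lambda>(r, c). a c r) F)"
proof -
  have bound: "min (enat N) e \<le> t_order (eval_cpoly h (\<lambda>(r, c). a c r) F)" if N: "0 < N" for N
  proof -
    from network_approximation[OF inf unit N] obtain \<rho> b g u where
      cl: "\<forall>c r. c < q + k \<longrightarrow> r < k \<longrightarrow> fps_X ^ N dvd (\<Sum>c'<q + k. u c' c * (\<Sum>s<k. g r s * netcol k q \<rho> c' s)) - a c r"
      and u: "\<forall>c c'. c < c' \<longrightarrow> u c' c = 0"
      and b: "\<forall>i. b i 0 = 0" "\<forall>i j. Suc i < k \<longrightarrow> j \<le> q \<longrightarrow> b i j \<le> b (Suc i) j"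
        "\<forall>i j. i < k \<longrightarrow> j < q \<longrightarrow> b i j \<le> b i (Suc j)"
        "\<forall>i j. i < k \<longrightarrow> j < q \<longrightarrow> t_order (\<rho> i j) = enat (b i (Suc j) - b i j)"
      and cm: "\<forall>i j e. i \<le> k \<longrightarrow> j \<le> q \<longrightarrow> (\<forall>f\<in>net_class k q i j. e \<le> t_order (minor k a f)) \<longrightarrow>
       min (enat N) e \<le> enat (\<Sum>r<i. b r (j + 1 + r - i))"
      by (elim exE conjE)
    define x where "x v = (case v of Left r s \<Rightarrow> g r s | Inner i j \<Rightarrow> \<rho> i j | Right c' c \<Rightarrow> u c' c)" for v
    have form: "arc_form k q x c r = (\<Sum>c'<q + k. u c' c * (\<Sum>s<k. g r s * netcol k q \<rho> c' s))" for c r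
      unfolding arc_form_def x_def using u by (auto intro!: sum.cong)
    have "t_power (min (enat N) e) dvd eval_cpoly h (\<lambda>(r, c). arc_form k q x c r) F"
    proof (rule vanishing_poly_order[OF F(1) J h, where b = b])
      show "min (enat N) e \<le> enat (\<Sum>r<i. b r (j + 1 + r - i))" if "(i, j) \<in> J" for i j
        using cm e[OF that] that J by blast
      show "fps_X ^ (b i (Suc j) - b i j) dvd x (Inner i j)" if "i < k" "j < q" for i j
        using b(4) that t_power_dvd_iff[of "enat (b i (Suc j) - b i j)" "\<rho> i j"]
        by (simp add: x_def t_power_enat)
    qed (use b in auto)
    then have ord1: "min (enat N) e \<le> t_order (eval_cpoly h (\<lambda>(r, c). arc_form k q x c r) F)"
      by (simp only: t_power_dvd_iff)
    \<comment> \<open>The comparison lemma wants congruence at all variables, so outside the matrix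
      the two assignments are made equal. \<open>F\<close> has no variables there.\<close>
    let ?y = "\<lambda>(r, c). if r < k \<and> c < q + k then a c r else arc_form k q x c r"
    have "fps_X ^ N dvd eval_cpoly h (\<lambda>(r, c). arc_form k q x c r) F - eval_cpoly h ?y F"
      by (rule eval_cpoly_dvd_diff) (use cl in \<open>auto simp: form\<close>)
    also have "eval_cpoly h ?y F = eval_cpoly h (\<lambda>(r, c). a c r) F"
      by (rule eval_cpoly_cong[OF F(2)]) auto
    finally have "min (enat N) (t_order (eval_cpoly h (\<lambda>(r, c). arc_form k q x c r) F)) \<le> t_order (eval_cpoly h (\<lambda>(r, c). a c r) F)"
      by (intro t_order_min_diff) (simp add: t_power_enat)
    then show ?thesis using ord1 by (meson min.boundedI min.cobounded1 order.trans)
  qed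
  show ?thesis
  proof (rule ccontr)
    assume "\<not> ?thesis"
    then have lt: "t_order (eval_cpoly h (\<lambda>(r, c). a c r) F) < e" by simp
    then obtain d where d: "t_order (eval_cpoly h (\<lambda>(r, c). a c r) F) = enat d"
      by (cases "t_order (eval_cpoly h (\<lambda>(r, c). a c r) F)") auto
    have "min (enat (Suc d)) e \<le> enat d" using bound[of "Suc d"] d by simp
    then show False using lt d by (auto simp: min_def split: if_splits)
  qed
qed

section \<open>Charts of the Grassmannian\<close>

definition entries :: "'a mat \<Rightarrow> nat \<Rightarrow> nat \<Rightarrow> 'a" where
  "entries A c r = A $$ (r, c)"

lemma col_sets_card: "I \<in> col_sets k n \<Longrightarrow> finite I \<and> card I = k \<and> I \<subseteq> {..<n}"
  unfolding col_sets_def using finite_subset by auto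

lemma pick_less: "I \<in> col_sets k n \<Longrightarrow> l < k \<Longrightarrow> pick I l \<in> I \<and> pick I l < n"
  using pick_in_set_le[of l I] col_sets_card[of I k n] by auto

lemma pick_strict_mono: "I \<in> col_sets k n \<Longrightarrow> l < l' \<Longrightarrow> l' < k \<Longrightarrow> pick I l < pick I l'"
  using pick_mono_le[of l' I l] col_sets_card[of I k n] by auto

lemma pick_inj: "I \<in> col_sets k n \<Longrightarrow> inj_on (pick I) {..<k}"
  by (rule inj_onI) (metis lessThan_iff less_irrefl nat_neq_iff pick_strict_mono)

lemma pick_image: "I \<in> col_sets k n \<Longrightarrow> pick I ` {..<k} = I"
  by (rule card_subset_eq) (auto simp: card_image pick_inj col_sets_card pick_less)

lemma pick_selection: "I \<in> col_sets k n \<Longrightarrow> restrict (pick I) {..<k} \<in> selections k n"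
  by (rule restrict_selections) (auto simp: pick_inj pick_less)

lemma submatrix_entries:
  assumes "A \<in> carrier_mat k n" "I \<in> col_sets k n"
  shows "submatrix A UNIV I = mat k k (\<lambda>(r, l). A $$ (r, pick I l))"
proof -
  have "{j. j < n \<and> j \<in> I} = I" using col_sets_card[OF assms(2)] by auto
  then show ?thesis using assms col_sets_card[OF assms(2)] unfolding submatrix_def by (auto simp: pick_UNIV)
qed

lemma submatrix_carrier:
  "A \<in> carrier_mat k n \<Longrightarrow> I \<in> col_sets k n \<Longrightarrow> submatrix A UNIV I \<in> carrier_mat k k"
  by (simp add: submatrix_entries)

lemma det_submatrix:
  "A \<in> carrier_mat k n \<Longrightarrow> I \<in> col_sets k n \<Longrightarrow> det (submatrix A UNIV I) = minor k (entries A) (pick I)"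
  unfolding submatrix_entries minor_def cdet_def entries_def ..

lemma submatrix_mult:
  assumes "G \<in> carrier_mat k k" "A \<in> carrier_mat k n" "I \<in> col_sets k n"
  shows "submatrix (G * A) UNIV I = G * submatrix A UNIV I"
proof -
  have GA: "G * A \<in> carrier_mat k n" using assms by simp
  show ?thesis unfolding submatrix_entries[OF GA assms(3)] submatrix_entries[OF assms(2,3)]
    by (rule eq_matI) (use assms pick_less[OF assms(3)] in \<open>auto simp: scalar_prod_def intro!: sum.cong\<close>)
qed

lemma row_span_mult:
  assumes "G \<in> carrier_mat k k" "A \<in> carrier_mat k n"
  shows "row_span (G * A) \<subseteq> row_span A"
proof
  fix v assume "v \<in> row_span (G * A)"
  then obtain x where x: "x \<in> carrier_vec k" "v = (G * A)\<^sup>T *\<^sub>v x"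
    using assms unfolding row_span_def by auto
  have "v = A\<^sup>T *\<^sub>v (G\<^sup>T *\<^sub>v x)"
    unfolding x(2) transpose_mult[OF assms] by (rule assoc_mult_mat_vec) (use assms x in auto)
  moreover have "G\<^sup>T *\<^sub>v x \<in> carrier_vec (dim_row A)" using assms x by auto
  ultimately show "v \<in> row_span A" unfolding row_span_def by blast
qed

lemma row_span_mult_eq:
  assumes "G \<in> carrier_mat k k" "H \<in> carrier_mat k k" "H * G = 1\<^sub>m k" "A \<in> carrier_mat k n"
  shows "row_span (G * A) = row_span A"
proof
  have "H * (G * A) = (H * G) * A" by (rule assoc_mult_mat[OF assms(2,1,4), symmetric])
  then have "H * (G * A) = A" unfolding assms(3) using assms(4) by simp
  then show "row_span A \<subseteq> row_span (G * A)"
    using row_span_mult[of H k "G * A" n] assms by simp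
qed (rule row_span_mult[OF assms(1,4)])

lemma row_span_subset_factor:
  fixes A B :: "'a::comm_ring_1 mat"
  assumes A: "A \<in> carrier_mat k n" and B: "B \<in> carrier_mat k n" and sub: "row_span A \<subseteq> row_span B"
  shows "\<exists>G\<in>carrier_mat k k. A = G * B"
proof -
  have "\<exists>x. x \<in> carrier_vec k \<and> row A r = B\<^sup>T *\<^sub>v x" if r: "r < k" for r
  proof -
    have "A\<^sup>T *\<^sub>v unit_vec k r \<in> row_span A" using A unfolding row_span_def by auto
    moreover have "A\<^sup>T *\<^sub>v unit_vec k r = row A r"
      using A r by (intro eq_vecI) (auto simp: scalar_prod_right_unit)
    ultimately show ?thesis using sub B unfolding row_span_def by auto
  qed
  then obtain x where x: "\<And>r. r < k \<Longrightarrow> x r \<in> carrier_vec k" "\<And>r. r < k \<Longrightarrow> row A r = B\<^sup>T *\<^sub>v x r" by metis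
  let ?G = "mat k k (\<lambda>(r, s). x r $ s)"
  have "A = ?G * B"
  proof (rule eq_matI)
    fix r c assume "r < dim_row (?G * B)" "c < dim_col (?G * B)"
    then have rc: "r < k" "c < n" using B by auto
    have "A $$ (r, c) = row A r $ c" using A rc by simp
    also have "\<dots> = (?G * B) $$ (r, c)"
      unfolding x(2)[OF rc(1)] using B rc x(1)[OF rc(1)]
      by (auto simp: scalar_prod_def mult.commute intro!: sum.cong)
    finally show "A $$ (r, c) = (?G * B) $$ (r, c)" .
  qed (use A B in auto)
  then show ?thesis by (intro bexI[of _ ?G]) auto
qed

lemma chart_mat_unique:
  fixes A B :: "'a::comm_ring_1 mat"
  assumes A: "A \<in> carrier_mat k n" "submatrix A UNIV I = 1\<^sub>m k"
    and B: "B \<in> carrier_mat k n" "submatrix B UNIV I = 1\<^sub>m k"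
    and I: "I \<in> col_sets k n" and span: "row_span A \<subseteq> row_span B"
  shows "A = B"
proof -
  obtain G where G: "G \<in> carrier_mat k k" "A = G * B"
    using row_span_subset_factor[OF A(1) B(1) span] by blast
  have "G * 1\<^sub>m k = 1\<^sub>m k" using submatrix_mult[OF G(1) B(1) I] A(2) B(2) G(2) by simp
  then have "G = 1\<^sub>m k" using G(1) by simp
  then show ?thesis using G(2) B(1) by simp
qed

lemma chart_mat:
  assumes "L \<in> chart k n I" "I \<in> col_sets k n"
  shows "chart_mat k n I L \<in> carrier_mat k n" "submatrix (chart_mat k n I L) UNIV I = 1\<^sub>m k"
    "row_span (chart_mat k n I L) = L"
proof -
  obtain A where A: "A \<in> carrier_mat k n" "submatrix A UNIV I = 1\<^sub>m k" "row_span A = L"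
    using assms(1) unfolding chart_def by auto
  have "chart_mat k n I L \<in> carrier_mat k n \<and> submatrix (chart_mat k n I L) UNIV I = 1\<^sub>m k \<and>
     row_span (chart_mat k n I L) = L"
    unfolding chart_mat_def
    by (rule theI[of _ A]) (use A chart_mat_unique[OF _ _ _ _ assms(2)] in auto)
  then show "chart_mat k n I L \<in> carrier_mat k n" "submatrix (chart_mat k n I L) UNIV I = 1\<^sub>m k"
    "row_span (chart_mat k n I L) = L" by auto
qed

lemma chart_mat_eqI:
  assumes "A \<in> carrier_mat k n" "submatrix A UNIV I = 1\<^sub>m k" "I \<in> col_sets k n"
  shows "chart_mat k n I (row_span A) = A"
proof -
  have "row_span A \<in> chart k n I" using assms unfolding chart_def by auto
  from chart_mat[OF this assms(3)] show ?thesis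
    by (intro chart_mat_unique[OF _ _ assms]) auto
qed

lemma row_span_in_chart:
  fixes A :: "'a::comm_ring_1 mat"
  assumes A: "A \<in> carrier_mat k n" and I: "I \<in> col_sets k n" and unit: "det (submatrix A UNIV I) dvd 1"
  shows "row_span A \<in> chart k n I \<and> (\<exists>G\<in>carrier_mat k k. det G dvd 1 \<and> A = G * chart_mat k n I (row_span A))"
proof -
  let ?G = "submatrix A UNIV I"
  have G: "?G \<in> carrier_mat k k" by (rule submatrix_carrier[OF A I])
  obtain w where w: "1 = det ?G * w" using unit by blast
  let ?H = "w \<cdot>\<^sub>m adj_mat ?G"
  have H: "?H \<in> carrier_mat k k" using adj_mat(1)[OF G] by simp
  have HG: "?H * ?G = 1\<^sub>m k"
  proof -
    have "?H * ?G = w \<cdot>\<^sub>m (adj_mat ?G * ?G)" using adj_mat(1)[OF G] G by (intro mult_smult_assoc_mat)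
    also have "\<dots> = 1\<^sub>m k" unfolding adj_mat(3)[OF G] using w by (intro eq_matI) (auto simp: mult.commute)
    finally show ?thesis .
  qed
  have GH: "?G * ?H = 1\<^sub>m k"
  proof -
    have "?G * ?H = w \<cdot>\<^sub>m (?G * adj_mat ?G)" using adj_mat(1)[OF G] G by (intro mult_smult_distrib)
    also have "\<dots> = 1\<^sub>m k" unfolding adj_mat(2)[OF G] using w by (intro eq_matI) (auto simp: mult.commute)
    finally show ?thesis .
  qed
  let ?B = "?H * A"
  have B: "?B \<in> carrier_mat k n" using H A by simp
  have sB: "submatrix ?B UNIV I = 1\<^sub>m k" using submatrix_mult[OF H A I] HG by simp
  have span: "row_span ?B = row_span A" by (rule row_span_mult_eq[OF H G GH A])
  have "chart_mat k n I (row_span A) = ?B" using chart_mat_eqI[OF B sB I] span by simp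
  moreover have "A = ?G * ?B" unfolding assoc_mult_mat[OF G H A, symmetric] GH using A by simp
  moreover have "row_span A \<in> chart k n I" using B sB span unfolding chart_def by auto
  ultimately show ?thesis using unit G by auto
qed

lemma grassmannian_in_chart:
  fixes L :: "'a::comm_ring_1 vec set"
  assumes "L \<in> grassmannian k n"
  shows "\<exists>I\<in>col_sets k n. L \<in> chart k n I"
  using assms row_span_in_chart unfolding grassmannian_def by blast

lemma chart_in_grassmannian:
  fixes L :: "'a::comm_ring_1 vec set"
  assumes "L \<in> chart k n I" "I \<in> col_sets k n"
  shows "L \<in> grassmannian k n"
  using assms unfolding chart_def grassmannian_def by force

lemma minor_mult:
  assumes "G \<in> carrier_mat k k" "B \<in> carrier_mat k n" "\<And>l. l < k \<Longrightarrow> f l < n"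
  shows "minor k (entries (G * B)) f = det G * minor k (entries B) f"
proof -
  have "minor k (entries (G * B)) f = cdet k (\<lambda>l r. \<Sum>s<k. G $$ (r, s) * entries B (f l) s)"
    unfolding minor_def
    by (rule cdet_cong) (use assms in \<open>auto simp: entries_def scalar_prod_def lessThan_atLeast0 intro!: sum.cong\<close>)
  then show ?thesis unfolding minor_def by (simp add: cdet_mult[OF assms(1)])
qed

text \<open>The two factorizations compose to the identity on the columns \<open>J\<close>, so the
  transition matrix is invertible.\<close>

lemma chart_change:
  fixes L :: "'a::comm_ring_1 vec set"
  assumes "L \<in> chart k n I" "L \<in> chart k n J" "I \<in> col_sets k n" "J \<in> col_sets k n"
  shows "\<exists>G\<in>carrier_mat k k. det G dvd 1 \<and> chart_mat k n I L = G * chart_mat k n J L"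
proof -
  note A = chart_mat[OF assms(1,3)] and B = chart_mat[OF assms(2,4)]
  obtain G where G: "G \<in> carrier_mat k k" "chart_mat k n I L = G * chart_mat k n J L"
    using row_span_subset_factor[OF A(1) B(1)] A(3) B(3) by blast
  obtain H where H: "H \<in> carrier_mat k k" "chart_mat k n J L = H * chart_mat k n I L"
    using row_span_subset_factor[OF B(1) A(1)] A(3) B(3) by blast
  have "1\<^sub>m k = H * submatrix (chart_mat k n I L) UNIV J"
    using submatrix_mult[OF H(1) A(1) assms(4)] H(2) B(2) by simp
  also have "submatrix (chart_mat k n I L) UNIV J = G * 1\<^sub>m k"
    using submatrix_mult[OF G(1) B(1) assms(4)] G(2) B(2) by simp
  finally have "1\<^sub>m k = H * G" using G by simp
  then have "det H * det G = 1" using det_mult[OF H(1) G(1)] det_one by metis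
  then have "det G dvd 1" by (metis dvd_triv_right)
  then show ?thesis using G by blast
qed

lemma chart_minor_order:
  fixes L :: "'a::field fps vec set"
  assumes "L \<in> chart k n I" "L \<in> chart k n J" "I \<in> col_sets k n" "J \<in> col_sets k n" "\<And>l. l < k \<Longrightarrow> f l < n"
  shows "t_order (minor k (entries (chart_mat k n I L)) f) = t_order (minor k (entries (chart_mat k n J L)) f)"
proof -
  obtain G where G: "G \<in> carrier_mat k k" "det G dvd 1" "chart_mat k n I L = G * chart_mat k n J L"
    using chart_change[OF assms(1-4)] by blast
  have o: "t_order (det G) = 0" using G(2) by (simp add: t_order_unit_iff)
  have "minor k (entries (chart_mat k n I L)) f = det G * minor k (entries (chart_mat k n J L)) f"
    unfolding G(3) by (rule minor_mult[OF G(1) chart_mat(1)[OF assms(2,4)] assms(5)])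
  then show ?thesis using o by (simp only: t_order_mult add_0)
qed

section \<open>Schubert conditions and minors\<close>

context vec_space
begin

lemma finite_span_index:
  fixes v :: "'a vec"
  assumes "finite S" "S \<subseteq> carrier_vec n"
  shows "v \<in> span S \<longleftrightarrow> v \<in> carrier_vec n \<and> (\<exists>a. \<forall>i<n. v $ i = (\<Sum>w\<in>S. a w * w $ i))"
proof -
  have sp: "span S = {lincomb a S |a. a \<in> (S \<rightarrow> UNIV)}"
    using finite_span[OF assms(1)] assms(2) by (simp add: class_ring_simps)
  have cl: "lincomb a S \<in> carrier_vec n" for a using assms(2) by (simp add: lincomb_closed)
  show ?thesis
  proof
    assume "v \<in> span S"
    then obtain a where "v = lincomb a S" unfolding sp by auto
    then show "v \<in> carrier_vec n \<and> (\<exists>a. \<forall>i<n. v $ i = (\<Sum>w\<in>S. a w * w $ i))"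
      using cl[of a] lincomb_index[OF _ assms(2)] by auto
  next
    assume v: "v \<in> carrier_vec n \<and> (\<exists>a. \<forall>i<n. v $ i = (\<Sum>w\<in>S. a w * w $ i))"
    then obtain a where a: "\<And>i. i < n \<Longrightarrow> v $ i = (\<Sum>w\<in>S. a w * w $ i)" by auto
    have "v = lincomb a S"
      using v cl[of a] by (intro eq_vecI) (auto simp: a lincomb_index[OF _ assms(2)])
    then show "v \<in> span S" unfolding sp by auto
  qed
qed

text \<open>The coordinates \<open>p l\<close> are dual to the vectors \<open>w l\<close>, which
  gives independence at once. Rows of a matrix that is the identity on some columns are of this
  kind.\<close>

lemma dim_span_dual:
  fixes w :: "'i \<Rightarrow> 'a vec" and p :: "'i \<Rightarrow> nat"
  assumes L: "finite L" "\<And>l. l \<in> L \<Longrightarrow> w l \<in> carrier_vec n" "\<And>l. l \<in> L \<Longrightarrow> p l < n"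
    and dual: "\<And>l l'. l \<in> L \<Longrightarrow> l' \<in> L \<Longrightarrow> w l $ p l' = (if l = l' then 1 else 0)"
  shows "vectorspace.dim class_ring (vs (span (w ` L))) = card L"
proof -
  have inj: "inj_on w L"
  proof (rule inj_onI)
    fix l l' assume l: "l \<in> L" "l' \<in> L" "w l = w l'"
    then have "w l $ p l = w l' $ p l" by simp
    then show "l = l'" using dual l by (metis zero_neq_one)
  qed
  have indep: "lin_indpt (w ` L)"
  proof
    assume "lin_dep (w ` L)"
    then obtain A a v where A: "finite A" "A \<subseteq> w ` L" "lincomb a A = 0\<^sub>v n" "v \<in> A" "a v \<noteq> 0"
      unfolding lin_dep_def by (auto simp: class_ring_simps module_vec_simps)
    obtain l where l: "l \<in> L" "v = w l" using A by auto
    have AC: "A \<subseteq> carrier_vec n" using A L by auto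
    have "0 = lincomb a A $ p l" using A(3) L(3)[OF l(1)] by simp
    also have "\<dots> = (\<Sum>x\<in>A. a x * x $ p l)" by (rule lincomb_index[OF L(3)[OF l(1)] AC])
    also have "\<dots> = (\<Sum>x\<in>A. if x = v then a v else 0)"
    proof (rule sum.cong[OF refl])
      fix x assume "x \<in> A"
      then obtain l' where "l' \<in> L" "x = w l'" using A by auto
      then show "a x * x $ p l = (if x = v then a v else 0)" using dual[of l' l] l inj by (auto simp: inj_on_def)
    qed
    finally show False using A by simp
  qed
  have "vectorspace.dim class_ring (vs (span (w ` L))) = card (w ` L)"
    by (rule dim_span[of "w ` L"]) (use L indep in \<open>auto simp: maximal_def\<close>)
  then show ?thesis using inj by (simp add: card_image)
qed

end

lemma flag_eq: "flag n i = {v \<in> carrier_vec n. \<forall>c<n - i. v $ c = 0}"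
proof -
  interpret vec_space "TYPE(complex)" n .
  let ?S = "unit_vec n ` {n - i..<n} :: complex vec set"
  have fin: "finite ?S" "?S \<subseteq> carrier_vec n" by auto
  have inj: "inj_on (unit_vec n :: nat \<Rightarrow> complex vec) {n - i..<n}"
  proof (rule inj_onI)
    fix x y assume xy: "x \<in> {n - i..<n}" "y \<in> {n - i..<n}" "unit_vec n x = (unit_vec n y :: complex vec)"
    then have "(unit_vec n x :: complex vec) $ x = unit_vec n y $ x" by simp
    then show "x = y" using xy by (auto split: if_splits)
  qed
  have sum: "(\<Sum>w\<in>?S. a w * w $ c) = (if n - i \<le> c then a (unit_vec n c) else 0)" if "c < n" for a c
  proof -
    have "(\<Sum>w\<in>?S. a w * w $ c) = (\<Sum>d\<in>{n - i..<n}. a (unit_vec n d) * unit_vec n d $ c)"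
      by (simp add: sum.reindex[OF inj])
    also have "\<dots> = (\<Sum>d\<in>{n - i..<n}. if d = c then a (unit_vec n c) else 0)"
      by (intro sum.cong refl) (use that in auto)
    finally show ?thesis using that by auto
  qed
  show ?thesis
  proof (rule Set.set_eqI, rule iffI)
    fix v assume "v \<in> flag n i"
    then show "v \<in> {v \<in> carrier_vec n. \<forall>c<n - i. v $ c = 0}"
      unfolding flag_def finite_span_index[OF fin] by (auto simp: sum)
  next
    fix v :: "complex vec" assume v: "v \<in> {v \<in> carrier_vec n. \<forall>c<n - i. v $ c = 0}"
    define a where "a w = v $ inv_into {n - i..<n} (unit_vec n) w" for w :: "complex vec"
    have a: "a (unit_vec n c) = v $ c" if "c \<in> {n - i..<n}" for c
      unfolding a_def inv_into_f_f[OF inj that] ..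
    show "v \<in> flag n i"
      unfolding flag_def finite_span_index[OF fin]
    proof (intro conjI exI[of _ a] allI impI)
      fix c assume "c < n"
      then show "v $ c = (\<Sum>w\<in>?S. a w * w $ c)" using v a[of c] by (simp add: sum)
    qed (use v in simp)
  qed
qed

text \<open>Chart coordinates are themselves minors, so polynomials in the coordinates can be
  rewritten in terms of minors.\<close>

lemma minor_identity_replace:
  fixes a :: "nat \<Rightarrow> nat \<Rightarrow> 'a::comm_ring_1"
  assumes id: "\<And>l r. l < k \<Longrightarrow> r < k \<Longrightarrow> a (f l) r = (if r = l then 1 else 0)" and l: "l < k"
  shows "minor k a (f(l := c)) = a c l"
proof -
  let ?e = "\<lambda>s r. if r = s then (1::'a) else 0"
  have "minor k a (f(l := c)) = (\<Sum>s\<in>{..<k}. a c s * cdet k ((\<lambda>i. a ((f(l := c)) i))(l := ?e s)))"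
    unfolding minor_def
  proof (rule cdet_sum[OF l])
    fix r assume r: "r < k"
    have "(\<Sum>s<k. a c s * (if r = s then 1 else 0)) = (\<Sum>s<k. if s = r then a c s else 0)"
      by (intro sum.cong) auto
    then show "a ((f(l := c)) l) r = (\<Sum>s\<in>{..<k}. a c s * (if r = s then 1 else 0))"
      using r by simp
  qed
  also have "\<dots> = (\<Sum>s\<in>{..<k}. if s = l then a c l else 0)"
  proof (intro sum.cong refl)
    fix s assume s: "s \<in> {..<k}"
    show "a c s * cdet k ((\<lambda>i. a ((f(l := c)) i))(l := ?e s)) = (if s = l then a c l else 0)"
    proof (cases "s = l")
      case True
      have "cdet k ((\<lambda>i. a ((f(l := c)) i))(l := ?e s)) = cdet k (\<lambda>l r. if l = r then 1 else 0)"
        by (rule cdet_cong) (use True id in auto)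
      then show ?thesis using True by (simp add: cdet_identity)
    next
      case False
      have "cdet k ((\<lambda>i. a ((f(l := c)) i))(l := ?e s)) = 0"
        by (rule cdet_eq_columns[of l _ s]) (use s l False id in auto)
      then show ?thesis using False by simp
    qed
  qed
  also have "\<dots> = a c l" using l by simp
  finally show ?thesis .
qed

lemma count_pick:
  assumes I: "I \<in> col_sets k n"
  shows "card {l. l < k \<and> pick I l < B} = card (I \<inter> {..<B})"
proof -
  have "I \<inter> {..<B} = pick I ` {l. l < k \<and> pick I l < B}"
    using pick_image[OF I] by auto
  moreover have "inj_on (pick I) {l. l < k \<and> pick I l < B}"
    using pick_inj[OF I] by (rule inj_on_subset) auto
  ultimately show ?thesis by (simp add: card_image)
qed

lemma minor_as_pick:
  fixes a :: "nat \<Rightarrow> nat \<Rightarrow> 'a::comm_ring_1"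
  assumes f: "inj_on f {..<k}" "\<forall>l<k. f l < n"
  shows "f ` {..<k} \<in> col_sets k n \<and> (\<exists>s. (s = 1 \<or> s = - 1) \<and> (\<forall>a::nat \<Rightarrow> nat \<Rightarrow> 'a. minor k a f = s * minor k a (pick (f ` {..<k})))) \<and>
    card {l. l < k \<and> f l < B} = card (f ` {..<k} \<inter> {..<B})"
proof -
  have I: "f ` {..<k} \<in> col_sets k n" unfolding col_sets_def using f by (auto simp: card_image)
  have "f ` {..<k} \<inter> {..<B} = f ` {l. l < k \<and> f l < B}" by auto
  moreover have "inj_on f {l. l < k \<and> f l < B}" using f(1) by (rule inj_on_subset) auto
  ultimately have "card {l. l < k \<and> f l < B} = card (f ` {..<k} \<inter> {..<B})" by (simp add: card_image)
  then show ?thesis using I minor_same_image[OF f(1) pick_inj[OF I]] pick_image[OF I] by blast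
qed

text \<open>Among the nonzero Pluecker coordinates take \<open>I\<close> with the most columns
  before \<open>B\<close> and normalize the matrix on \<open>I\<close>. The rows whose pivot is at
  \<open>B\<close> or later then form a basis of the intersection, so its dimension is
  \<open>k\<close> minus this maximal number.\<close>

lemma subspace_dim_flag_iff:
  fixes A :: "complex mat"
  assumes A: "A \<in> carrier_mat k n" and I0: "I0 \<in> col_sets k n" "minor k (entries A) (pick I0) \<noteq> 0"
    and B: "B \<le> n" and l: "l < k"
  shows "k - l \<le> subspace_dim n (row_span A \<inter> flag n (n - B)) \<longleftrightarrow>
    (\<forall>f. (\<forall>l'<k. f l' < n) \<longrightarrow> Suc l \<le> card {l'. l' < k \<and> f l' < B} \<longrightarrow> minor k (entries A) f = 0)"
proof -
  interpret vec_space "TYPE(complex)" n .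
  let ?P = "\<lambda>I. I \<in> col_sets k n \<and> minor k (entries A) (pick I) \<noteq> 0"
  have "finite {card (I \<inter> {..<B}) | I. ?P I}"
    by (rule finite_subset[of _ "{..B}"]) (auto intro: order_trans[OF card_mono[of "{..<B}"]])
  then obtain I where I: "?P I" and max: "\<And>J. ?P J \<Longrightarrow> card (J \<inter> {..<B}) \<le> card (I \<inter> {..<B})"
  proof -
    assume fin: "finite {card (I \<inter> {..<B}) | I. ?P I}"
    have ne: "{card (I \<inter> {..<B}) | I. ?P I} \<noteq> {}" using I0 by auto
    have "Max {card (I \<inter> {..<B}) | I. ?P I} \<in> {card (I \<inter> {..<B}) | I. ?P I}" by (rule Max_in[OF fin ne])
    then obtain I where "?P I" "Max {card (I \<inter> {..<B}) | I. ?P I} = card (I \<inter> {..<B})" by auto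
    moreover have "card (J \<inter> {..<B}) \<le> Max {card (I \<inter> {..<B}) | I. ?P I}" if "?P J" for J
      by (rule Max_ge[OF fin]) (use that in auto)
    ultimately show ?thesis using that by metis
  qed
  have Ics: "I \<in> col_sets k n" using I by simp
  let ?f = "pick I"
  have "det (submatrix A UNIV I) dvd 1" using I det_submatrix[OF A Ics] by (simp add: dvd_field_iff)
  from row_span_in_chart[OF A Ics this] obtain G where chart: "row_span A \<in> chart k n I"
    and G: "G \<in> carrier_mat k k" "det G dvd 1" "A = G * chart_mat k n I (row_span A)" by blast
  define A' where "A' = chart_mat k n I (row_span A)"
  note A' = chart_mat[OF chart Ics, folded A'_def]
  have AG: "A = G * A'" using G(3) by (simp add: A'_def)
  have minorA: "minor k (entries A) f = det G * minor k (entries A') f" if "\<And>l. l < k \<Longrightarrow> f l < n" for f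
    unfolding AG by (rule minor_mult[OF G(1) A'(1) that])
  have id: "entries A' (?f l) r = (if r = l then 1 else 0)" if "l < k" "r < k" for l r
  proof -
    have "submatrix A' UNIV I $$ (r, l) = A' $$ (r, ?f l)" unfolding submatrix_entries[OF A'(1) Ics] using that by simp
    then show ?thesis using A'(2) that by (simp add: entries_def)
  qed
  define L where "L = {l. l < k \<and> B \<le> ?f l}"
  \<comment> \<open>With a nonzero entry here, column \<open>c\<close> could replace the pivot of
    row \<open>l\<close>, giving a nonzero minor with more columns before \<open>B\<close>.\<close>
  have zero: "A' $$ (l, c) = 0" if lL: "l \<in> L" and c: "c < B" for l c
  proof (rule ccontr)
    assume nz: "A' $$ (l, c) \<noteq> 0"
    have lk: "l < k" "B \<le> ?f l" using lL by (auto simp: L_def)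
    let ?g = "?f(l := c)"
    have gn: "?g l' < n" if "l' < k" for l' using pick_less[OF Ics that] c B by auto
    have gn'': "\<forall>l'<k. ?g l' < n" by (intro allI impI) (rule gn)
    have "minor k (entries A') ?g = A' $$ (l, c)"
      using minor_identity_replace[of k "entries A'" ?f l c, OF id lk(1)] by (simp add: entries_def)
    moreover have "det G \<noteq> 0" using G(2) by auto
    moreover have "minor k (entries A) ?g = det G * minor k (entries A') ?g" by (rule minorA) (rule gn)
    ultimately have ng: "minor k (entries A) ?g \<noteq> 0" using nz by simp
    then have inj: "inj_on ?g {..<k}" using minor_not_inj by blast
    from minor_as_pick[where f = ?g and n = n and ?'a = complex and B = B, OF inj gn''] obtain s :: complex where
      J: "?g ` {..<k} \<in> col_sets k n" and s: "s = 1 \<or> s = -1"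
      "\<forall>a. minor k a ?g = s * minor k a (pick (?g ` {..<k}))"
      and cnt: "card {l'. l' < k \<and> ?g l' < B} = card (?g ` {..<k} \<inter> {..<B})" by (elim conjE exE)
    have "minor k (entries A) (pick (?g ` {..<k})) \<noteq> 0" using ng s(2) by (metis mult_zero_right)
    then have "card {l'. l' < k \<and> ?g l' < B} \<le> card (I \<inter> {..<B})" unfolding cnt by (intro max conjI J)
    also have "\<dots> = card {l'. l' < k \<and> ?f l' < B}" using count_pick[OF Ics] by simp
    also have "\<dots> < card {l'. l' < k \<and> ?g l' < B}"
    proof (rule psubset_card_mono)
      have "l \<in> {l'. l' < k \<and> ?g l' < B}" "l \<notin> {l'. l' < k \<and> ?f l' < B}" using lk c by auto
      moreover have "{l'. l' < k \<and> ?f l' < B} \<subseteq> {l'. l' < k \<and> ?g l' < B}" using c by auto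
      ultimately show "{l'. l' < k \<and> ?f l' < B} \<subset> {l'. l' < k \<and> ?g l' < B}" by blast
    qed simp
    finally show False by simp
  qed
  have Wspan: "row_span A \<inter> flag n (n - B) = span (row A' ` L)"
  proof -
    have finS: "finite (row A' ` L)" "row A' ` L \<subseteq> carrier_vec n" using A'(1) by (auto simp: L_def)
    have injS: "inj_on (row A') L"
    proof (rule inj_onI)
      fix l l' assume l: "l \<in> L" "l' \<in> L" "row A' l = row A' l'"
      then have lk: "l < k" "l' < k" by (auto simp: L_def)
      have "A' $$ (l, ?f l) = A' $$ (l', ?f l)"
        using l(3) pick_less[OF Ics lk(1)] lk A'(1) by (metis carrier_matD index_row(1))
      then show "l = l'" using id[OF lk(1) lk(1)] id[OF lk(1) lk(2)] by (auto simp: entries_def split: if_splits)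
    qed
    have rs: "v \<in> row_span A \<longleftrightarrow> (\<exists>x\<in>carrier_vec k. v \<in> carrier_vec n \<and> (\<forall>c<n. v $ c = (\<Sum>l<k. x $ l * A' $$ (l, c))))" for v :: "complex vec"
    proof -
      have T: "A'\<^sup>T *\<^sub>v x = vec n (\<lambda>c. \<Sum>l<k. x $ l * A' $$ (l, c))" if "x \<in> carrier_vec k" for x
        using A'(1) that by (intro eq_vecI) (auto simp: scalar_prod_def lessThan_atLeast0 mult.commute intro!: sum.cong)
      have "row_span A' = {A'\<^sup>T *\<^sub>v x | x. x \<in> carrier_vec k}"
        using A'(1) unfolding row_span_def by simp
      also have "\<dots> = {vec n (\<lambda>c. \<Sum>l<k. x $ l * A' $$ (l, c)) | x. x \<in> carrier_vec k}"
        by (intro Collect_cong ex_cong1) (auto simp: T)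
      finally have "row_span A' = {vec n (\<lambda>c. \<Sum>l<k. x $ l * A' $$ (l, c)) | x. x \<in> carrier_vec k}" .
      then have rsA: "row_span A = {vec n (\<lambda>c. \<Sum>l<k. x $ l * A' $$ (l, c)) | x. x \<in> carrier_vec k}"
        unfolding A'(3) .
      have vec: "v = vec n F \<longleftrightarrow> v \<in> carrier_vec n \<and> (\<forall>c<n. v $ c = F c)" for F
        by (auto intro!: eq_vecI)
      show ?thesis unfolding rsA mem_Collect_eq vec by blast
    qed
    show ?thesis
    proof (rule Set.set_eqI, rule iffI)
      fix v :: "complex vec" assume "v \<in> row_span A \<inter> flag n (n - B)"
      then obtain x :: "complex vec" where x: "x \<in> carrier_vec k" "v \<in> carrier_vec n" "\<And>c. c < n \<Longrightarrow> v $ c = (\<Sum>l<k. x $ l * A' $$ (l, c))"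
        and v0: "\<And>c. c < B \<Longrightarrow> v $ c = 0" unfolding Int_iff rs flag_eq using B by auto
      \<comment> \<open>The coefficients of \<open>v\<close> are its entries at the pivots, so rows
        with a pivot before \<open>B\<close> do not occur.\<close>
      have xl: "x $ l = v $ ?f l" if "l < k" for l
      proof -
        have "v $ ?f l = (\<Sum>l'<k. if l' = l then x $ l else 0)"
          unfolding x(3)[OF conjunct2[OF pick_less[OF Ics that]]]
          by (intro sum.cong refl) (use id that in \<open>auto simp: entries_def\<close>)
        then show ?thesis using that by simp
      qed
      have "v $ c = (\<Sum>w\<in>row A' ` L. x $ inv_into L (row A') w * w $ c)" if "c < n" for c
      proof -
        have "v $ c = (\<Sum>l\<in>L. x $ l * A' $$ (l, c))"
          unfolding x(3)[OF that]
        proof (rule sum.mono_neutral_right)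
          show "\<forall>i\<in>{..<k} - L. x $ i * A' $$ (i, c) = 0"
          proof
            fix i assume i: "i \<in> {..<k} - L"
            then have "i < k" "?f i < B" by (auto simp: L_def)
            then show "x $ i * A' $$ (i, c) = 0" by (simp add: xl v0)
          qed
        qed (auto simp: L_def)
        also have "\<dots> = (\<Sum>w\<in>row A' ` L. x $ inv_into L (row A') w * w $ c)"
          unfolding sum.reindex[OF injS]
          by (intro sum.cong refl) (use injS that A'(1) in \<open>auto simp: L_def\<close>)
        finally show ?thesis .
      qed
      then show "v \<in> span (row A' ` L)"
        unfolding finite_span_index[OF finS] using x(2) by (intro conjI exI[of _ "\<lambda>w. x $ inv_into L (row A') w"]) auto
    next
      fix v :: "complex vec" assume "v \<in> span (row A' ` L)"
      then obtain a where a: "v \<in> carrier_vec n" "\<And>c. c < n \<Longrightarrow> v $ c = (\<Sum>w\<in>row A' ` L. a w * w $ c)"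
        unfolding finite_span_index[OF finS] by auto
      have vc: "v $ c = (\<Sum>l\<in>L. a (row A' l) * A' $$ (l, c))" if "c < n" for c
        unfolding a(2)[OF that] sum.reindex[OF injS] o_def
        by (intro sum.cong refl) (use that A'(1) in \<open>auto simp: L_def\<close>)
      have "v $ c = (\<Sum>l<k. vec k (\<lambda>l. if l \<in> L then a (row A' l) else 0) $ l * A' $$ (l, c))" if "c < n" for c
        unfolding vc[OF that] by (rule sum.mono_neutral_cong_left) (auto simp: L_def)
      then have "v \<in> row_span A" unfolding rs using a(1)
        by (intro bexI[of _ "vec k (\<lambda>l. if l \<in> L then a (row A' l) else 0)"]) auto
      moreover have "v \<in> flag n (n - B)" unfolding flag_eq using a(1) B zero
        by (auto simp: vc intro!: sum.neutral)
      ultimately show "v \<in> row_span A \<inter> flag n (n - B)" by simp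
    qed
  qed
  have dim: "subspace_dim n (row_span A \<inter> flag n (n - B)) = card L"
    unfolding subspace_dim_def Wspan
  proof (rule dim_span_dual[where p = ?f])
    show "row A' l $ ?f l' = (if l = l' then 1 else 0)" if "l \<in> L" "l' \<in> L" for l l'
      using id[of l' l] that A'(1) pick_less[OF Ics, of l'] by (auto simp: L_def entries_def)
  qed (use A'(1) pick_less[OF Ics] in \<open>auto simp: L_def\<close>)
  let ?C = "{l'. l' < k \<and> ?f l' < B}"
  have split: "card L + card ?C = k"
  proof -
    have "card L + card ?C = card (L \<union> ?C)" by (rule card_Un_disjoint[symmetric]) (auto simp: L_def)
    also have "L \<union> ?C = {..<k}" by (auto simp: L_def)
    finally show ?thesis by simp
  qed
  show ?thesis
  proof
    assume "k - l \<le> subspace_dim n (row_span A \<inter> flag n (n - B))"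
    then have le: "card ?C \<le> l" unfolding dim using split l by linarith
    show "\<forall>f. (\<forall>l'<k. f l' < n) \<longrightarrow> Suc l \<le> card {l'. l' < k \<and> f l' < B} \<longrightarrow> minor k (entries A) f = 0"
    proof (intro allI impI, rule ccontr)
      fix g assume gn: "\<forall>l'<k. g l' < n" and cg: "Suc l \<le> card {l'. l' < k \<and> g l' < B}" and ng: "minor k (entries A) g \<noteq> 0"
      then have inj: "inj_on g {..<k}" using minor_not_inj by blast
      from minor_as_pick[where f = g and n = n and ?'a = complex and B = B, OF inj gn] obtain s :: complex where
        J: "g ` {..<k} \<in> col_sets k n" and s: "s = 1 \<or> s = -1"
        "\<forall>a. minor k a g = s * minor k a (pick (g ` {..<k}))"
        and cnt: "card {l'. l' < k \<and> g l' < B} = card (g ` {..<k} \<inter> {..<B})" by (elim conjE exE)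
      have "minor k (entries A) (pick (g ` {..<k})) \<noteq> 0" using ng s(2) by (metis mult_zero_right)
      then have "card {l'. l' < k \<and> g l' < B} \<le> card (I \<inter> {..<B})" unfolding cnt by (intro max conjI J)
      then show False using cg le count_pick[OF Ics, of B] by simp
    qed
  next
    assume van: "\<forall>f. (\<forall>l'<k. f l' < n) \<longrightarrow> Suc l \<le> card {l'. l' < k \<and> f l' < B} \<longrightarrow> minor k (entries A) f = 0"
    have "\<not> Suc l \<le> card ?C" using van I pick_less[OF Ics] by blast
    then show "k - l \<le> subspace_dim n (row_span A \<inter> flag n (n - B))" unfolding dim using split by linarith
  qed
qed

section \<open>The contact order with a Schubert variety\<close>

text \<open>For \<open>s = Suc l\<close> the Schubert condition concerns the first
  \<open>l + lam (k - l)\<close> coordinates, and this is the bound of the family listed. A zero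
  part imposes no condition, and its second index would exceed \<open>q\<close>.\<close>

definition partition_classes :: "nat \<Rightarrow> nat \<Rightarrow> (nat \<Rightarrow> nat) \<Rightarrow> (nat \<times> nat) set" where
  "partition_classes k q lam = {(Suc l, Suc q - lam (k - l)) | l. l < k \<and> 1 \<le> lam (k - l)}"

lemma partition_bound:
  assumes "is_partition k n lam" "1 \<le> r" "r \<le> k"
  shows "lam r \<le> n - k"
  using assms(2,3)
proof (induction r rule: dec_induct)
  case base
  then show ?case using assms(1) by (simp add: is_partition_def)
next
  case (step r)
  have "lam (r + 1) \<le> lam r" using assms(1) step by (simp add: is_partition_def)
  then show ?case using step by simp
qed

lemma partition_classes_subset:
  assumes "is_partition k n lam"
  shows "partition_classes k (n - k) lam \<subseteq> {..k} \<times> {..n - k}"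
  unfolding partition_classes_def by auto

lemma schubert_iff_minors:
  fixes A :: "complex mat"
  assumes lam: "is_partition k n lam" and kn: "k \<le> n"
    and A: "A \<in> carrier_mat k n" and I: "I \<in> col_sets k n" "minor k (entries A) (pick I) \<noteq> 0"
  shows "row_span A \<in> schubert k n lam \<longleftrightarrow>
    (\<forall>(i, j)\<in>partition_classes k (n - k) lam. \<forall>f\<in>net_class k (n - k) i j. minor k (entries A) f = 0)"
proof -
  have gr: "row_span A \<in> grassmannian k n"
    unfolding grassmannian_def
    by (intro CollectI exI[of _ A] conjI refl A bexI[OF _ I(1)])
       (use I in \<open>simp add: det_submatrix[OF A I(1)] dvd_field_iff\<close>)
  let ?dim = "\<lambda>l. k - l \<le> subspace_dim n (row_span A \<inter> flag n (n - (l + lam (k - l))))"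
  have one: "?dim l \<longleftrightarrow> (1 \<le> lam (k - l) \<longrightarrow>
      (\<forall>f\<in>net_class k (n - k) (Suc l) (Suc (n - k) - lam (k - l)). minor k (entries A) f = 0))"
    if l: "l < k" for l
  proof -
    have b: "lam (k - l) \<le> n - k" by (rule partition_bound[OF lam]) (use l in auto)
    have iff: "?dim l \<longleftrightarrow> (\<forall>f. (\<forall>l'<k. f l' < n) \<longrightarrow> Suc l \<le> card {l'. l' < k \<and> f l' < l + lam (k - l)}
      \<longrightarrow> minor k (entries A) f = 0)"
      by (rule subspace_dim_flag_iff[OF A I _ l]) (use b l kn in auto)
    show ?thesis
    proof (cases "1 \<le> lam (k - l)")
      case True
      have "(c + (Suc (n - k) - lam (k - l)) < n - k + Suc l) = (c < l + lam (k - l))" for c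
        using b True by auto
      then have "f \<in> net_class k (n - k) (Suc l) (Suc (n - k) - lam (k - l)) \<longleftrightarrow>
          (\<forall>l'<k. f l' < n) \<and> Suc l \<le> card {l'. l' < k \<and> f l' < l + lam (k - l)}" for f
        unfolding net_class_def using kn by simp
      then show ?thesis unfolding iff using True by blast
    next
      case False
      \<comment> \<open>For a zero part the bound is \<open>l\<close>, and no more than
        \<open>l\<close> distinct columns lie before it.\<close>
      have "minor k (entries A) f = 0" if "Suc l \<le> card {l'. l' < k \<and> f l' < l + lam (k - l)}" for f
      proof (rule minor_not_inj, rule notI)
        assume inj: "inj_on f {..<k}"
        have "inj_on f {l'. l' < k \<and> f l' < l + lam (k - l)}" using inj by (rule inj_on_subset) auto
        then have "card {l'. l' < k \<and> f l' < l + lam (k - l)} \<le> card {..<l}"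
          by (rule card_inj_on_le) (use False in auto)
        then show False using that by simp
      qed
      then show ?thesis unfolding iff using False by blast
    qed
  qed
  have "row_span A \<in> schubert k n lam \<longleftrightarrow> (\<forall>l<k. ?dim l)"
  proof -
    have reindex: "(\<forall>s\<in>{1..k}. Q s) \<longleftrightarrow> (\<forall>l<k. Q (Suc l))" for Q
      unfolding image_Suc_lessThan[symmetric] by auto
    show ?thesis unfolding schubert_def mem_Collect_eq reindex using gr by (simp add: Let_def)
  qed
  also have "\<dots> \<longleftrightarrow> (\<forall>(i, j)\<in>partition_classes k (n - k) lam. \<forall>f\<in>net_class k (n - k) i j. minor k (entries A) f = 0)"
    using one unfolding partition_classes_def by blast
  finally show ?thesis .
qed

lemma minor_cong_entries:
  "(\<And>c r. c < n \<Longrightarrow> r < k \<Longrightarrow> a c r = a' c r) \<Longrightarrow> (\<And>l. l < k \<Longrightarrow> f l < n) \<Longrightarrow> minor k a f = minor k a' f"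
  unfolding minor_def by (rule cdet_cong) auto

lemma minor_hom: "comm_ring_hom h \<Longrightarrow> minor k (\<lambda>c r. h (a c r)) f = h (minor k a f)"
  unfolding minor_def by (rule cdet_hom)

text \<open>A polynomial on a chart, with the chart coordinates replaced by quotients of minors and
  denominators cleared with one factor to spare, so that it vanishes off the chart.\<close>
definition homogenize :: "nat \<Rightarrow> nat set \<Rightarrow> (nat \<times> nat) cpoly \<Rightarrow> (nat \<times> nat) cpoly" where
  "homogenize k I f = (\<Sum>m\<in>Poly_Mapping.keys f. const_poly (Poly_Mapping.lookup f m) *
     monom_eval (\<lambda>(r, c). minor k (\<lambda>c r. var_poly (r, c)) ((pick I)(r := c))) m *
     minor k (\<lambda>c r. var_poly (r, c)) (pick I) ^
       (Suc (\<Sum>m\<in>Poly_Mapping.keys f. monom_weight (\<lambda>_. 1) m) - monom_weight (\<lambda>_. 1) m))"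

lemma eval_homogenize:
  assumes h: "comm_ring_hom h"
  shows "eval_cpoly h (\<lambda>(r, c). a c r) (homogenize k I f) =
    (\<Sum>m\<in>Poly_Mapping.keys f. h (Poly_Mapping.lookup f m) *
     monom_eval (\<lambda>(r, c). minor k a ((pick I)(r := c))) m *
     minor k a (pick I) ^ (Suc (\<Sum>m\<in>Poly_Mapping.keys f. monom_weight (\<lambda>_. 1) m) - monom_weight (\<lambda>_. 1) m))"
proof -
  let ?E = "eval_cpoly h (\<lambda>(r, c). a c r)"
  interpret E: comm_ring_hom ?E by (rule comm_ring_hom_eval[OF h])
  have mn: "?E (minor k (\<lambda>c r. var_poly (r, c)) g) = minor k a g" for g
    unfolding minor_hom[OF E.comm_ring_hom_axioms, symmetric] by (simp add: eval_cpoly_var[OF h])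
  have "?E (monom_eval (\<lambda>(r, c). minor k (\<lambda>c r. var_poly (r, c)) ((pick I)(r := c))) m) =
      monom_eval (\<lambda>(r, c). minor k a ((pick I)(r := c))) m" for m
    unfolding monom_eval_def E.hom_prod E.hom_power by (intro prod.cong refl) (auto simp: mn)
  then show ?thesis unfolding homogenize_def
    by (simp add: eval_cpoly_sum[OF h] E.hom_mult E.hom_power mn eval_cpoly_const[OF h])
qed

lemma monom_eval_scaled:
  assumes "\<And>v. v \<in> Poly_Mapping.keys m \<Longrightarrow> x v = d * y v"
  shows "monom_eval x m = d ^ monom_weight (\<lambda>_. 1) m * monom_eval y m"
  unfolding monom_eval_def monom_weight_def power_sum prod.distrib[symmetric]
  by (intro prod.cong refl) (simp add: assms power_mult_distrib)

lemma eval_homogenize_chart: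
  fixes a a' :: "nat \<Rightarrow> nat \<Rightarrow> 'a::comm_ring_1"
  assumes h: "comm_ring_hom h" and f: "f \<in> cpolys ({..<k} \<times> {..<n})"
    and a: "\<And>r c. r < k \<Longrightarrow> c < n \<Longrightarrow> minor k a ((pick I)(r := c)) = minor k a (pick I) * a' c r"
  shows "eval_cpoly h (\<lambda>(r, c). a c r) (homogenize k I f) =
    minor k a (pick I) ^ Suc (\<Sum>m\<in>Poly_Mapping.keys f. monom_weight (\<lambda>_. 1) m) * eval_cpoly h (\<lambda>(r, c). a' c r) f"
proof -
  let ?d = "minor k a (pick I)" and ?D = "\<Sum>m\<in>Poly_Mapping.keys f. monom_weight (\<lambda>_. 1) m"
  have "h (Poly_Mapping.lookup f m) * monom_eval (\<lambda>(r, c). minor k a ((pick I)(r := c))) m *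
     ?d ^ (Suc ?D - monom_weight (\<lambda>_. 1) m) = ?d ^ Suc ?D * (h (Poly_Mapping.lookup f m) * monom_eval (\<lambda>(r, c). a' c r) m)"
    if m: "m \<in> Poly_Mapping.keys f" for m
  proof -
    have mv: "v \<in> {..<k} \<times> {..<n}" if "v \<in> Poly_Mapping.keys m" for v using f m that by (auto simp: cpolys_def)
    have "monom_eval (\<lambda>(r, c). minor k a ((pick I)(r := c))) m = ?d ^ monom_weight (\<lambda>_. 1) m * monom_eval (\<lambda>(r, c). a' c r) m"
      by (rule monom_eval_scaled) (use mv a in auto)
    moreover have "monom_weight (\<lambda>_. 1) m \<le> ?D" by (rule member_le_sum) (use m in auto)
    then have "?d ^ Suc ?D = ?d ^ monom_weight (\<lambda>_. 1) m * ?d ^ (Suc ?D - monom_weight (\<lambda>_. 1) m)"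
      unfolding power_add[symmetric] by simp
    ultimately show ?thesis by (simp only: mult_ac)
  qed
  then show ?thesis unfolding eval_homogenize[OF h] unfolding eval_cpoly_monom sum_distrib_left by (intro sum.cong refl)
qed

text \<open>The cut to the variables of a \<open>k \<times> n\<close> matrix gives membership in
  \<open>cpolys\<close>; by \<open>eval_chart_poly\<close> it preserves values.\<close>

definition chart_poly :: "nat \<Rightarrow> nat \<Rightarrow> nat set \<Rightarrow> (nat \<times> nat) cpoly \<Rightarrow> (nat \<times> nat) cpoly" where
  "chart_poly k n I f = part_poly (\<lambda>m. Poly_Mapping.keys m \<subseteq> {..<k} \<times> {..<n}) (homogenize k I f)"

lemma eval_chart_poly:
  assumes h: "comm_ring_hom h" and I: "I \<in> col_sets k n" and f: "f \<in> cpolys ({..<k} \<times> {..<n})"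
  shows "eval_cpoly h (\<lambda>(r, c). a c r) (chart_poly k n I f) = eval_cpoly h (\<lambda>(r, c). a c r) (homogenize k I f)"
proof -
  let ?a = "\<lambda>c r. if r < k \<and> c < n then a c r else 0"
  have "(\<lambda>v. if v \<in> {..<k} \<times> {..<n} then (\<lambda>(r, c). a c r) v else 0) = (\<lambda>(r, c). ?a c r)" by auto
  then have "eval_cpoly h (\<lambda>(r, c). a c r) (chart_poly k n I f) = eval_cpoly h (\<lambda>(r, c). ?a c r) (homogenize k I f)"
    unfolding chart_poly_def eval_part_poly_support[OF h] by simp
  also have "\<dots> = eval_cpoly h (\<lambda>(r, c). a c r) (homogenize k I f)"
    unfolding eval_homogenize[OF h]
  proof (intro sum.cong refl arg_cong2[where f = "(*)"] arg_cong2[where f = "(^)"])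
    show "minor k ?a (pick I) = minor k a (pick I)"
      by (rule minor_cong_entries[of n]) (use pick_less[OF I] in auto)
    fix m assume m: "m \<in> Poly_Mapping.keys f"
    show "monom_eval (\<lambda>(r, c). minor k ?a ((pick I)(r := c))) m = monom_eval (\<lambda>(r, c). minor k a ((pick I)(r := c))) m"
    proof (rule monom_eval_cong)
      fix v assume v: "v \<in> Poly_Mapping.keys m"
      obtain r c where rc: "v = (r, c)" by (cases v)
      then have "c < n" using f m v by (auto simp: cpolys_def)
      then have "minor k ?a ((pick I)(r := c)) = minor k a ((pick I)(r := c))"
        by (intro minor_cong_entries[of n]) (use pick_less[OF I] in auto)
      then show "(case v of (r, c) \<Rightarrow> minor k ?a ((pick I)(r := c))) = (case v of (r, c) \<Rightarrow> minor k a ((pick I)(r := c)))"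
        using rc by simp
    qed
  qed
  finally show ?thesis .
qed

lemma entries_chart:
  assumes "A \<in> carrier_mat k n" "I \<in> col_sets k n" "submatrix A UNIV I = 1\<^sub>m k" "l < k" "r < k"
  shows "entries A (pick I l) r = (if r = l then 1 else 0)"
proof -
  have "submatrix A UNIV I $$ (r, l) = A $$ (r, pick I l)"
    unfolding submatrix_entries[OF assms(1,2)] using assms by simp
  then show ?thesis using assms by (simp add: entries_def)
qed

lemma minor_chart:
  assumes "A \<in> carrier_mat k n" "I \<in> col_sets k n" "submatrix A UNIV I = 1\<^sub>m k"
  shows "minor k (entries A) (pick I) = 1"
  using det_submatrix[OF assms(1,2)] assms(3) by simp

lemma chart_vars_subset: "chart_vars k n I \<subseteq> {..<k} \<times> {..<n}"
  unfolding chart_vars_def by auto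

lemma cpolys_mono: "V \<subseteq> W \<Longrightarrow> cpolys V \<subseteq> cpolys W"
  unfolding cpolys_def by blast

text \<open>Where the minor of \<open>I\<close> is 0, the spare factor vanishes. Elsewhere a matrix
  whose family minors vanish spans a complex point of the Schubert variety in the chart, where
  \<open>f\<close> is 0.\<close>

lemma chart_poly_vanishing:
  assumes lam: "is_partition k n lam" and kn: "k \<le> n" and I: "I \<in> col_sets k n"
    and f: "f \<in> chart_ideal k n I (schubert k n lam)"
  shows "chart_poly k n I f \<in> vanishing_polys k (n - k) (partition_classes k (n - k) lam)"
  unfolding vanishing_polys_def
proof (intro CollectI allI impI)
  fix a :: "nat \<Rightarrow> nat \<Rightarrow> complex"
  assume van: "\<forall>(i, j)\<in>partition_classes k (n - k) lam. \<forall>f\<in>net_class k (n - k) i j. minor k a f = 0"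
  have fc: "f \<in> cpolys ({..<k} \<times> {..<n})"
    using f cpolys_mono[OF chart_vars_subset] unfolding chart_ideal_def by blast
  let ?d = "minor k a (pick I)"
  have "eval_cpoly id (\<lambda>(r, c). a c r) (homogenize k I f) = 0"
  proof (cases "?d = 0")
    case True
    have le: "monom_weight (\<lambda>_. 1) m \<le> (\<Sum>m\<in>Poly_Mapping.keys f. monom_weight (\<lambda>_. 1) m)"
      if "m \<in> Poly_Mapping.keys f" for m by (rule member_le_sum) (use that in auto)
    show ?thesis unfolding eval_homogenize[OF comm_ring_hom_id'] True
      by (rule sum.neutral) (use le in \<open>auto simp: Suc_diff_le\<close>)
  next
    case False
    define A where "A = mat k n (\<lambda>(r, c). a c r)"
    have A: "A \<in> carrier_mat k n" by (simp add: A_def)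
    have mA: "minor k (entries A) g = minor k a g" if "\<And>l. l < k \<Longrightarrow> g l < n" for g
      by (rule minor_cong_entries[of n]) (use that in \<open>auto simp: entries_def A_def\<close>)
    have d: "minor k (entries A) (pick I) = ?d" by (rule mA) (use pick_less[OF I] in auto)
    have "row_span A \<in> schubert k n lam"
      unfolding schubert_iff_minors[OF lam kn A I False[folded d]]
    proof (clarify)
      fix i j g assume "(i, j) \<in> partition_classes k (n - k) lam" and g: "g \<in> net_class k (n - k) i j"
      then have "minor k a g = 0" using van by blast
      moreover have "minor k (entries A) g = minor k a g"
        by (rule mA) (use g kn in \<open>auto simp: net_class_def\<close>)
      ultimately show "minor k (entries A) g = 0" by simp
    qed
    moreover have "det (submatrix A UNIV I) dvd 1" using False d det_submatrix[OF A I] by (simp add: dvd_field_iff)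
    from row_span_in_chart[OF A I this] obtain G where chart: "row_span A \<in> chart k n I"
      and G: "G \<in> carrier_mat k k" "A = G * chart_mat k n I (row_span A)" by blast
    ultimately have f0: "eval_cpoly id (chart_coord k n I (row_span A)) f = 0"
      using f unfolding chart_ideal_def by blast
    let ?A' = "chart_mat k n I (row_span A)"
    note A' = chart_mat[OF chart I]
    have mG: "minor k a g = det G * minor k (entries ?A') g" if g: "\<And>l. l < k \<Longrightarrow> g l < n" for g
    proof -
      have "minor k a g = minor k (entries (G * ?A')) g" using mA[of g] g G(2) by simp
      also have "\<dots> = det G * minor k (entries ?A') g" by (rule minor_mult[OF G(1) A'(1) g])
      finally show ?thesis .
    qed
    have dG: "?d = det G" using mG[of "pick I"] pick_less[OF I] minor_chart[OF A'(1) I A'(2)] by simp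
    have "eval_cpoly id (\<lambda>(r, c). a c r) (homogenize k I f) =
      ?d ^ Suc (\<Sum>m\<in>Poly_Mapping.keys f. monom_weight (\<lambda>_. 1) m) * eval_cpoly id (\<lambda>(r, c). entries ?A' c r) f"
    proof (rule eval_homogenize_chart[OF comm_ring_hom_id' fc])
      fix r c assume rc: "r < k" "c < n"
      have "minor k a ((pick I)(r := c)) = det G * minor k (entries ?A') ((pick I)(r := c))"
        by (rule mG) (use rc pick_less[OF I] in auto)
      also have "minor k (entries ?A') ((pick I)(r := c)) = entries ?A' c r"
        by (rule minor_identity_replace, rule entries_chart[OF A'(1) I A'(2)], assumption+, rule rc(1))
      finally show "minor k a ((pick I)(r := c)) = ?d * entries ?A' c r" unfolding dG .
    qed
    also have "(\<lambda>(r, c). entries ?A' c r) = chart_coord k n I (row_span A)"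
      by (auto simp: entries_def chart_coord_def)
    finally show ?thesis by (simp only: f0 mult_zero_right)
  qed
  then show "eval_cpoly id (\<lambda>(r, c). a c r) (chart_poly k n I f) = 0"
    unfolding eval_chart_poly[OF comm_ring_hom_id' I fc] .
qed

lemma eval_chart_poly_chart:
  assumes h: "comm_ring_hom h" and L: "L \<in> chart k n I" "I \<in> col_sets k n" and f: "f \<in> cpolys ({..<k} \<times> {..<n})"
  shows "eval_cpoly h (\<lambda>(r, c). entries (chart_mat k n I L) c r) (chart_poly k n I f) = eval_cpoly h (chart_coord k n I L) f"
proof -
  note A = chart_mat[OF L]
  have one: "minor k (entries (chart_mat k n I L)) (pick I) = 1" by (rule minor_chart[OF A(1) L(2) A(2)])
  have "eval_cpoly h (\<lambda>(r, c). entries (chart_mat k n I L) c r) (homogenize k I f) =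
     minor k (entries (chart_mat k n I L)) (pick I) ^ Suc (\<Sum>m\<in>Poly_Mapping.keys f. monom_weight (\<lambda>_. 1) m) *
     eval_cpoly h (\<lambda>(r, c). entries (chart_mat k n I L) c r) f"
  proof (rule eval_homogenize_chart[OF h f])
    fix r c assume rc: "r < k" "c < n"
    have "minor k (entries (chart_mat k n I L)) ((pick I)(r := c)) = entries (chart_mat k n I L) c r"
      by (rule minor_identity_replace, rule entries_chart[OF A(1) L(2) A(2)], assumption+, rule rc(1))
    then show "minor k (entries (chart_mat k n I L)) ((pick I)(r := c)) =
      minor k (entries (chart_mat k n I L)) (pick I) * entries (chart_mat k n I L) c r" using one by simp
  qed
  moreover have "(\<lambda>(r, c). entries (chart_mat k n I L) c r) = chart_coord k n I L"
    by (auto simp: entries_def chart_coord_def)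
  ultimately show ?thesis unfolding eval_chart_poly[OF h L(2) f] one by simp
qed

section \<open>Minors as functions on a chart\<close>

definition minor_poly :: "nat \<Rightarrow> nat \<Rightarrow> nat set \<Rightarrow> (nat \<Rightarrow> nat) \<Rightarrow> (nat \<times> nat) cpoly" where
  "minor_poly k n I f = part_poly (\<lambda>m. Poly_Mapping.keys m \<subseteq> chart_vars k n I)
     (minor k (\<lambda>c r. if c \<in> I then (if c = pick I r then 1 else 0) else var_poly (r, c)) f)"

lemma eval_minor_poly:
  assumes h: "comm_ring_hom h" and L: "L \<in> chart k n I" "I \<in> col_sets k n" and f: "\<And>l. l < k \<Longrightarrow> f l < n"
  shows "eval_cpoly h (chart_coord k n I L) (minor_poly k n I f) = minor k (entries (chart_mat k n I L)) f"
proof -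
  note A = chart_mat[OF L]
  let ?x = "\<lambda>v. if v \<in> chart_vars k n I then chart_coord k n I L v else 0"
  interpret E: comm_ring_hom "eval_cpoly h ?x" by (rule comm_ring_hom_eval[OF h])
  have "eval_cpoly h (chart_coord k n I L) (minor_poly k n I f) =
     minor k (\<lambda>c r. eval_cpoly h ?x (if c \<in> I then (if c = pick I r then 1 else 0) else var_poly (r, c))) f"
    unfolding minor_poly_def eval_part_poly_support[OF h] minor_hom[OF E.comm_ring_hom_axioms] ..
  also have "\<dots> = minor k (entries (chart_mat k n I L)) f"
  proof (rule minor_cong_entries[of n])
    fix c r assume cr: "c < n" "r < k"
    show "eval_cpoly h ?x (if c \<in> I then (if c = pick I r then 1 else 0) else var_poly (r, c)) = entries (chart_mat k n I L) c r"
    proof (cases "c \<in> I")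
      case True
      then obtain l where l: "l < k" "c = pick I l" using pick_image[OF L(2)] by auto
      have "(c = pick I r) = (r = l)" using l cr pick_inj[OF L(2)] by (auto simp: inj_on_def)
      then show ?thesis using True l entries_chart[OF A(1) L(2) A(2) l(1) cr(2)] by simp
    next
      case False
      then show ?thesis using cr by (simp add: eval_cpoly_var[OF h] chart_vars_def chart_coord_def entries_def)
    qed
  qed (rule f)
  finally show ?thesis .
qed

lemma minor_poly_in_ideal:
  assumes lam: "is_partition k n lam" and kn: "k \<le> n" and I: "I \<in> col_sets k n"
    and f: "(i, j) \<in> partition_classes k (n - k) lam" "f \<in> net_class k (n - k) i j"
  shows "minor_poly k n I f \<in> chart_ideal k n I (schubert k n lam)"
  unfolding chart_ideal_def
proof (intro CollectI conjI ballI)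
  show "minor_poly k n I f \<in> cpolys (chart_vars k n I)"
    unfolding minor_poly_def by (rule part_poly_support_in_cpolys)
  fix V assume V: "V \<in> schubert k n lam \<inter> chart k n I"
  then have chart: "V \<in> chart k n I" by simp
  note A = chart_mat[OF chart I]
  have "minor k (entries (chart_mat k n I V)) (pick I) \<noteq> 0" using minor_chart[OF A(1) I A(2)] by simp
  from schubert_iff_minors[OF lam kn A(1) I this] have "minor k (entries (chart_mat k n I V)) f = 0"
    using V f A(3) by auto
  moreover have "f l < n" if "l < k" for l using f(2) kn that by (auto simp: net_class_def)
  ultimately show "eval_cpoly id (chart_coord k n I V) (minor_poly k n I f) = 0"
    using eval_minor_poly[OF comm_ring_hom_id' chart I, of f] by simp
qed

section \<open>Contact orders of arcs over the universal domain\<close>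

lemma comm_ring_hom_udom: "comm_ring_hom udom_const"
  unfolding udom_const_def
  by unfold_locales
       (auto simp: single_add mult_single Zero_fract_def One_fract_def simp flip: to_ac_add to_ac_mult)

lemma udom_infinite: "infinite (UNIV :: udom set)"
proof -
  have "inj udom_const"
  proof (rule injI)
    fix x y assume "udom_const x = udom_const y"
    then have "Fract (Poly_Mapping.single 0 x :: nat cpoly) 1 = Fract (Poly_Mapping.single 0 y) 1"
      unfolding udom_const_def by simp
    then have "(Poly_Mapping.single 0 x :: nat cpoly) = Poly_Mapping.single 0 y" by (simp add: eq_fract)
    then show "x = y" by (metis lookup_single_eq)
  qed
  moreover have "infinite (UNIV :: complex set)" by (rule infinite_UNIV_char_0)
  ultimately show ?thesis using finite_imageD by (metis infinite_super subset_UNIV)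
qed

abbreviation series_const :: "complex \<Rightarrow> udom fps" where
  "series_const c \<equiv> fps_const (udom_const c)"

lemma comm_ring_hom_series: "comm_ring_hom series_const"
  by (rule comm_ring_hom_comp[OF comm_ring_hom_fps_const comm_ring_hom_udom])

text \<open>The matrices from different charts differ by an invertible factor, so the choice of
  chart does not affect the order; see \<open>arc_minor_chart\<close>.\<close>

definition arc_minor :: "nat \<Rightarrow> nat \<Rightarrow> arc \<Rightarrow> (nat \<Rightarrow> nat) \<Rightarrow> enat" where
  "arc_minor k n \<Lambda> f = t_order (minor k (entries (chart_mat k n (SOME I. I \<in> col_sets k n \<and> \<Lambda> \<in> chart k n I) \<Lambda>)) f)"

lemma arc_minor_chart:
  assumes "I \<in> col_sets k n" "\<Lambda> \<in> chart k n I" "\<And>l. l < k \<Longrightarrow> f l < n"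
  shows "arc_minor k n \<Lambda> f = t_order (minor k (entries (chart_mat k n I \<Lambda>)) f)"
proof -
  let ?P = "\<lambda>I. I \<in> col_sets k n \<and> \<Lambda> \<in> chart k n I"
  have "?P (SOME I. ?P I)" by (rule someI[of ?P I]) (use assms in simp)
  then show ?thesis unfolding arc_minor_def using assms by (intro chart_minor_order) auto
qed

text \<open>The minors of the families are functions in the ideal of the Schubert variety, so the
  pullback contains every series of order at least the infimum. By
  \<open>vanishing_poly_order_arc\<close> no other function in the ideal pulls back to a smaller
  order.\<close>

lemma contact_profile_minors:
  assumes \<Lambda>: "\<Lambda> \<in> arcs k n" and lam: "is_partition k n lam" and kn: "k \<le> n"
  shows "contact_profile k n \<Lambda> lam =
    Inf {arc_minor k n \<Lambda> f | f. \<exists>(i, j)\<in>partition_classes k (n - k) lam. f \<in> net_class k (n - k) i j}"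
proof -
  let ?J = "partition_classes k (n - k) lam"
  let ?O = "{arc_minor k n \<Lambda> f | f. \<exists>(i, j)\<in>?J. f \<in> net_class k (n - k) i j}"
  let ?e = "Inf ?O"
  let ?gens = "\<Union>I \<in> {I \<in> col_sets k n. \<Lambda> \<in> chart k n I}.
        eval_cpoly series_const (chart_coord k n I \<Lambda>) ` chart_ideal k n I (schubert k n lam)"
  interpret M: Modules.module "(*) :: udom fps \<Rightarrow> udom fps \<Rightarrow> udom fps"
    by unfold_locales (auto simp: algebra_simps)
  have fn: "f l < n" if "f \<in> net_class k (n - k) i j" "l < k" for f i j l
    using that kn by (auto simp: net_class_def)
  have gens: "t_power ?e dvd g" if g: "g \<in> ?gens" for g
  proof -
    obtain I f where I: "I \<in> col_sets k n" "\<Lambda> \<in> chart k n I" and f: "f \<in> chart_ideal k n I (schubert k n lam)"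
      and gf: "g = eval_cpoly series_const (chart_coord k n I \<Lambda>) f" using g by auto
    have fc: "f \<in> cpolys ({..<k} \<times> {..<n})"
      using f cpolys_mono[OF chart_vars_subset] unfolding chart_ideal_def by blast
    note A = chart_mat[OF I(2,1)]
    let ?a = "entries (chart_mat k n I \<Lambda>)"
    have nk: "n - k + k = n" using kn by simp
    have "?e \<le> t_order (eval_cpoly series_const (\<lambda>(r, c). ?a c r) (chart_poly k n I f))"
    proof (rule vanishing_poly_order_arc[OF udom_infinite _ chart_poly_vanishing[OF lam kn I(1) f] _ partition_classes_subset[OF lam] comm_ring_hom_series])
      show "\<exists>f\<in>selections k (n - k + k). t_order (minor k ?a f) = 0"
        unfolding nk using pick_selection[OF I(1)] minor_chart[OF A(1) I(1) A(2)]
        by (intro bexI[of _ "restrict (pick I) {..<k}"]) (auto simp: minor_restrict)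
      show "chart_poly k n I f \<in> cpolys ({..<k} \<times> {..<n - k + k})"
        unfolding nk chart_poly_def by (rule part_poly_support_in_cpolys)
      fix i j g assume ij: "(i, j) \<in> ?J" and g: "g \<in> net_class k (n - k) i j"
      have "arc_minor k n \<Lambda> g \<in> ?O" using ij g by blast
      then have "?e \<le> arc_minor k n \<Lambda> g" by (rule Inf_lower)
      then show "?e \<le> t_order (minor k ?a g)" using arc_minor_chart[OF I] fn[OF g] by simp
    qed
    then show ?thesis unfolding gf eval_chart_poly_chart[OF comm_ring_hom_series I(2,1) fc] t_power_dvd_iff .
  qed
  have "pullback_ideal k n \<Lambda> (schubert k n lam) = {g. t_power ?e dvd g}"
  proof
    show "pullback_ideal k n \<Lambda> (schubert k n lam) \<subseteq> {g. t_power ?e dvd g}"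
      unfolding pullback_ideal_def
      by (rule M.span_minimal) (use gens in \<open>auto simp: M.subspace_def intro: dvd_add\<close>)
    show "{g. t_power ?e dvd g} \<subseteq> pullback_ideal k n \<Lambda> (schubert k n lam)"
    proof
      fix g :: "udom fps" assume "g \<in> {g. t_power ?e dvd g}"
      then have g: "t_power ?e dvd g" by simp
      show "g \<in> pullback_ideal k n \<Lambda> (schubert k n lam)"
      \<comment> \<open>An infinite infimum, as for the empty set of minors of the zero partition,
        leaves only \<open>g = 0\<close>. A finite one is attained by some minor.\<close>
      proof (cases "?e = \<infinity>")
        case True
        then have "g = 0" using g by simp
        then show ?thesis unfolding pullback_ideal_def using M.span_zero by simp
      next
        case False
        then have "?O \<noteq> {}" by (auto simp: top_enat_def[symmetric])
        then have "?e \<in> ?O" by (metis (no_types, lifting) False Inf_enat_def LeastI ex_in_conv)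
        then obtain f i j where f: "?e = arc_minor k n \<Lambda> f" and ij: "(i, j) \<in> ?J" "f \<in> net_class k (n - k) i j" by blast
        obtain I where I: "I \<in> col_sets k n" "\<Lambda> \<in> chart k n I"
          using grassmannian_in_chart \<Lambda> unfolding arcs_def by blast
        let ?s = "minor k (entries (chart_mat k n I \<Lambda>)) f"
        have "?s = eval_cpoly series_const (chart_coord k n I \<Lambda>) (minor_poly k n I f)"
          by (rule eval_minor_poly[OF comm_ring_hom_series I(2,1) fn[OF ij(2)], symmetric])
        then have "?s \<in> eval_cpoly series_const (chart_coord k n I \<Lambda>) ` chart_ideal k n I (schubert k n lam)"
          using minor_poly_in_ideal[OF lam kn I(1) ij] by (rule image_eqI)
        then have "?s \<in> ?gens" using I by (intro UN_I[of I]) auto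
        then have s: "?s \<in> pullback_ideal k n \<Lambda> (schubert k n lam)"
          unfolding pullback_ideal_def by (rule M.span_base)
        have et: "?e = t_order ?s" unfolding f by (rule arc_minor_chart[OF I fn[OF ij(2)]])
        have "?s dvd g" using g unfolding et dvd_iff_t_order t_order_t_power .
        then obtain d where d: "g = ?s * d" by (rule dvdE)
        have "d * ?s \<in> pullback_ideal k n \<Lambda> (schubert k n lam)"
          using s unfolding pullback_ideal_def by (rule M.span_scale)
        then show ?thesis unfolding d by (simp only: mult.commute)
      qed
    qed
  qed
  then have "contact_order k n \<Lambda> (schubert k n lam) = ?e"
    unfolding contact_order_def
  proof (intro the_equality)
    fix e' :: enat
    assume id: "pullback_ideal k n \<Lambda> (schubert k n lam) = {g. t_power ?e dvd g}"
      and "pullback_ideal k n \<Lambda> (schubert k n lam) = {g. t_power e' dvd g}"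
    then have eq: "{g :: udom fps. t_power ?e dvd g} = {g. t_power e' dvd g}" by simp
    have "(t_power e' :: udom fps) \<in> {g. t_power ?e dvd g}" unfolding eq by simp
    moreover have "(t_power ?e :: udom fps) \<in> {g. t_power e' dvd g}" unfolding eq[symmetric] by simp
    ultimately show "e' = ?e" by (simp add: t_power_dvd_iff)
  qed
  then show ?thesis unfolding contact_profile_def .
qed

section \<open>Closed conditions on arcs\<close>

definition map_fps :: "('a \<Rightarrow> 'b) \<Rightarrow> 'a::zero fps \<Rightarrow> 'b::zero fps" where
  "map_fps h F = Abs_fps (\<lambda>p. h (fps_nth F p))"

lemma map_fps_nth [simp]: "fps_nth (map_fps h F) p = h (fps_nth F p)"
  unfolding map_fps_def by simp

lemma comm_ring_hom_map_fps:
  assumes "comm_ring_hom h"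
  shows "comm_ring_hom (map_fps h)"
proof -
  interpret comm_ring_hom h by fact
  show ?thesis
    by unfold_locales (auto intro!: fps_ext simp: fps_mult_nth hom_distribs)
qed

lemma minor_map_fps:
  assumes "comm_ring_hom h"
  shows "h (fps_nth (minor k a f) p) = fps_nth (minor k (\<lambda>c r. map_fps h (a c r)) f) p"
  unfolding minor_hom[OF comm_ring_hom_map_fps[OF assms]] by simp

definition minor_coeff_poly :: "nat \<Rightarrow> nat \<Rightarrow> nat set \<Rightarrow> (nat \<Rightarrow> nat) \<Rightarrow> nat \<Rightarrow> (nat \<times> nat \<times> nat) cpoly" where
  "minor_coeff_poly k n I f p = part_poly (\<lambda>m. Poly_Mapping.keys m \<subseteq> arc_vars k n I)
     (fps_nth (minor k (\<lambda>c r. if c \<in> I then (if c = pick I r then 1 else 0) else Abs_fps (\<lambda>p. var_poly (r, c, p))) f) p)"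

lemma eval_minor_coeff_poly:
  assumes I: "I \<in> col_sets k n" and L: "\<Lambda> \<in> chart k n I" and f: "\<And>l. l < k \<Longrightarrow> f l < n"
  shows "eval_cpoly udom_const (arc_coord k n I \<Lambda>) (minor_coeff_poly k n I f p) =
    fps_nth (minor k (entries (chart_mat k n I \<Lambda>)) f) p"
proof -
  note A = chart_mat[OF L I]
  let ?x = "\<lambda>v. if v \<in> arc_vars k n I then arc_coord k n I \<Lambda> v else 0"
  let ?E = "eval_cpoly udom_const ?x"
  have E: "comm_ring_hom ?E" by (rule comm_ring_hom_eval[OF comm_ring_hom_udom])
  interpret E: comm_ring_hom ?E by (rule E)
  have "eval_cpoly udom_const (arc_coord k n I \<Lambda>) (minor_coeff_poly k n I f p) =
    fps_nth (minor k (\<lambda>c r. map_fps ?E (if c \<in> I then (if c = pick I r then 1 else 0) else Abs_fps (\<lambda>p. var_poly (r, c, p)))) f) p"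
    unfolding minor_coeff_poly_def eval_part_poly_support[OF comm_ring_hom_udom] by (rule minor_map_fps[OF E])
  also have "\<dots> = fps_nth (minor k (entries (chart_mat k n I \<Lambda>)) f) p"
  proof (rule arg_cong[where f = "\<lambda>F. fps_nth F p"], rule minor_cong_entries[of n])
    fix c r assume cr: "c < n" "r < k"
    show "map_fps ?E (if c \<in> I then (if c = pick I r then 1 else 0) else Abs_fps (\<lambda>p. var_poly (r, c, p))) =
      entries (chart_mat k n I \<Lambda>) c r"
    proof (cases "c \<in> I")
      case True
      then obtain l where l: "l < k" "c = pick I l" using pick_image[OF I] by auto
      have "(c = pick I r) = (r = l)" using l cr pick_inj[OF I] by (auto simp: inj_on_def)
      then show ?thesis using True l entries_chart[OF A(1) I A(2) l(1) cr(2)]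
        by (auto intro!: fps_ext)
    next
      case False
      then show ?thesis using cr
        by (auto intro!: fps_ext simp: eval_cpoly_var[OF comm_ring_hom_udom] arc_vars_def chart_vars_def
            arc_coord_def chart_coord_def entries_def)
    qed
  qed (rule f)
  finally show ?thesis .
qed

text \<open>A lower bound on an order means the vanishing of coefficients, and on each chart these
  are polynomials in the arc coordinates. An infinite bound gives infinitely many equations, which a
  closed set allows.\<close>

lemma zariski_closed_minor_orders:
  "zariski_closed k n {\<Lambda> \<in> arcs k n. \<forall>f. (\<forall>l<k. f l < n) \<longrightarrow> e f \<le> arc_minor k n \<Lambda> f}"
  (is "zariski_closed k n ?Z")
  unfolding zariski_closed_def
proof (intro conjI ballI)
  show "?Z \<subseteq> arcs k n" by auto
  fix I assume I: "I \<in> col_sets k n"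
  let ?S = "{minor_coeff_poly k n I f p | f p. (\<forall>l<k. f l < n) \<and> enat p < e f}"
  have iff: "e f \<le> arc_minor k n \<Lambda> f \<longleftrightarrow>
      (\<forall>p. enat p < e f \<longrightarrow> eval_cpoly udom_const (arc_coord k n I \<Lambda>) (minor_coeff_poly k n I f p) = 0)"
    if L: "\<Lambda> \<in> chart k n I" and f: "\<forall>l<k. f l < n" for \<Lambda> f
  proof -
    have 1: "arc_minor k n \<Lambda> f = t_order (minor k (entries (chart_mat k n I \<Lambda>)) f)"
      by (rule arc_minor_chart[OF I L]) (use f in simp)
    have 2: "eval_cpoly udom_const (arc_coord k n I \<Lambda>) (minor_coeff_poly k n I f p) =
      fps_nth (minor k (entries (chart_mat k n I \<Lambda>)) f) p" for p
      by (rule eval_minor_coeff_poly[OF I L]) (use f in simp)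
    show ?thesis unfolding 1 2 t_power_dvd_iff[symmetric] t_power_dvd_iff_nth ..
  qed
  show "\<exists>S\<subseteq>cpolys (arc_vars k n I). ?Z \<inter> chart k n I =
      {\<Lambda> \<in> arcs k n \<inter> chart k n I. \<forall>f\<in>S. eval_cpoly udom_const (arc_coord k n I \<Lambda>) f = 0}"
  proof (intro exI[of _ ?S] conjI)
    show "?S \<subseteq> cpolys (arc_vars k n I)"
      unfolding minor_coeff_poly_def using part_poly_support_in_cpolys by blast
    have "\<Lambda> \<in> ?Z \<longleftrightarrow> \<Lambda> \<in> arcs k n \<and> (\<forall>f\<in>?S. eval_cpoly udom_const (arc_coord k n I \<Lambda>) f = 0)"
      if L: "\<Lambda> \<in> chart k n I" for \<Lambda>
    proof -
      have "(\<forall>f\<in>?S. eval_cpoly udom_const (arc_coord k n I \<Lambda>) f = 0) \<longleftrightarrow>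
        (\<forall>f. (\<forall>l<k. f l < n) \<longrightarrow> (\<forall>p. enat p < e f \<longrightarrow>
           eval_cpoly udom_const (arc_coord k n I \<Lambda>) (minor_coeff_poly k n I f p) = 0))" by blast
      then show ?thesis using iff[OF L] by auto
    qed
    then show "?Z \<inter> chart k n I =
      {\<Lambda> \<in> arcs k n \<inter> chart k n I. \<forall>f\<in>?S. eval_cpoly udom_const (arc_coord k n I \<Lambda>) f = 0}" by blast
  qed
qed

lemma minor_order_semicontinuous:
  assumes "zariski_closure k n C' \<subseteq> zariski_closure k n C"
    and C: "\<And>\<Lambda> f. \<Lambda> \<in> C \<Longrightarrow> (\<And>l. l < k \<Longrightarrow> f l < n) \<Longrightarrow> e f \<le> arc_minor k n \<Lambda> f" and "C \<subseteq> arcs k n"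
    and "\<Lambda>' \<in> C'" "\<And>l. l < k \<Longrightarrow> f l < n"
  shows "e f \<le> arc_minor k n \<Lambda>' f"
proof -
  let ?Z = "{\<Lambda> \<in> arcs k n. \<forall>f. (\<forall>l<k. f l < n) \<longrightarrow> e f \<le> arc_minor k n \<Lambda> f}"
  have "C \<subseteq> ?Z" using C assms(3) by blast
  then have "zariski_closure k n C \<subseteq> ?Z"
    unfolding zariski_closure_def by (rule hull_minimal) (rule zariski_closed_minor_orders)
  moreover have "\<Lambda>' \<in> zariski_closure k n C'"
    unfolding zariski_closure_def using assms(4) hull_subset[of C' "zariski_closed k n"] by blast
  ultimately show ?thesis using assms(1,5) by blast
qed

section \<open>The contact profile of an arc\<close>

definition class_order :: "nat \<Rightarrow> nat \<Rightarrow> arc \<Rightarrow> nat \<Rightarrow> nat \<Rightarrow> enat" where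
  "class_order k n \<Lambda> i j = Inf (arc_minor k n \<Lambda> ` net_class k (n - k) i j)"

lemma contact_profile_class_order:
  assumes "\<Lambda> \<in> arcs k n" "is_partition k n lam" "k \<le> n"
  shows "contact_profile k n \<Lambda> lam = (INF (i, j)\<in>partition_classes k (n - k) lam. class_order k n \<Lambda> i j)"
  unfolding contact_profile_minors[OF assms] class_order_def
proof (rule antisym)
  let ?J = "partition_classes k (n - k) lam"
  let ?O = "{arc_minor k n \<Lambda> f | f. \<exists>(i, j)\<in>?J. f \<in> net_class k (n - k) i j}"
  show "Inf ?O \<le> (INF (i, j)\<in>?J. Inf (arc_minor k n \<Lambda> ` net_class k (n - k) i j))"
  proof (rule INF_greatest)
    fix x assume "x \<in> ?J"
    then have "arc_minor k n \<Lambda> ` net_class k (n - k) (fst x) (snd x) \<subseteq> ?O" by force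
    then show "Inf ?O \<le> (case x of (i, j) \<Rightarrow> Inf (arc_minor k n \<Lambda> ` net_class k (n - k) i j))"
      by (cases x) (simp add: Inf_superset_mono)
  qed
  show "(INF (i, j)\<in>?J. Inf (arc_minor k n \<Lambda> ` net_class k (n - k) i j)) \<le> Inf ?O"
  proof (rule Inf_greatest)
    fix y assume "y \<in> ?O"
    then obtain f i j where f: "y = arc_minor k n \<Lambda> f" "(i, j) \<in> ?J" "f \<in> net_class k (n - k) i j" by blast
    have "(INF (i, j)\<in>?J. Inf (arc_minor k n \<Lambda> ` net_class k (n - k) i j)) \<le> Inf (arc_minor k n \<Lambda> ` net_class k (n - k) i j)"
      using INF_lower[OF f(2), of "\<lambda>(i, j). Inf (arc_minor k n \<Lambda> ` net_class k (n - k) i j)"] by simp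
    also have "\<dots> \<le> y" unfolding f(1) using f(3) by (rule INF_lower)
    finally show "(INF (i, j)\<in>?J. Inf (arc_minor k n \<Lambda> ` net_class k (n - k) i j)) \<le> y" .
  qed
qed

lemma arc_minor_not_inj:
  assumes "\<not> inj_on f {..<k}"
  shows "arc_minor k n \<Lambda> f = \<infinity>"
  unfolding arc_minor_def minor_not_inj[OF assms] by simp

text \<open>Selections with a repetition have infinite order, so only injective ones have to be
  compared.\<close>

lemma class_order_mono:
  assumes "\<And>f. f \<in> net_class k (n - k) i j \<Longrightarrow> inj_on f {..<k} \<Longrightarrow> f \<in> net_class k (n - k) i' j'"
  shows "class_order k n \<Lambda> i' j' \<le> class_order k n \<Lambda> i j"
  unfolding class_order_def
proof (rule INF_greatest)
  fix f assume f: "f \<in> net_class k (n - k) i j"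
  show "(INF f\<in>net_class k (n - k) i' j'. arc_minor k n \<Lambda> f) \<le> arc_minor k n \<Lambda> f"
  proof (cases "inj_on f {..<k}")
    case True
    then show ?thesis using assms f by (intro INF_lower) auto
  next
    case False
    then show ?thesis by (simp add: arc_minor_not_inj)
  qed
qed

lemma class_order_diagonal: "class_order k n \<Lambda> i j \<le> class_order k n \<Lambda> (Suc i) (Suc j)"
  by (rule class_order_mono) (auto simp: net_class_def)

text \<open>Lowering \<open>i\<close> moves the bound by one, which costs an injective selection at
  most one column.\<close>

lemma class_order_rows: "class_order k n \<Lambda> i j \<le> class_order k n \<Lambda> (Suc i) j"
proof (rule class_order_mono)
  fix f assume f: "f \<in> net_class k (n - k) (Suc i) j" "inj_on f {..<k}"
  let ?q = "n - k"
  let ?C = "{l. l < k \<and> f l + j < ?q + Suc i}" and ?D = "{l. l < k \<and> f l + j < ?q + i}"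
  let ?E = "{l. l < k \<and> f l + j = ?q + i}"
  have "card ?E \<le> card {?q + i - j}" by (rule card_inj_on_le[of f]) (use f(2) in \<open>auto simp: inj_on_def\<close>)
  moreover have "?C = ?D \<union> ?E" by auto
  then have "card ?C \<le> card ?D + card ?E" using card_Un_le[of ?D ?E] by simp
  ultimately have "i \<le> card ?D" using f(1) by (simp add: net_class_def)
  then show "f \<in> net_class k ?q i j" using f(1) by (simp add: net_class_def)
qed

text \<open>The index of a chart, whose minor is a unit, belongs to these families: at most
  \<open>k - i\<close> of its columns lie at \<open>n - k + i\<close> or later.\<close>

lemma class_order_zero:
  assumes \<Lambda>: "\<Lambda> \<in> arcs k n" and kn: "k \<le> n" and i: "i \<le> k" and "i = 0 \<or> j = 0"
  shows "class_order k n \<Lambda> i j = 0"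
proof -
  obtain I where I: "I \<in> col_sets k n" "\<Lambda> \<in> chart k n I"
    using grassmannian_in_chart \<Lambda> unfolding arcs_def by blast
  note A = chart_mat[OF I(2,1)]
  have pn: "\<And>l. l < k \<Longrightarrow> pick I l < n" using pick_less[OF I(1)] by simp
  have "arc_minor k n \<Lambda> (pick I) = t_order (minor k (entries (chart_mat k n I \<Lambda>)) (pick I))"
    by (rule arc_minor_chart[OF I]) (rule pn)
  then have "arc_minor k n \<Lambda> (pick I) = 0"
    unfolding minor_chart[OF A(1) I(1) A(2)] by simp
  moreover have "pick I \<in> net_class k (n - k) i j"
  proof (cases "i = 0")
    case True
    then show ?thesis using pn kn by (simp add: net_class_def)
  next
    case False
    then have j: "j = 0" using assms(4) by simp
    let ?C = "{l. l < k \<and> pick I l + j < n - k + i}" and ?D = "{l. l < k \<and> n - k + i \<le> pick I l}"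
    have "inj_on (pick I) ?D" using pick_inj[OF I(1)] by (rule inj_on_subset) auto
    then have "card ?D \<le> card {n - k + i..<n}" by (rule card_inj_on_le) (use pn in auto)
    moreover have "{..<k} = ?C \<union> ?D" using j by auto
    then have "card {..<k} \<le> card ?C + card ?D" using card_Un_le[of ?C ?D] by simp
    then have "k \<le> card ?C + card ?D" by simp
    ultimately have "i \<le> card ?C" using i kn by simp
    then show ?thesis using pn kn by (simp add: net_class_def)
  qed
  then have "class_order k n \<Lambda> i j \<le> arc_minor k n \<Lambda> (pick I)" unfolding class_order_def by (rule INF_lower)
  ultimately have "class_order k n \<Lambda> i j \<le> 0" by simp
  then show ?thesis by simp
qed

lemma rectangle_partition: "j \<le> n - k \<Longrightarrow> is_partition k n (rectangle i j)"
  unfolding is_partition_def rectangle_def by auto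

text \<open>The rectangle yields the families \<open>(Suc l, Suc j)\<close> with
  \<open>i \<le> l\<close>; by \<open>class_order_rows\<close> the one with \<open>l = i\<close> has
  the smallest order.\<close>

lemma rect_order_class_order:
  assumes \<Lambda>: "\<Lambda> \<in> arcs k n" and kn: "k \<le> n" and i: "i < k" and j: "j < n - k"
  shows "rect_order k n \<Lambda> (k - i) (n - k - j) = class_order k n \<Lambda> (Suc i) (Suc j)"
proof -
  let ?q = "n - k"
  have J: "partition_classes k ?q (rectangle (k - i) (?q - j)) = (\<lambda>l. (Suc l, Suc j)) ` {i..<k}"
  proof -
    have r: "rectangle (k - i) (?q - j) (k - l) = (if i \<le> l then ?q - j else 0)" if "l < k" for l
      using i that by (auto simp: rectangle_def)
    have J1: "Suc ?q - (?q - j) = Suc j" using j by simp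
    have "{(Suc l, Suc ?q - rectangle (k - i) (?q - j) (k - l)) | l. l < k \<and> 1 \<le> rectangle (k - i) (?q - j) (k - l)} =
      {(Suc l, Suc j) | l. l < k \<and> i \<le> l}"
      using r J1 j by (intro Collect_cong ex_cong) (auto split: if_splits)
    then show ?thesis unfolding partition_classes_def by auto
  qed
  have "class_order k n \<Lambda> (Suc i) (Suc j) \<le> class_order k n \<Lambda> (Suc l) (Suc j)" if "i \<le> l" for l
    using that by (induction l rule: dec_induct) (auto intro: order_trans class_order_rows)
  then have "(INF (i, j)\<in>(\<lambda>l. (Suc l, Suc j)) ` {i..<k}. class_order k n \<Lambda> i j) = class_order k n \<Lambda> (Suc i) (Suc j)"
    using i by (intro antisym INF_greatest) (auto intro!: INF_lower2[of "(Suc i, Suc j)"])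
  then have "contact_profile k n \<Lambda> (rectangle (k - i) (?q - j)) = class_order k n \<Lambda> (Suc i) (Suc j)"
    using contact_profile_class_order[OF \<Lambda> rectangle_partition kn, of "?q - j" "k - i"] unfolding J by simp
  moreover have "\<not> (k - i > k \<or> ?q - j > ?q)" by auto
  ultimately show ?thesis unfolding rect_order_def by simp
qed

text \<open>This is the diagonal successor in the definition of the invariant factors. The
  convention that orders outside the grid are 0 matches \<open>class_order_zero\<close>.\<close>

lemma rect_order_class_order':
  assumes \<Lambda>: "\<Lambda> \<in> arcs k n" and kn: "k \<le> n" and i: "i < k" and j: "j < n - k"
  shows "rect_order k n \<Lambda> (k - i + 1) (n - k - j + 1) = class_order k n \<Lambda> i j"
proof (cases "i = 0 \<or> j = 0")
  case True
  then show ?thesis using class_order_zero[OF \<Lambda> kn _ True] i j by (auto simp: rect_order_def)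
next
  case False
  then obtain i' j' where ij: "i = Suc i'" "j = Suc j'" by (metis not0_implies_Suc)
  have "k - i + 1 = k - i'" "n - k - j + 1 = n - k - j'" using i j ij by auto
  then show ?thesis using rect_order_class_order[OF \<Lambda> kn, of i' j'] i j ij by simp
qed

text \<open>Reversed indices, shifted so that the empty column \<open>j = 0\<close> has order \<open>0\<close>.\<close>
definition rev_profile :: "nat \<Rightarrow> nat \<Rightarrow> (nat \<Rightarrow> nat \<Rightarrow> enat) \<Rightarrow> nat \<Rightarrow> nat \<Rightarrow> enat" where
  "rev_profile k n \<beta> i j = (case j of 0 \<Rightarrow> 0 | Suc j' \<Rightarrow> \<beta> (k - i) (n - k - j'))"

lemma rev_profile_0 [simp]: "rev_profile k n \<beta> i 0 = 0"
  unfolding rev_profile_def by simp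

lemma rev_profile_rows:
  assumes "plane_partition k n \<beta>" "Suc i < k" "j \<le> n - k"
  shows "rev_profile k n \<beta> i j \<le> rev_profile k n \<beta> (Suc i) j"
proof (cases j)
  case (Suc j')
  have "\<beta> (k - Suc i + 1) (n - k - j') \<le> \<beta> (k - Suc i) (n - k - j')"
  proof -
    have "k - Suc i \<in> {1..<k}" "n - k - j' \<in> {1..n - k}" using assms Suc by auto
    then show ?thesis using assms(1) unfolding plane_partition_def by blast
  qed
  moreover have "k - Suc i + 1 = k - i" using assms by simp
  ultimately show ?thesis using Suc by (simp add: rev_profile_def)
qed simp

lemma rev_profile_columns:
  assumes "plane_partition k n \<beta>" "i < k" "j < n - k"
  shows "rev_profile k n \<beta> i j \<le> rev_profile k n \<beta> i (Suc j)"
proof (cases j)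
  case (Suc j')
  have "\<beta> (k - i) (n - k - j + 1) \<le> \<beta> (k - i) (n - k - j)"
  proof -
    have "k - i \<in> {1..k}" "n - k - j \<in> {1..<n - k}" using assms Suc by auto
    then show ?thesis using assms(1) unfolding plane_partition_def by blast
  qed
  moreover have "n - k - j + 1 = n - k - j'" using assms Suc by simp
  ultimately show ?thesis using Suc by (simp add: rev_profile_def)
qed simp

text \<open>The order of the family \<open>(i, j)\<close> predicted by \<beta>: invariant factors
  added along the diagonal that ends at row \<open>i - 1\<close> and level \<open>j\<close>. Outside
  the grid the truncated subtraction gives level 0, which contributes 0.\<close>

definition profile_sum :: "nat \<Rightarrow> nat \<Rightarrow> (nat \<Rightarrow> nat \<Rightarrow> enat) \<Rightarrow> nat \<Rightarrow> nat \<Rightarrow> enat" where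
  "profile_sum k n \<beta> i j = (\<Sum>r<i. rev_profile k n \<beta> r (j + 1 + r - i))"

lemma profile_sum_step: "profile_sum k n \<beta> (Suc i) (Suc j) = rev_profile k n \<beta> i (Suc j) + profile_sum k n \<beta> i j"
  unfolding profile_sum_def by (simp add: add.commute)

lemma profile_sum_0: "i = 0 \<or> j = 0 \<Longrightarrow> profile_sum k n \<beta> i j = 0"
  unfolding profile_sum_def by (auto intro!: sum.neutral)

lemma enat_diff_add: "(b::enat) \<le> a \<Longrightarrow> a - b + b = a"
  by (cases a; cases b) auto

text \<open>The differences that define \<beta> add up along diagonals. By
  \<open>class_order_diagonal\<close> the subtraction can be undone, also at infinity.\<close>

lemma class_order_stratum:
  assumes \<Lambda>: "\<Lambda> \<in> contact_stratum k n \<beta>" and kn: "k \<le> n" and "i \<le> k" "j \<le> n - k"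
  shows "class_order k n \<Lambda> i j = profile_sum k n \<beta> i j"
  using assms(3,4)
proof (induction i arbitrary: j)
  case 0
  have "\<Lambda> \<in> arcs k n" using \<Lambda> unfolding contact_stratum_def by simp
  then show ?case using class_order_zero[of \<Lambda> k n 0 j] kn by (simp add: profile_sum_0)
next
  case (Suc i)
  have arc: "\<Lambda> \<in> arcs k n" using \<Lambda> unfolding contact_stratum_def by simp
  show ?case
  proof (cases j)
    case 0
    then show ?thesis using class_order_zero[OF arc kn, of "Suc i" 0] Suc.prems by (simp add: profile_sum_0)
  next
    case (Suc j')
    have ij: "i < k" "j' < n - k" using Suc.prems Suc by auto
    have "invariant_factor_profile k n \<Lambda> (k - i) (n - k - j') = \<beta> (k - i) (n - k - j')"
    proof -
      have "k - i \<in> {1..k}" "n - k - j' \<in> {1..n - k}" using ij by auto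
      then show ?thesis using \<Lambda> unfolding contact_stratum_def by blast
    qed
    then have "class_order k n \<Lambda> (Suc i) (Suc j') - class_order k n \<Lambda> i j' = rev_profile k n \<beta> i (Suc j')"
      unfolding invariant_factor_profile_def rect_order_class_order[OF arc kn ij] rect_order_class_order'[OF arc kn ij]
      by (simp add: rev_profile_def)
    then have "class_order k n \<Lambda> (Suc i) (Suc j') = rev_profile k n \<beta> i (Suc j') + class_order k n \<Lambda> i j'"
      using enat_diff_add[OF class_order_diagonal[of k n \<Lambda> i j']] by simp
    then show ?thesis unfolding Suc profile_sum_step using Suc.IH[of j'] ij by simp
  qed
qed

text \<open>The orders of the families depend on \<beta> only, so the contact profile is constant on
  the stratum. It therefore bounds the minors of the relevant families on the whole stratum, and the
  bound passes to the closure.\<close>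

lemma contact_profile_semicontinuous:
  assumes kn: "k \<le> n" and sub: "zariski_closure k n (contact_stratum k n \<beta>') \<subseteq> zariski_closure k n (contact_stratum k n \<beta>)"
    and \<Lambda>: "\<Lambda> \<in> contact_stratum k n \<beta>" and \<Lambda>': "\<Lambda>' \<in> contact_stratum k n \<beta>'" and lam: "is_partition k n lam"
  shows "contact_profile k n \<Lambda> lam \<le> contact_profile k n \<Lambda>' lam"
proof -
  have arc: "\<Lambda> \<in> arcs k n" "\<Lambda>' \<in> arcs k n" using \<Lambda> \<Lambda>' unfolding contact_stratum_def by auto
  let ?J = "partition_classes k (n - k) lam"
  let ?in = "\<lambda>f. \<exists>(i, j)\<in>?J. f \<in> net_class k (n - k) i j"
  define e where "e f = (if ?in f then contact_profile k n \<Lambda> lam else 0)" for f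
  have const: "contact_profile k n \<Lambda>1 lam = contact_profile k n \<Lambda> lam" if L1: "\<Lambda>1 \<in> contact_stratum k n \<beta>" for \<Lambda>1
  proof -
    have arc1: "\<Lambda>1 \<in> arcs k n" using L1 unfolding contact_stratum_def by simp
    show ?thesis unfolding contact_profile_class_order[OF arc1 lam kn] contact_profile_class_order[OF arc(1) lam kn]
    proof (rule INF_cong[OF refl])
      fix x assume "x \<in> ?J"
      then have "fst x \<le> k" "snd x \<le> n - k" using partition_classes_subset[OF lam] by auto
      then show "(case x of (i, j) \<Rightarrow> class_order k n \<Lambda>1 i j) = (case x of (i, j) \<Rightarrow> class_order k n \<Lambda> i j)"
        using class_order_stratum[OF L1 kn] class_order_stratum[OF \<Lambda> kn] by (cases x) simp
    qed
  qed
  have *: "e f \<le> arc_minor k n \<Lambda>' f" if f: "\<And>l. l < k \<Longrightarrow> f l < n" for f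
  proof (rule minor_order_semicontinuous[OF sub _ _ \<Lambda>' f])
    show "contact_stratum k n \<beta> \<subseteq> arcs k n" unfolding contact_stratum_def by auto
    fix \<Lambda>1 g assume L1: "\<Lambda>1 \<in> contact_stratum k n \<beta>"
    then have arc1: "\<Lambda>1 \<in> arcs k n" unfolding contact_stratum_def by simp
    show "e g \<le> arc_minor k n \<Lambda>1 g"
    proof (cases "?in g")
      case True
      then show ?thesis unfolding e_def const[OF L1, symmetric] contact_profile_minors[OF arc1 lam kn]
        by (auto intro: Inf_lower)
    qed (simp add: e_def)
  qed
  show ?thesis unfolding contact_profile_minors[OF arc(2) lam kn]
  proof (rule Inf_greatest)
    fix y assume "y \<in> {arc_minor k n \<Lambda>' f | f. ?in f}"
    then obtain f where f: "y = arc_minor k n \<Lambda>' f" "?in f" by blast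
    have "f l < n" if "l < k" for l using f(2) that kn by (auto simp: net_class_def)
    then have "e f \<le> y" using * f(1) by simp
    then show "contact_profile k n \<Lambda> lam \<le> y" using f(2) by (simp add: e_def)
  qed
qed

section \<open>Path sums in the planar network\<close>

lemma net_paths_last_step:
  "net_paths k n a b = (if a = b then {[b]} else {}) \<union>
     (\<Union>u\<in>{u. net_edge k n u b}. (\<lambda>xs. xs @ [b]) ` net_paths k n a u)"
proof (intro equalityI subsetI)
  fix xs assume xs: "xs \<in> net_paths k n a b"
  then obtain ys where ys: "xs = ys @ [b]"
    unfolding net_paths_def by (cases xs rule: rev_cases) auto
  show "xs \<in> (if a = b then {[b]} else {}) \<union> (\<Union>u\<in>{u. net_edge k n u b}. (\<lambda>xs. xs @ [b]) ` net_paths k n a u)"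
  proof (cases "ys = []")
    case True
    then show ?thesis using xs ys by (auto simp: net_paths_def)
  next
    case False
    then have "net_edge k n (last ys) b" "ys \<in> net_paths k n a (last ys)"
      using xs ys by (auto simp: net_paths_def successively_append_iff)
    then show ?thesis using ys by blast
  qed
qed (auto simp: net_paths_def successively_append_iff split: if_splits)

definition preds :: "nat \<Rightarrow> nat \<Rightarrow> net_vertex \<Rightarrow> net_vertex set" where
  "preds k n b = {u. net_edge k n u b}"

lemma preds_Source: "preds k n (Source r) = {}"
  unfolding preds_def by (auto elim: net_edge.cases)

lemma preds_Sink: "j \<in> {1..n - k} \<Longrightarrow> preds k n (Sink j) = {Internal k j}"
  unfolding preds_def by (auto elim: net_edge.cases intro: net_edge.intros)

lemma preds_Internal:
  assumes "i < k" "j < n - k"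
  shows "preds k n (Internal (k - i) (n - k - j)) =
    (if j = 0 then {Source (k - i)} else {Internal (k - i) (n - k - (j - 1))}) \<union>
    (if Suc i < k then {Internal (k - Suc i) (n - k - j)} else {})" (is "_ = ?R")
proof (intro equalityI subsetI)
  fix u assume "u \<in> preds k n (Internal (k - i) (n - k - j))"
  then have "net_edge k n u (Internal (k - i) (n - k - j))" by (simp add: preds_def)
  then show "u \<in> ?R" using assms by cases (auto split: if_splits)
next
  fix u assume u: "u \<in> ?R"
  have "net_edge k n u (Internal (k - i) (n - k - j))"
  proof (cases "Suc i < k \<and> u = Internal (k - Suc i) (n - k - j)")
    case True
    then have "k - Suc i \<in> {1..<k}" "n - k - j \<in> {1..n - k}" "k - Suc i + 1 = k - i" using assms by auto
    then show ?thesis using net_edge.intros(3)[of "k - Suc i" k "n - k - j" n] True by metis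
  next
    case False
    then have u: "u = (if j = 0 then Source (k - i) else Internal (k - i) (n - k - (j - 1)))"
      using u by (auto split: if_splits)
    show ?thesis
    proof (cases "j = 0")
      case True
      then show ?thesis using net_edge.intros(1)[of "k - i" k n] u assms by auto
    next
      case False
      then have "n - k - (j - 1) = n - k - j + 1" "k - i \<in> {1..k}" "n - k - j \<in> {1..<n - k}" using assms by auto
      then show ?thesis using net_edge.intros(2)[of "k - i" k "n - k - j" n] u False by metis
    qed
  qed
  then show "u \<in> preds k n (Internal (k - i) (n - k - j))" by (simp add: preds_def)
qed

lemma finite_preds: "finite (preds k n b)"
proof (cases b)
  case (Internal i j)
  have "preds k n b \<subseteq> {Source i, Internal i (j + 1), Internal (i - 1) j}"
    unfolding preds_def Internal by (auto elim: net_edge.cases)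
  then show ?thesis by (rule finite_subset) simp
next
  case (Sink j)
  have "preds k n b \<subseteq> {Internal k j}" unfolding preds_def Sink by (auto elim: net_edge.cases)
  then show ?thesis by (rule finite_subset) simp
qed (simp add: preds_Source)

text \<open>A rank that grows along every edge, so that induction over predecessors
  terminates.\<close>

fun net_level :: "nat \<Rightarrow> nat \<Rightarrow> net_vertex \<Rightarrow> nat" where
  "net_level k n (Source i) = 0"
| "net_level k n (Internal i j) = Suc (i + (n - k - j))"
| "net_level k n (Sink j) = Suc (Suc (k + n))"

lemma net_level_less: "u \<in> preds k n b \<Longrightarrow> net_level k n u < net_level k n b"
  unfolding preds_def mem_Collect_eq by (erule net_edge.cases) auto

lemma finite_net_paths: "finite (net_paths k n a b)"
proof (induction "net_level k n b" arbitrary: b rule: less_induct)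
  case less
  have "finite (\<Union>u\<in>preds k n b. (\<lambda>xs. xs @ [b]) ` net_paths k n a u)"
    using finite_preds less net_level_less by blast
  then show ?case by (subst net_paths_last_step) (simp add: preds_def)
qed

definition path_sum :: "nat \<Rightarrow> nat \<Rightarrow> (nat \<Rightarrow> nat \<Rightarrow> 'r::comm_ring_1) \<Rightarrow> net_vertex \<Rightarrow> net_vertex \<Rightarrow> 'r" where
  "path_sum k n w a b = (\<Sum>xs\<in>net_paths k n a b. path_weight k n w xs)"

lemma path_weight_snoc:
  "xs \<noteq> [] \<Longrightarrow> path_weight k n w (xs @ [b]) =
    path_weight k n w xs * (edge_weight k n w (last xs, b) * vertex_weight k n w b)"
proof -
  assume "xs \<noteq> []"
  then have "zip (xs @ [b]) (tl (xs @ [b])) = zip xs (tl xs) @ [(last xs, b)]"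
  proof (induction xs)
    case (Cons x xs)
    then show ?case by (cases xs) auto
  qed simp
  then show ?thesis unfolding path_weight_def by (simp add: algebra_simps)
qed

lemma path_sum_step:
  assumes "a \<noteq> b"
  shows "path_sum k n w a b = (\<Sum>u\<in>preds k n b. path_sum k n w a u * (edge_weight k n w (u, b) * vertex_weight k n w b))"
proof -
  have "path_sum k n w a b = (\<Sum>xs\<in>(\<Union>u\<in>preds k n b. (\<lambda>xs. xs @ [b]) ` net_paths k n a u). path_weight k n w xs)"
    unfolding path_sum_def by (subst net_paths_last_step) (simp add: assms preds_def)
  also have "\<dots> = (\<Sum>u\<in>preds k n b. \<Sum>xs\<in>(\<lambda>xs. xs @ [b]) ` net_paths k n a u. path_weight k n w xs)"
    by (intro sum.UNION_disjoint) (auto simp: finite_preds finite_net_paths, auto simp: net_paths_def)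
  also have "\<dots> = (\<Sum>u\<in>preds k n b. \<Sum>xs\<in>net_paths k n a u. path_weight k n w (xs @ [b]))"
    by (simp add: sum.reindex inj_on_def)
  also have "\<dots> = (\<Sum>u\<in>preds k n b. path_sum k n w a u * (edge_weight k n w (u, b) * vertex_weight k n w b))"
  proof (rule sum.cong[OF refl])
    fix u
    have "path_weight k n w (xs @ [b]) = path_weight k n w xs * (edge_weight k n w (u, b) * vertex_weight k n w b)"
      if "xs \<in> net_paths k n a u" for xs
      using that path_weight_snoc[of xs k n w b] by (auto simp: net_paths_def)
    then show "(\<Sum>xs\<in>net_paths k n a u. path_weight k n w (xs @ [b])) =
        path_sum k n w a u * (edge_weight k n w (u, b) * vertex_weight k n w b)"
      unfolding path_sum_def sum_distrib_right by (intro sum.cong) auto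
  qed
  finally show ?thesis .
qed

lemma path_sum_Source: "path_sum k n w (Source r) (Source s) = (if r = s then 1 else 0)"
proof (cases "r = s")
  case True
  have "net_paths k n (Source r) (Source r) = {[Source r]}"
    using net_paths_last_step[of k n "Source r" "Source r"] preds_Source[of k n r] by (simp add: preds_def)
  then show ?thesis using True unfolding path_sum_def by (simp add: path_weight_def)
next
  case False
  then show ?thesis using path_sum_step[of "Source r" "Source s" k n w] by (simp add: preds_Source)
qed

lemma path_sum_Sink:
  "j \<in> {1..n - k} \<Longrightarrow> path_sum k n w (Source r) (Sink j) = path_sum k n w (Source r) (Internal k j)"
  by (simp add: path_sum_step[of _ "Sink j"] preds_Sink)

text \<open>In reversed indices a path enters \<open>(i, j)\<close> from \<open>(Suc i, j)\<close>
  or \<open>(i, j - 1)\<close>. The essential weight sits on the horizontal edge for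
  \<open>i < j\<close>, on the vertex for \<open>i = j\<close> and on the vertical edge
  otherwise.\<close>

lemma path_sum_Internal:
  fixes w :: "nat \<Rightarrow> nat \<Rightarrow> 'r::comm_ring_1"
  assumes "i < k" "j < n - k" and r: "r < k"
  defines "w' \<equiv> \<lambda>i j. w (k - i) (n - k - j)"
  defines "F \<equiv> \<lambda>i j. if i < k then path_sum k n w (Source (k - r)) (Internal (k - i) (n - k - j)) else 0"
  shows "F i j = (if i = j then w' i i else 1) * ((if j < Suc i then w' (Suc i) j else 1) * F (Suc i) j +
    (if i < j then w' i j else 1) * (if j = 0 then (if r = i then 1 else 0) else F i (j - 1)))"
proof -
  let ?q = "n - k"
  let ?b = "Internal (k - i) (?q - j)"
  let ?g = "\<lambda>u. path_sum k n w (Source (k - r)) u * (edge_weight k n w (u, ?b) * vertex_weight k n w ?b)"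
  let ?u = "if j = 0 then Source (k - i) else Internal (k - i) (?q - (j - 1))"
  have v: "vertex_weight k n w ?b = (if i = j then w' i i else 1)"
    using assms(1,2) by (auto simp: w'_def)
  have 1: "?g ?u = (if i = j then w' i i else 1) * ((if i < j then w' i j else 1) * (if j = 0 then (if r = i then 1 else 0) else F i (j - 1)))"
  proof (cases "j = 0")
    case True
    have "k - r = k - i \<longleftrightarrow> r = i" using assms(1) r by auto
    then show ?thesis unfolding v using True by (simp add: path_sum_Source)
  next
    case False
    then have "?q - (j - 1) = ?q - j + 1" using assms(2) by auto
    then have "edge_weight k n w (Internal (k - i) (?q - (j - 1)), ?b) = (if i < j then w' i j else 1)"
      using assms(1,2) by (auto simp: w'_def)
    then show ?thesis unfolding v using False assms(1) by (simp add: F_def algebra_simps)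
  qed
  have 2: "?g (Internal (k - Suc i) (?q - j)) = (if i = j then w' i i else 1) * ((if j < Suc i then w' (Suc i) j else 1) * F (Suc i) j)"
    if "Suc i < k"
  proof -
    have "k - i = k - Suc i + 1" using that by simp
    then have "edge_weight k n w (Internal (k - Suc i) (?q - j), ?b) = (if j < Suc i then w' (Suc i) j else 1)"
      using assms(1,2) that by (auto simp: w'_def)
    then show ?thesis unfolding v using that by (simp add: F_def algebra_simps)
  qed
  have "F i j = (\<Sum>u\<in>preds k n ?b. ?g u)"
    using assms(1) by (simp add: F_def path_sum_step)
  also have "\<dots> = (\<Sum>u\<in>{?u}. ?g u) + (\<Sum>u\<in>(if Suc i < k then {Internal (k - Suc i) (?q - j)} else {}). ?g u)"
  proof -
    have "preds k n ?b = {?u} \<union> (if Suc i < k then {Internal (k - Suc i) (?q - j)} else {})"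
      unfolding preds_Internal[OF assms(1,2)] by (rule arg_cong2[where f = "(\<union>)"]) auto
    then show ?thesis by (simp only:, intro sum.union_disjoint) auto
  qed
  also have "\<dots> = ?g ?u + (if Suc i < k then ?g (Internal (k - Suc i) (?q - j)) else 0)" by simp
  also have "\<dots> = (if i = j then w' i i else 1) * ((if i < j then w' i j else 1) * (if j = 0 then (if r = i then 1 else 0) else F i (j - 1)))
      + (if i = j then w' i i else 1) * ((if j < Suc i then w' (Suc i) j else 1) * F (Suc i) j)"
    unfolding 1 using 2 by (simp add: F_def)
  finally show ?thesis by (simp only: distrib_left add.commute)
qed

section \<open>Networks and their essential weightings\<close>

text \<open>\<open>h i j\<close> is the product of the essential weights of column \<open>j\<close>
  in the rows from \<open>j\<close> to \<open>i\<close>. Multiplying path sums by it below the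
  diagonal moves the weights of vertical edges to horizontal ones. On the diagonal the vertex weight
  already contains this factor, hence the test \<open>j < i\<close>.\<close>

lemma ncol_gauge:
  fixes F :: "nat \<Rightarrow> nat \<Rightarrow> 'a::comm_ring_1"
  assumes F0: "\<And>j. F k j = 0"
    and F: "\<And>i j. i < k \<Longrightarrow> j < q \<Longrightarrow> F i j = (if i = j then w i i else 1) * ((if j < Suc i then w (Suc i) j else 1) * F (Suc i) j +
      (if i < j then w i j else 1) * (if j = 0 then (if r = i then 1 else 0) else F i (j - 1)))"
    and h_diag: "\<And>j. j < k \<Longrightarrow> h j j = w j j"
    and h_step: "\<And>i j. j \<le> i \<Longrightarrow> Suc i < k \<Longrightarrow> j < q \<Longrightarrow> h (Suc i) j = h i j * w (Suc i) j"
    and \<rho>_0: "\<And>i. i < k \<Longrightarrow> \<rho> i 0 = h i 0"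
    and \<rho>_lower: "\<And>i j. i < k \<Longrightarrow> Suc j \<le> i \<Longrightarrow> Suc j < q \<Longrightarrow> \<rho> i (Suc j) * h i j = h i (Suc j)"
    and \<rho>_upper: "\<And>i j. i < k \<Longrightarrow> i < j \<Longrightarrow> j < q \<Longrightarrow> \<rho> i j = w i j"
  shows "j < q \<Longrightarrow> i \<le> k \<Longrightarrow> ncol k \<rho> (Suc j) i r = (if j < i then h i j else 1) * F i j"
proof (induction j arbitrary: i)
  case (0 i)
  show ?case using 0(2)
  proof (induction i rule: inc_induct)
    case base
    then show ?case by (simp add: F0)
  next
    case (step i)
    have IH: "ncol k \<rho> (Suc 0) (Suc i) r = h (Suc i) 0 * F (Suc i) 0" using step by simp
    have s: "h (Suc i) 0 * F (Suc i) 0 = h i 0 * (w (Suc i) 0 * F (Suc i) 0)"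
      using h_step[of 0 i] 0 F0 step by (cases "Suc i = k") auto
    have "ncol k \<rho> (Suc 0) i r = h i 0 * (w (Suc i) 0 * F (Suc i) 0 + (if r = i then 1 else 0))"
      using ncol_step[OF step(2), of \<rho> 0 r] \<rho>_0[OF step(2)] unfolding IH s by (simp add: algebra_simps)
    moreover have "F i 0 = (if i = 0 then w i i else 1) * (w (Suc i) 0 * F (Suc i) 0 + (if r = i then 1 else 0))"
      using F[OF step(2), of 0] 0 by simp
    ultimately show ?case using h_diag[OF step(2)] by (cases "i = 0") simp_all
  qed
next
  case (Suc j i)
  show ?case using Suc.prems(2)
  proof (induction i rule: inc_induct)
    case base
    then show ?case by (simp add: F0)
  next
    case (step i)
    have j: "j < q" using Suc.prems by simp
    have A: "ncol k \<rho> (Suc (Suc j)) i r = ncol k \<rho> (Suc (Suc j)) (Suc i) r + \<rho> i (Suc j) * ncol k \<rho> (Suc j) i r"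
      by (rule ncol_step[OF step(2)])
    have B: "ncol k \<rho> (Suc j) i r = (if j < i then h i j else 1) * F i j"
      using Suc.IH[OF j, of i] step by simp
    note C = F[OF step(2) Suc.prems(1)]
    consider "i = Suc j" | "Suc j < i" | "i < Suc j" by linarith
    then show ?case
    proof cases
      case 1
      have s: "h (Suc i) (Suc j) * F (Suc i) (Suc j) = h i (Suc j) * (w (Suc i) (Suc j) * F (Suc i) (Suc j))"
        using h_step[of "Suc j" i] Suc.prems F0 step 1 by (cases "Suc i = k") auto
      have "ncol k \<rho> (Suc (Suc j)) i r = h i (Suc j) * (w (Suc i) (Suc j) * F (Suc i) (Suc j)) + \<rho> i (Suc j) * h i j * F i j"
        unfolding A B using step.IH 1 s by (simp add: mult.assoc)
      also have "\<dots> = h i (Suc j) * (w (Suc i) (Suc j) * F (Suc i) (Suc j) + F i j)"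
        using \<rho>_lower[OF step(2), of j] 1 Suc.prems by (simp add: algebra_simps)
      also have "\<dots> = F i (Suc j)" using C h_diag[OF step(2)] 1 by simp
      finally show ?thesis using 1 by simp
    next
      case 2
      have s: "h (Suc i) (Suc j) * F (Suc i) (Suc j) = h i (Suc j) * (w (Suc i) (Suc j) * F (Suc i) (Suc j))"
        using h_step[of "Suc j" i] Suc.prems F0 step 2 by (cases "Suc i = k") auto
      have "ncol k \<rho> (Suc (Suc j)) i r = h i (Suc j) * (w (Suc i) (Suc j) * F (Suc i) (Suc j)) + \<rho> i (Suc j) * h i j * F i j"
        unfolding A B using step.IH 2 s by (simp add: mult.assoc)
      also have "\<dots> = h i (Suc j) * (w (Suc i) (Suc j) * F (Suc i) (Suc j) + F i j)"
        using \<rho>_lower[OF step(2), of j] 2 Suc.prems by (simp add: algebra_simps)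
      also have "\<dots> = h i (Suc j) * F i (Suc j)" using C 2 by simp
      finally show ?thesis using 2 by simp
    next
      case 3
      have "ncol k \<rho> (Suc (Suc j)) i r = F (Suc i) (Suc j) + w i (Suc j) * F i j"
        unfolding A B using step.IH 3 \<rho>_upper[OF step(2) 3 Suc.prems(1)] by simp
      also have "\<dots> = F i (Suc j)" using C 3 by simp
      finally show ?thesis using 3 by simp
    qed
  qed
qed

text \<open>The network with weights \<open>\<rho>\<close> on its horizontal edges only is obtained from the essential
  weighting \<open>w\<close> by rescaling at the internal vertices; \<open>h\<close> is the scaling factor below the diagonal.\<close>
lemma net_arc_matrix_netcol:
  fixes w :: "nat \<Rightarrow> nat \<Rightarrow> 'a::comm_ring_1"
  assumes kn: "k \<le> n"
    and h_diag: "\<And>j. j < k \<Longrightarrow> j < n - k \<Longrightarrow> h j j = w (k - j) (n - k - j)"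
    and h_step: "\<And>i j. j \<le> i \<Longrightarrow> Suc i < k \<Longrightarrow> j < n - k \<Longrightarrow> h (Suc i) j = h i j * w (k - Suc i) (n - k - j)"
    and \<rho>_0: "\<And>i. i < k \<Longrightarrow> 0 < n - k \<Longrightarrow> \<rho> i 0 = h i 0"
    and \<rho>_lower: "\<And>i j. i < k \<Longrightarrow> Suc j \<le> i \<Longrightarrow> Suc j < n - k \<Longrightarrow> \<rho> i (Suc j) * h i j = h i (Suc j)"
    and \<rho>_upper: "\<And>i j. i < k \<Longrightarrow> i < j \<Longrightarrow> j < n - k \<Longrightarrow> \<rho> i j = w (k - i) (n - k - j)"
    and c: "c < n" and r: "r < k"
  shows "entries (net_arc_matrix k n w) c (k - Suc r) = netcol k (n - k) \<rho> c r"
proof (cases "c < n - k")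
  case True
  let ?q = "n - k"
  define w' where "w' i j = w (k - i) (?q - j)" for i j
  define F where "F i j = (if i < k then path_sum k n w (Source (k - r)) (Internal (k - i) (?q - j)) else 0)" for i j
  define j where "j = ?q - Suc c"
  have j: "j < ?q" "?q - c = Suc j" "?q - j = Suc c" using True by (auto simp: j_def)
  \<comment> \<open>\<open>ncol_gauge\<close> asks for the diagonal values of \<open>h\<close> in
    all rows, also beyond the last column of the grid; \<open>w'\<close> supplies them
    there.\<close>
  define h' where "h' i j = (if j < ?q then h i j else w' i j)" for i j
  have "ncol k \<rho> (Suc j) 0 r = (if j < 0 then h' 0 j else 1) * F 0 j"
  proof (rule ncol_gauge[where q = ?q and w = w' and F = F and k = k])
    fix i j assume "i < k" "j < ?q"
    then show "F i j = (if i = j then w' i i else 1) * ((if j < Suc i then w' (Suc i) j else 1) * F (Suc i) j +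
      (if i < j then w' i j else 1) * (if j = 0 then (if r = i then 1 else 0) else F i (j - 1)))"
      unfolding F_def w'_def by (rule path_sum_Internal[OF _ _ r])
  qed (use j assms in \<open>auto simp: w'_def h'_def F_def\<close>)
  moreover have "entries (net_arc_matrix k n w) c (k - Suc r) = path_sum k n w (Source (k - r)) (Sink (Suc c))"
    using True c r unfolding entries_def net_arc_matrix_def net_matrix_def path_sum_def
    by (simp add: Suc_diff_Suc)
  moreover have "path_sum k n w (Source (k - r)) (Sink (Suc c)) = F 0 j"
    using path_sum_Sink[of "Suc c" n k w "k - r"] True r j by (simp add: F_def)
  ultimately show ?thesis using True j unfolding netcol_def by (simp del: ncol.simps)
next
  case False
  then show ?thesis using c r kn unfolding entries_def net_arc_matrix_def antidiag_def netcol_def by auto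
qed

text \<open>Row reversal multiplies minors by the determinant of a permutation matrix. Divisibility
  in both directions then gives equal orders without computing it.\<close>

lemma minor_reverse_rows_dvd:
  assumes a: "\<And>c r. c < n \<Longrightarrow> r < k \<Longrightarrow> a c r = b c (k - Suc r)" and f: "\<And>l. l < k \<Longrightarrow> f l < n"
  shows "minor k b f dvd minor k a f"
proof -
  have "minor k a f = det (mat k k (\<lambda>(r, s). if s = k - Suc r then 1 else 0)) * minor k b f"
  proof (rule minor_left_mult[OF _ f])
    fix c r assume cr: "c < n" "r < k"
    have "(\<Sum>s<k. (if s = k - Suc r then 1 else 0) * b c s) = (\<Sum>s<k. if s = k - Suc r then b c s else 0)"
      by (intro sum.cong) auto
    also have "\<dots> = b c (k - Suc r)" using cr by simp
    finally show "a c r = (\<Sum>s<k. (if s = k - Suc r then 1 else 0) * b c s)" using a cr by simp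
  qed
  then show ?thesis by simp
qed

lemma minor_reverse_rows_order:
  fixes a b :: "nat \<Rightarrow> nat \<Rightarrow> 'a::field fps"
  assumes a: "\<And>c r. c < n \<Longrightarrow> r < k \<Longrightarrow> b c (k - Suc r) = a c r" and f: "\<And>l. l < k \<Longrightarrow> f l < n"
  shows "t_order (minor k b f) = t_order (minor k a f)"
proof -
  have "minor k b f dvd minor k a f"
    by (rule minor_reverse_rows_dvd[of n]) (use a f in auto)
  moreover have "minor k a f dvd minor k b f"
  proof (rule minor_reverse_rows_dvd[of n])
    fix c r assume "c < n" "r < k"
    then show "b c r = a c (k - Suc r)" using a[of c "k - Suc r"] by (simp add: Suc_diff_Suc)
  qed (rule f)
  ultimately show ?thesis unfolding dvd_iff_t_order by (rule antisym)
qed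

section \<open>Specialization of the generic network\<close>

lemma vertex_weight_hom:
  assumes "comm_ring_hom h"
  shows "vertex_weight k n (\<lambda>i j. h (w i j)) v = h (vertex_weight k n w v)"
proof -
  interpret comm_ring_hom h by fact
  show ?thesis by (cases v) auto
qed

lemma edge_weight_hom:
  assumes "comm_ring_hom h"
  shows "edge_weight k n (\<lambda>i j. h (w i j)) e = h (edge_weight k n w e)"
proof -
  interpret comm_ring_hom h by fact
  show ?thesis by (cases "(k, n, w, e)" rule: edge_weight.cases) auto
qed

lemma net_arc_matrix_hom:
  assumes "comm_ring_hom h" and cr: "c < n" "r < k"
  shows "entries (net_arc_matrix k n (\<lambda>i j. h (w i j))) c r = h (entries (net_arc_matrix k n w) c r)"
proof -
  interpret comm_ring_hom h by fact
  have prod: "prod_list (map (\<lambda>x. h (g x)) xs) = h (prod_list (map g xs))" for g :: "'x \<Rightarrow> _" and xs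
    by (induction xs) (auto simp: hom_distribs)
  have "path_weight k n (\<lambda>i j. h (w i j)) xs = h (path_weight k n w xs)" for xs
    unfolding path_weight_def vertex_weight_hom[OF assms(1)] edge_weight_hom[OF assms(1)] prod by (simp add: hom_distribs)
  then show ?thesis using cr
    by (cases "c < n - k") (auto simp: entries_def net_arc_matrix_def net_matrix_def antidiag_def hom_distribs)
qed

lemma map_fps_t_power:
  assumes "comm_ring_hom h"
  shows "map_fps h (t_power e) = t_power e"
proof -
  interpret comm_ring_hom h by fact
  show ?thesis
    by (cases e) (auto intro!: fps_ext simp: t_power_enat fps_X_power_nth)
qed

text \<open>This evaluation is the embedding of the polynomial ring into its fraction field and on
  into the algebraic closure.\<close>

lemma eval_udom_var_eq_0:
  assumes "eval_cpoly udom_const udom_var f = 0"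
  shows "f = 0"
proof -
  let ?\<phi> = "\<lambda>f :: nat cpoly. to_ac (Fract f 1)"
  have hom: "comm_ring_hom ?\<phi>"
    by unfold_locales (auto simp: Zero_fract_def One_fract_def simp flip: to_ac_add to_ac_mult)
  have "?\<phi> (eval_cpoly const_poly var_poly f) = eval_cpoly udom_const udom_var f"
    unfolding eval_cpoly_hom[OF hom] udom_const_def udom_var_def const_poly_def var_poly_def ..
  then have "to_ac (Fract f 1) = 0" using assms by (simp add: eval_cpoly_var_poly)
  then have "Fract f 1 = 0" by simp
  then show ?thesis by (simp add: Zero_fract_def eq_fract)
qed

text \<open>The generic weight before evaluation. One and the same minor can thus be evaluated at
  \<open>udom_var\<close> and at the coefficients of a given weighting.\<close>

definition symbolic_weight :: "nat \<Rightarrow> nat \<Rightarrow> (nat \<Rightarrow> nat \<Rightarrow> enat) \<Rightarrow> nat \<Rightarrow> nat \<Rightarrow> nat cpoly fps" where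
  "symbolic_weight k n \<beta> i j = t_power (weight_exponent k n \<beta> i j) *
     Abs_fps (\<lambda>p. var_poly (prod_encode (i, prod_encode (j, p))))"

lemma symbolic_weight_eval:
  "map_fps (eval_cpoly udom_const x) (symbolic_weight k n \<beta> i j) =
    t_power (weight_exponent k n \<beta> i j) * Abs_fps (\<lambda>p. x (prod_encode (i, prod_encode (j, p))))"
proof -
  note hom = comm_ring_hom_eval[OF comm_ring_hom_udom, of x]
  interpret comm_ring_hom "map_fps (eval_cpoly udom_const x)" by (rule comm_ring_hom_map_fps[OF hom])
  have "map_fps (eval_cpoly udom_const x) (Abs_fps (\<lambda>p. var_poly (prod_encode (i, prod_encode (j, p))))) =
      Abs_fps (\<lambda>p. x (prod_encode (i, prod_encode (j, p))))"
    by (rule fps_ext) (simp add: eval_cpoly_var[OF comm_ring_hom_udom])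
  then show ?thesis unfolding symbolic_weight_def hom_mult map_fps_t_power[OF hom] by simp
qed

lemma minor_symbolic_weight:
  assumes "\<And>l. l < k \<Longrightarrow> f l < n"
  shows "minor k (entries (net_arc_matrix k n (\<lambda>i j. map_fps (eval_cpoly udom_const x) (symbolic_weight k n \<beta> i j)))) f =
    map_fps (eval_cpoly udom_const x) (minor k (entries (net_arc_matrix k n (symbolic_weight k n \<beta>))) f)"
proof -
  have hom: "comm_ring_hom (map_fps (eval_cpoly udom_const x))"
    by (rule comm_ring_hom_map_fps[OF comm_ring_hom_eval[OF comm_ring_hom_udom]])
  show ?thesis unfolding minor_hom[OF hom, symmetric]
    by (rule minor_cong_entries[of n]) (use net_arc_matrix_hom[OF hom] assms in auto)
qed

lemma net_arc_matrix_carrier: "net_arc_matrix k n w \<in> carrier_mat k n"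
  unfolding net_arc_matrix_def by simp

lemma pluecker_order_minor:
  "I \<in> col_sets k n \<Longrightarrow>
    pluecker_order k n \<beta> I = t_order (minor k (entries (net_arc_matrix k n (generic_weight k n \<beta>))) (pick I))"
  unfolding pluecker_order_def by (simp add: det_submatrix[OF net_arc_matrix_carrier])

text \<open>The coefficients of a generic minor are evaluations of polynomials at independent variables, so
  when one of them vanishes, it does so after every specialization of the weights.\<close>
lemma pluecker_order_le_specialization:
  fixes w :: "nat \<Rightarrow> nat \<Rightarrow> udom fps"
  assumes I: "I \<in> col_sets k n" and w: "\<And>i j. t_power (weight_exponent k n \<beta> i j) dvd w i j"
  shows "pluecker_order k n \<beta> I \<le> t_order (minor k (entries (net_arc_matrix k n w)) (pick I))"
proof -
  let ?P = "minor k (entries (net_arc_matrix k n (symbolic_weight k n \<beta>))) (pick I)"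
  have f: "pick I l < n" if "l < k" for l using pick_less[OF I] that by simp
  note M = minor_symbolic_weight[of k "pick I" n, OF f]
  have "\<forall>i j. \<exists>s. w i j = t_power (weight_exponent k n \<beta> i j) * s" using w unfolding dvd_def by blast
  then obtain s where s: "\<And>i j. w i j = t_power (weight_exponent k n \<beta> i j) * s i j" by metis
  define x where "x m = (case prod_decode m of (i, m') \<Rightarrow> case prod_decode m' of (j, p) \<Rightarrow> fps_nth (s i j) p)" for m
  have "Abs_fps (\<lambda>p. x (prod_encode (i, prod_encode (j, p)))) = s i j" for i j
    by (rule fps_ext) (simp add: x_def)
  then have "w = (\<lambda>i j. map_fps (eval_cpoly udom_const x) (symbolic_weight k n \<beta> i j))"
    by (intro ext) (simp add: symbolic_weight_eval s)
  then have w1: "minor k (entries (net_arc_matrix k n w)) (pick I) = map_fps (eval_cpoly udom_const x) ?P"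
    using M[of x \<beta>] by simp
  have "generic_weight k n \<beta> = (\<lambda>i j. map_fps (eval_cpoly udom_const udom_var) (symbolic_weight k n \<beta> i j))"
    by (intro ext) (simp add: symbolic_weight_eval generic_weight_def generic_series_def)
  then have g1: "minor k (entries (net_arc_matrix k n (generic_weight k n \<beta>))) (pick I) =
      map_fps (eval_cpoly udom_const udom_var) ?P"
    using M[of udom_var \<beta>] by simp
  let ?e = "pluecker_order k n \<beta> I"
  have "t_power ?e dvd map_fps (eval_cpoly udom_const udom_var) ?P"
    unfolding t_power_dvd_iff pluecker_order_minor[OF I] g1 by simp
  then have "fps_nth ?P p = 0" if "enat p < ?e" for p
    using that eval_udom_var_eq_0 unfolding t_power_dvd_iff_nth by auto
  then have "t_power ?e dvd map_fps (eval_cpoly udom_const x) ?P"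
    unfolding t_power_dvd_iff_nth by simp
  then show ?thesis unfolding w1 t_power_dvd_iff .
qed

section \<open>Networks with a given invariant factor profile\<close>

lemma weight_exponent_reverse:
  assumes "i < k" "j < n - k"
  shows "weight_exponent k n \<beta> (k - i) (n - k - j) =
    (if i = j then rev_profile k n \<beta> i (Suc j)
     else if i < j then rev_profile k n \<beta> i (Suc j) - rev_profile k n \<beta> i j
     else rev_profile k n \<beta> i (Suc j) - rev_profile k n \<beta> (i - 1) (Suc j))"
proof -
  have "k - (k - i) = i" "n - k - (n - k - j) = j" using assms by auto
  moreover have "n - k - j + 1 = n - k - (j - 1)" if "0 < j" using assms that by auto
  moreover have "k - i + 1 = k - (i - 1)" if "0 < i" using assms that by auto
  ultimately show ?thesis unfolding weight_exponent_def rev_profile_def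
    by (cases j; cases "i = j"; cases "i < j") auto
qed

text \<open>Stated as a sum, so that a weight is free where both entries are infinite; a difference
  would force it to be 0, as \<infinity> - \<infinity> is \<infinity>.\<close>

definition has_profile :: "nat \<Rightarrow> nat \<Rightarrow> (nat \<Rightarrow> nat \<Rightarrow> enat) \<Rightarrow> (nat \<Rightarrow> nat \<Rightarrow> 'a::comm_ring_1 fps) \<Rightarrow> bool" where
  "has_profile k n \<beta> \<rho> \<longleftrightarrow> (\<forall>i<k. \<forall>j<n - k. t_order (\<rho> i j) + rev_profile k n \<beta> i j = rev_profile k n \<beta> i (Suc j))"

lemma has_profileD:
  "has_profile k n \<beta> \<rho> \<Longrightarrow> i < k \<Longrightarrow> j < n - k \<Longrightarrow> t_order (\<rho> i j) + rev_profile k n \<beta> i j = rev_profile k n \<beta> i (Suc j)"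
  unfolding has_profile_def by simp

lemma has_profile_prod:
  fixes \<rho> :: "nat \<Rightarrow> nat \<Rightarrow> 'a::idom fps"
  assumes "has_profile k n \<beta> \<rho>" "i < k"
  shows "j \<le> n - k \<Longrightarrow> t_order (\<Prod>l<j. \<rho> i l) = rev_profile k n \<beta> i j"
proof (induction j)
  case (Suc j)
  then show ?case using has_profileD[OF assms, of j] by (simp add: t_order_mult add.commute)
qed simp

text \<open>Undoes the rescaling: vertical weights are quotients of the products \<open>h\<close> in
  adjacent rows. An infinite entry has an infinite weight exponent, so the weight has to be 0. The
  last hypothesis ensures this for horizontal edges, the choice of \<open>y\<close> for vertical
  ones.\<close>

lemma essential_weighting_exists:
  fixes \<rho> :: "nat \<Rightarrow> nat \<Rightarrow> 'a::field fps"
  assumes \<beta>: "plane_partition k n \<beta>" and kn: "k \<le> n" and \<rho>: "has_profile k n \<beta> \<rho>"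
    and \<rho>_0: "\<And>i j. i < k \<Longrightarrow> j < n - k \<Longrightarrow> rev_profile k n \<beta> i (Suc j) = \<infinity> \<Longrightarrow> \<rho> i j = 0"
  shows "\<exists>w. (\<forall>i j. t_power (weight_exponent k n \<beta> i j) dvd w i j) \<and>
    (\<forall>c<n. \<forall>r<k. entries (net_arc_matrix k n w) c (k - Suc r) = netcol k (n - k) \<rho> c r)"
proof -
  let ?q = "n - k" and ?B = "rev_profile k n \<beta>"
  define h where "h i j = (\<Prod>l<Suc j. \<rho> i l)" for i j
  have h: "t_order (h i j) = ?B i (Suc j)" if "i < k" "j < ?q" for i j
    unfolding h_def by (rule has_profile_prod[OF \<rho>]) (use that in auto)
  have "\<exists>x. h (Suc i) j = h i j * x \<and> (h (Suc i) j = 0 \<longrightarrow> x = 0)" if "Suc i < k" "j < ?q" for i j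
  proof (cases "h (Suc i) j = 0")
    case False
    have "h i j dvd h (Suc i) j"
      unfolding dvd_iff_t_order using h that rev_profile_rows[OF \<beta>, of i "Suc j"] by simp
    then show ?thesis using False by (auto elim: dvdE)
  qed simp
  then have "\<forall>i j. \<exists>x. Suc i < k \<and> j < ?q \<longrightarrow> h (Suc i) j = h i j * x \<and> (h (Suc i) j = 0 \<longrightarrow> x = 0)" by blast
  then obtain y where y: "\<And>i j. Suc i < k \<Longrightarrow> j < ?q \<Longrightarrow> h (Suc i) j = h i j * y i j \<and> (h (Suc i) j = 0 \<longrightarrow> y i j = 0)"
    by metis
  define w' where "w' i j = (if i = j then h j j else if i < j then \<rho> i j else y (i - 1) j)" for i j
  define w where "w i j = (if 1 \<le> i \<and> i \<le> k \<and> 1 \<le> j \<and> j \<le> ?q then w' (k - i) (?q - j) else 0)" for i j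
  have ww: "w (k - i) (?q - j) = w' i j" if "i < k" "j < ?q" for i j
    using that by (auto simp: w_def)
  have diff: "z - y' \<le> x" if "x + y' = z" "z = \<infinity> \<Longrightarrow> x = \<infinity>" for x y' z :: enat
    using that by (cases x; cases y'; cases z) auto
  have dvd': "t_power (weight_exponent k n \<beta> (k - i) (?q - j)) dvd w' i j" if ij: "i < k" "j < ?q" for i j
  proof -
    consider "i = j" | "i < j" | i' where "i = Suc i'" "j \<le> i'" by (cases i) (auto, linarith)
    then have "weight_exponent k n \<beta> (k - i) (?q - j) \<le> t_order (w' i j)"
    proof cases
      case 1
      then show ?thesis using h[OF ij] unfolding weight_exponent_reverse[OF ij] w'_def by simp
    next
      case 2
      have "weight_exponent k n \<beta> (k - i) (?q - j) = ?B i (Suc j) - ?B i j"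
        using 2 weight_exponent_reverse[OF ij, of \<beta>] by simp
      then show ?thesis using diff[OF has_profileD[OF \<rho> ij]] \<rho>_0[OF ij] 2 by (simp add: w'_def)
    next
      case 3
      have e: "weight_exponent k n \<beta> (k - i) (?q - j) = ?B i (Suc j) - ?B i' (Suc j)"
          using 3 weight_exponent_reverse[OF ij, of \<beta>] by simp
      have "h i j = h i' j * y i' j \<and> (h i j = 0 \<longrightarrow> y i' j = 0)" using y[of i' j] ij 3 by simp
      moreover have "t_order (h i j) = ?B i (Suc j)" "t_order (h i' j) = ?B i' (Suc j)" using h ij 3 by auto
      moreover have "w' i j = y i' j" using 3 by (simp add: w'_def)
      ultimately show ?thesis unfolding e
        using diff[of "t_order (y i' j)" "?B i' (Suc j)" "?B i (Suc j)"] t_order_mult[of "y i' j" "h i' j"]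
        by (metis mult.commute t_order_eq_infinity)
    qed
    then show ?thesis by (simp add: t_power_dvd_iff)
  qed
  have dvd: "t_power (weight_exponent k n \<beta> i j) dvd w i j" for i j
  proof (cases "1 \<le> i \<and> i \<le> k \<and> 1 \<le> j \<and> j \<le> ?q")
    case True
    then have "k - (k - i) = i" "?q - (?q - j) = j" "k - i < k" "?q - j < ?q" by auto
    then show ?thesis using dvd'[of "k - i" "?q - j"] True by (simp add: w_def)
  next
    case False
    then have "w i j = 0" unfolding w_def by argo
    then show ?thesis by simp
  qed
  have "entries (net_arc_matrix k n w) c (k - Suc r) = netcol k ?q \<rho> c r" if "c < n" "r < k" for c r
  proof (rule net_arc_matrix_netcol[where h = h, OF kn _ _ _ _ _ that])
    fix j assume "j < k" "j < ?q"
    then show "h j j = w (k - j) (?q - j)" using ww[of j j] by (simp add: w'_def)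
  next
    fix i j assume "j \<le> i" "Suc i < k" "j < ?q"
    then show "h (Suc i) j = h i j * w (k - Suc i) (?q - j)" using y[of i j] ww[of "Suc i" j] by (simp add: w'_def)
  next
    fix i j assume "i < k" "i < j" "j < ?q"
    then show "\<rho> i j = w (k - i) (?q - j)" using ww[of i j] by (simp add: w'_def)
  qed (simp_all add: h_def mult.commute)
  then show ?thesis using dvd by blast
qed

text \<open>The converse rescaling: for \<open>0 < j \<le> i\<close> the horizontal weights are
  quotients of vertical products \<open>h\<close> in adjacent columns, which exist because \<beta>
  is monotone.\<close>

lemma rescaled_network_exists:
  fixes w :: "nat \<Rightarrow> nat \<Rightarrow> 'a::field fps"
  assumes \<beta>: "plane_partition k n \<beta>" and kn: "k \<le> n"
    and w: "\<And>i j. t_order (w i j) = weight_exponent k n \<beta> i j"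
  shows "\<exists>\<rho>. has_profile k n \<beta> \<rho> \<and>
    (\<forall>c<n. \<forall>r<k. entries (net_arc_matrix k n w) c (k - Suc r) = netcol k (n - k) \<rho> c r)"
proof -
  let ?q = "n - k" and ?B = "rev_profile k n \<beta>"
  define w' where "w' i j = w (k - i) (?q - j)" for i j
  have wo: "t_order (w' i j) = (if i = j then ?B i (Suc j) else if i < j then ?B i (Suc j) - ?B i j
     else ?B i (Suc j) - ?B (i - 1) (Suc j))" if "i < k" "j < ?q" for i j
    unfolding w'_def w by (rule weight_exponent_reverse[OF that])
  define h where "h i j = (\<Prod>l\<in>{j..i}. w' l j)" for i j
  have hS: "h (Suc i) j = h i j * w' (Suc i) j" if "j \<le> i" for i j
    using that by (simp add: h_def mult.commute)
  have h: "t_order (h i j) = ?B i (Suc j)" if "j \<le> i" "i < k" "j < ?q" for i j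
    using that
  proof (induction i rule: dec_induct)
    case base
    then show ?case using wo[of j j] by (simp add: h_def)
  next
    case (step i)
    have "t_order (w' (Suc i) j) = ?B (Suc i) (Suc j) - ?B i (Suc j)"
      using step wo[of "Suc i" j] by simp
    moreover have "?B i (Suc j) \<le> ?B (Suc i) (Suc j)"
      by (rule rev_profile_rows[OF \<beta>]) (use step in auto)
    note enat_diff_add[OF this]
    moreover have "t_order (h (Suc i) j) = t_order (w' (Suc i) j) + t_order (h i j)"
      using hS[of j i] step by (simp add: t_order_mult add.commute)
    ultimately show ?case using step by simp
  qed
  have "\<exists>x. h i (Suc j) = x * h i j" if "Suc j \<le> i" "i < k" "Suc j < ?q" for i j
  proof -
    have "h i j dvd h i (Suc j)"
      unfolding dvd_iff_t_order using h that rev_profile_columns[OF \<beta>, of i "Suc j"] by simp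
    then show ?thesis by (auto elim!: dvdE simp: mult.commute)
  qed
  then have "\<forall>i j. \<exists>x. Suc j \<le> i \<and> i < k \<and> Suc j < ?q \<longrightarrow> h i (Suc j) = x * h i j" by blast
  then obtain y where y: "\<And>i j. Suc j \<le> i \<Longrightarrow> i < k \<Longrightarrow> Suc j < ?q \<Longrightarrow> h i (Suc j) = y i j * h i j" by metis
  define \<rho> where "\<rho> i j = (if i < j then w' i j else case j of 0 \<Rightarrow> h i 0 | Suc j' \<Rightarrow> y i j')" for i j
  have "t_order (\<rho> i j) + ?B i j = ?B i (Suc j)" if ij: "i < k" "j < ?q" for i j
  proof (cases "i < j")
    case True
    then have "t_order (\<rho> i j) = ?B i (Suc j) - ?B i j"
      using wo[OF ij] by (simp add: \<rho>_def)
    then show ?thesis using rev_profile_columns[OF \<beta> ij] by (simp add: enat_diff_add)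
  next
    case False
    show ?thesis
    proof (cases j)
      case 0
      then show ?thesis using h[of 0 i] ij by (simp add: \<rho>_def)
    next
      case (Suc j')
      then have "t_order (h i j) = t_order (\<rho> i j) + t_order (h i j')"
        using y[of j' i] False ij by (simp add: \<rho>_def t_order_mult)
      then show ?thesis using h[of j i] h[of j' i] ij False Suc by simp
    qed
  qed
  then have "has_profile k n \<beta> \<rho>" unfolding has_profile_def by blast
  moreover have "entries (net_arc_matrix k n w) c (k - Suc r) = netcol k ?q \<rho> c r" if "c < n" "r < k" for c r
  proof (rule net_arc_matrix_netcol[where h = h, OF kn _ _ _ _ _ that])
    fix i j assume "i < k" "Suc j \<le> i" "Suc j < ?q"
    then show "\<rho> i (Suc j) * h i j = h i (Suc j)" using y[of j i] by (simp add: \<rho>_def)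
  qed (use hS in \<open>auto simp: h_def \<rho>_def w'_def\<close>)
  ultimately show ?thesis by blast
qed

text \<open>\<open>net_minor_dvd\<close>, with powers of \<open>t\<close> for \<open>d\<close>,
  bounds the family from below. The corner minor attains the bound by repeated use of
  \<open>net_corner_minor\<close>.\<close>

lemma net_class_order:
  fixes \<rho> :: "nat \<Rightarrow> nat \<Rightarrow> 'a::field fps"
  assumes \<beta>: "plane_partition k n \<beta>" and \<rho>: "has_profile k n \<beta> \<rho>" and i: "i \<le> k" and j: "j \<le> n - k"
  shows "(INF f\<in>net_class k (n - k) i j. t_order (minor k (netcol k (n - k) \<rho>) f)) = profile_sum k n \<beta> i j"
proof (rule antisym)
  let ?q = "n - k" and ?B = "rev_profile k n \<beta>"
  let ?d = "\<lambda>i j. t_power (?B i j) :: 'a fps"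
  show "profile_sum k n \<beta> i j \<le> (INF f\<in>net_class k ?q i j. t_order (minor k (netcol k ?q \<rho>) f))"
  proof (rule INF_greatest)
    fix f assume f: "f \<in> net_class k ?q i j"
    have "(\<Prod>r<i. ?d r (j + 1 + r - i)) dvd cdet k (\<lambda>l. netcol k ?q \<rho> (f l))"
    proof (rule net_minor_dvd[where d = ?d])
      fix i j assume ij: "i < k" "j < ?q"
      show "?d i (Suc j) dvd \<rho> i j * ?d i j"
        unfolding dvd_iff_t_order using has_profileD[OF \<rho> ij] by (simp add: t_order_mult)
      show "?d i j dvd ?d i (Suc j)" by (rule t_power_mono_dvd[OF rev_profile_columns[OF \<beta> ij]])
    qed (use f i j in \<open>auto simp: net_class_def intro!: t_power_mono_dvd rev_profile_rows[OF \<beta>]\<close>)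
    then have "t_power (profile_sum k n \<beta> i j) dvd minor k (netcol k ?q \<rho>) f"
      unfolding profile_sum_def minor_def by (simp add: t_power_sum)
    then show "profile_sum k n \<beta> i j \<le> t_order (minor k (netcol k ?q \<rho>) f)" unfolding t_power_dvd_iff .
  qed
  have "t_order (minor k (netcol k ?q \<rho>) (corner ?q i j)) = profile_sum k n \<beta> i j"
    using i j
  proof (induction i arbitrary: j)
    case 0
    have "cdet k (\<lambda>l. netcol k ?q \<rho> (corner ?q 0 j l)) = cdet k (\<lambda>l r. if l = r then 1 else 0)"
      by (rule cdet_cong) (auto simp: corner_def netcol_identity)
    then show ?case by (simp add: minor_def profile_sum_0 cdet_identity)
  next
    case (Suc i)
    show ?case
    proof (cases j)
      case 0
      have "cdet k (\<lambda>l. netcol k ?q \<rho> (corner ?q (Suc i) 0 l)) = cdet k (\<lambda>l r. if l = r then 1 else 0)"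
        by (rule cdet_cong) (auto simp: corner_def netcol_identity)
      then show ?thesis using 0 by (simp add: minor_def profile_sum_0 cdet_identity)
    next
      case (Suc j')
      have ij: "i < k" "j' < ?q" using Suc.prems Suc by auto
      obtain s :: "'a fps" where s: "s = 1 \<or> s = -1"
        "\<And>a. cdet k (\<lambda>l. a (corner_rot ?q i j' l)) = s * cdet k (\<lambda>l. a (corner ?q i j' l))"
        using corner_rot_sign[OF ij(1), of ?q j'] by (elim exE conjE) auto
      have "minor k (netcol k ?q \<rho>) (corner ?q (Suc i) (Suc j')) =
          (\<Prod>l<Suc j'. \<rho> i l) * (s * minor k (netcol k ?q \<rho>) (corner ?q i j'))"
        unfolding minor_def net_corner_minor[OF ij] ncol_diagonal[OF ij(1)] s(2) ..
      then have "t_order (minor k (netcol k ?q \<rho>) (corner ?q (Suc i) (Suc j'))) =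
          t_order (\<Prod>l<Suc j'. \<rho> i l) + t_order (minor k (netcol k ?q \<rho>) (corner ?q i j'))"
        using t_order_sign[OF s(1)] by (simp only: t_order_mult)
      also have "\<dots> = ?B i (Suc j') + profile_sum k n \<beta> i j'"
        using has_profile_prod[OF \<rho> ij(1), of "Suc j'"] Suc.IH[of j'] ij by simp
      finally show ?thesis unfolding Suc profile_sum_step .
    qed
  qed
  moreover have "corner ?q i j \<in> net_class k ?q i j"
  proof -
    have "card {..<i} \<le> card {l. l < k \<and> corner ?q i j l + j < ?q + i}"
      by (rule card_mono) (use i j in \<open>auto simp: corner_def\<close>)
    then show ?thesis using i j by (auto simp: net_class_def corner_def)
  qed
  ultimately show "(INF f\<in>net_class k ?q i j. t_order (minor k (netcol k ?q \<rho>) f)) \<le> profile_sum k n \<beta> i j"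
    by (metis INF_lower)
qed

text \<open>Some entry on the diagonal is infinite and is dominated by the later ones. So an
  infinite \<open>profile_sum\<close> can be subtracted from its diagonal successor without losing
  the invariant factor.\<close>

lemma profile_sum_infinite:
  assumes \<beta>: "plane_partition k n \<beta>"
  shows "i < k \<Longrightarrow> j < n - k \<Longrightarrow> profile_sum k n \<beta> i j = \<infinity> \<Longrightarrow> rev_profile k n \<beta> i (Suc j) = \<infinity>"
proof (induction i arbitrary: j)
  case 0
  then show ?case by (simp add: profile_sum_0)
next
  case (Suc i)
  then obtain j' where j: "j = Suc j'" by (cases j) (auto simp: profile_sum_0)
  have "rev_profile k n \<beta> i (Suc j') = \<infinity>"
    using Suc.prems Suc.IH[of j'] unfolding j profile_sum_step by (auto simp: plus_eq_infty_iff_enat)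
  moreover have "rev_profile k n \<beta> i (Suc j') \<le> rev_profile k n \<beta> (Suc i) j"
    using rev_profile_rows[OF \<beta>, of i j] Suc.prems j by simp
  moreover have "rev_profile k n \<beta> (Suc i) j \<le> rev_profile k n \<beta> (Suc i) (Suc j)"
    using rev_profile_columns[OF \<beta>, of "Suc i" j] Suc.prems by simp
  ultimately show ?case by (metis enat_ord_simps(5) order_trans)
qed

section \<open>The network arc\<close>

lemma udom_var_nonzero: "udom_var m \<noteq> 0"
proof
  assume "udom_var m = 0"
  then have "eval_cpoly udom_const udom_var (var_poly m) = 0" by (simp add: eval_cpoly_var[OF comm_ring_hom_udom])
  then have "(var_poly m :: nat cpoly) = 0" by (rule eval_udom_var_eq_0)
  then show False unfolding var_poly_def by (metis lookup_single_eq lookup_zero zero_neq_one)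
qed

lemma t_order_generic_weight: "t_order (generic_weight k n \<beta> i j) = weight_exponent k n \<beta> i j"
proof -
  have nth: "fps_nth (generic_series i j) 0 \<noteq> 0" unfolding generic_series_def by (simp add: udom_var_nonzero)
  then have "t_order (generic_series i j) = 0"
    by (subst t_order_nonzero) (auto simp: zero_enat_def)
  then show ?thesis unfolding generic_weight_def by (simp add: t_order_mult)
qed

lemma arc_minor_row_span:
  assumes A: "A \<in> carrier_mat k n" and I: "I \<in> col_sets k n" and unit: "t_order (minor k (entries A) (pick I)) = 0"
    and f: "\<And>l. l < k \<Longrightarrow> f l < n"
  shows "row_span A \<in> arcs k n" and "arc_minor k n (row_span A) f = t_order (minor k (entries A) f)"
proof -
  have d: "det (submatrix A UNIV I) dvd 1" unfolding det_submatrix[OF A I] using unit t_order_unit_iff by blast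
  have c: "row_span A \<in> chart k n I" using row_span_in_chart[OF A I d] by simp
  then show "row_span A \<in> arcs k n" unfolding arcs_def by (rule chart_in_grassmannian[OF _ I])
  obtain G where G: "G \<in> carrier_mat k k" "det G dvd 1" "A = G * chart_mat k n I (row_span A)"
    using row_span_in_chart[OF A I d] by blast
  let ?B = "chart_mat k n I (row_span A)"
  have "minor k (entries (G * ?B)) f = det G * minor k (entries ?B) f"
    by (rule minor_mult[OF G(1) chart_mat(1)[OF c I] f])
  then have "t_order (minor k (entries A) f) = t_order (det G) + t_order (minor k (entries ?B) f)"
    using G(3) t_order_mult by metis
  moreover have "t_order (det G) = 0" using G(2) t_order_unit_iff by blast
  moreover have "arc_minor k n (row_span A) f = t_order (minor k (entries ?B) f)" by (rule arc_minor_chart[OF I c f])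
  ultimately show "arc_minor k n (row_span A) f = t_order (minor k (entries A) f)" by simp
qed

lemma pick_last_columns:
  assumes "k \<le> n" "l < k"
  shows "pick {n - k..<n} l = n - k + l"
proof -
  have "{a \<in> {n - k..<n}. a < n - k + l} = {n - k..<n - k + l}" using assms by auto
  then have c: "card {a \<in> {n - k..<n}. a < n - k + l} = l" by simp
  have "n - k + l \<in> {n - k..<n}" using assms by auto
  from pick_card_in_set[OF this] show ?thesis unfolding c .
qed

lemma network_arc:
  assumes \<beta>: "plane_partition k n \<beta>" and kn: "k \<le> n"
  defines "A \<equiv> net_arc_matrix k n (generic_weight k n \<beta>)"
  shows "row_span A \<in> contact_stratum k n \<beta>"
    and "(\<And>l. l < k \<Longrightarrow> f l < n) \<Longrightarrow> arc_minor k n (row_span A) f = t_order (minor k (entries A) f)"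
proof -
  let ?q = "n - k" and ?I = "{n - k..<n}"
  have A: "A \<in> carrier_mat k n" unfolding A_def by (rule net_arc_matrix_carrier)
  have I: "?I \<in> col_sets k n" using kn by (auto simp: col_sets_def)
  obtain \<rho> where \<rho>: "has_profile k n \<beta> \<rho>"
    "\<And>c r. c < n \<Longrightarrow> r < k \<Longrightarrow> entries A c (k - Suc r) = netcol k ?q \<rho> c r"
    using rescaled_network_exists[OF \<beta> kn t_order_generic_weight] unfolding A_def by blast
  have order: "t_order (minor k (entries A) f) = t_order (minor k (netcol k ?q \<rho>) f)" if "\<And>l. l < k \<Longrightarrow> f l < n" for f
    by (rule minor_reverse_rows_order[of n]) (use \<rho>(2) that in auto)
  have "minor k (netcol k ?q \<rho>) (pick ?I) = cdet k (\<lambda>l r. if l = r then 1 else 0)"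
    unfolding minor_def by (rule cdet_cong) (auto simp: pick_last_columns[OF kn] netcol_identity)
  then have unit: "t_order (minor k (entries A) (pick ?I)) = 0"
    using order[of "pick ?I"] pick_less[OF I] by (simp add: cdet_identity)
  note arc = arc_minor_row_span[OF A I unit]
  show "arc_minor k n (row_span A) f = t_order (minor k (entries A) f)" if "\<And>l. l < k \<Longrightarrow> f l < n" for f
    by (rule arc(2)) (rule that)
  have \<Lambda>: "row_span A \<in> arcs k n" by (rule arc(1)[of "pick ?I"]) (use pick_less[OF I] in simp)
  have co: "class_order k n (row_span A) i j = profile_sum k n \<beta> i j" if "i \<le> k" "j \<le> ?q" for i j
    unfolding net_class_order[OF \<beta> \<rho>(1) that, symmetric] class_order_def
  proof (rule INF_cong[OF refl])
    fix f assume "f \<in> net_class k ?q i j"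
    then have f: "f l < n" if "l < k" for l using that kn by (auto simp: net_class_def)
    show "arc_minor k n (row_span A) f = t_order (minor k (netcol k ?q \<rho>) f)"
      using arc(2)[of f] order[of f] f by simp
  qed
  have "invariant_factor_profile k n (row_span A) i j = \<beta> i j" if ij: "i \<in> {1..k}" "j \<in> {1..?q}" for i j
  proof -
    define i' j' where "i' = k - i" and "j' = ?q - j"
    have ij': "i' < k" "j' < ?q" "i = k - i'" "j = ?q - j'" using ij by (auto simp: i'_def j'_def)
    have "invariant_factor_profile k n (row_span A) i j = profile_sum k n \<beta> (Suc i') (Suc j') - profile_sum k n \<beta> i' j'"
      unfolding invariant_factor_profile_def ij'(3,4) rect_order_class_order[OF \<Lambda> kn ij'(1,2)]
        rect_order_class_order'[OF \<Lambda> kn ij'(1,2)] using co[of "Suc i'" "Suc j'"] co[of i' j'] ij' by simp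
    \<comment> \<open>If the subtracted sum is infinite, both sides are infinite.\<close>
    also have "\<dots> = rev_profile k n \<beta> i' (Suc j')"
      using profile_sum_infinite[OF \<beta> ij'(1,2)] unfolding profile_sum_step
      by (cases "profile_sum k n \<beta> i' j'"; cases "rev_profile k n \<beta> i' (Suc j')") auto
    also have "\<dots> = \<beta> i j" unfolding rev_profile_def ij'(3,4) by simp
    finally show ?thesis .
  qed
  then show "row_span A \<in> contact_stratum k n \<beta>" unfolding contact_stratum_def using \<Lambda> by blast
qed

lemma network_arc_pluecker:
  assumes \<beta>: "plane_partition k n \<beta>" and kn: "k \<le> n" and I: "I \<in> col_sets k n"
  shows "arc_minor k n (row_span (net_arc_matrix k n (generic_weight k n \<beta>))) (pick I) = pluecker_order k n \<beta> I"
  unfolding pluecker_order_minor[OF I] by (rule network_arc(2)[OF \<beta> kn]) (use pick_less[OF I] in simp)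

section \<open>Generic minors have the smallest order\<close>

lemma finite_profile_sum_bound:
  fixes k q :: nat
  shows "\<exists>M :: nat. \<forall>i\<le>k. \<forall>j\<le>q. P i j \<noteq> (\<infinity>::enat) \<longrightarrow> P i j \<le> enat M"
proof -
  define M where "M = (\<Sum>i\<le>k. \<Sum>j\<le>q. the_enat (P i j))"
  have "P i j \<le> enat M" if "i \<le> k" "j \<le> q" "P i j \<noteq> \<infinity>" for i j
  proof -
    have "the_enat (P i j) \<le> (\<Sum>j\<le>q. the_enat (P i j))"
      using that by (intro member_le_sum) auto
    also have "\<dots> \<le> M" unfolding M_def using that by (intro member_le_sum) auto
    finally show ?thesis using that(3) by (cases "P i j") auto
  qed
  then show ?thesis by blast
qed

text \<open>A dropped weight may itself have small order. What matters is that every path through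
  its edge has order at least \<open>b i (Suc j)\<close> after it, by
  \<open>ncol_dvd\<close>.\<close>

lemma truncate_network:
  assumes b0: "\<And>i. b i 0 = 0" and bi: "\<And>i j. Suc i < k \<Longrightarrow> j \<le> q \<Longrightarrow> b i j \<le> b (Suc i) j"
    and bj: "\<And>i j. i < k \<Longrightarrow> j < q \<Longrightarrow> b i j \<le> b i (Suc j)"
    and \<rho>: "\<And>i j. i < k \<Longrightarrow> j < q \<Longrightarrow> t_order (\<rho> i j :: 'a::field fps) = enat (b i (Suc j) - b i j)"
    and \<rho>': "\<And>i j. i < k \<Longrightarrow> j < q \<Longrightarrow> \<rho>' i j = \<rho> i j \<or> \<rho>' i j = 0 \<and> N \<le> b i (Suc j)"
  shows "j \<le> q \<Longrightarrow> fps_X ^ N dvd ncol k \<rho> j i r - ncol k \<rho>' j i r"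
proof (induction j arbitrary: i)
  case (Suc j)
  let ?d = "\<lambda>i j. fps_X ^ b i j :: 'a fps"
  have "fps_X ^ N dvd (\<Sum>l\<in>{i..<k}. \<rho> l j * ncol k \<rho> j l r - \<rho>' l j * ncol k \<rho>' j l r)"
  proof (rule dvd_sum)
    fix l assume "l \<in> {i..<k}"
    then have l: "l < k" by simp
    have j: "j < q" using Suc.prems by simp
    consider "\<rho>' l j = \<rho> l j" | "\<rho>' l j = 0" "N \<le> b l (Suc j)" using \<rho>'[OF l j] by blast
    then show "fps_X ^ N dvd \<rho> l j * ncol k \<rho> j l r - \<rho>' l j * ncol k \<rho>' j l r"
    proof cases
      case 1
      then show ?thesis using Suc.IH[of l] j by (simp add: right_diff_distrib[symmetric] dvd_mult)
    next
      case 2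
      have d: "?d i (Suc j) dvd \<rho> i j * ?d i j" if "i < k" "j < q" for i j
      proof -
        have "t_power (enat (b i (Suc j) - b i j)) dvd \<rho> i j" unfolding t_power_dvd_iff using \<rho>[OF that] by simp
        then have "fps_X ^ (b i (Suc j) - b i j) * ?d i j dvd \<rho> i j * ?d i j"
          by (intro mult_dvd_mono) (simp_all add: t_power_enat)
        then show ?thesis using bj[OF that] by (simp add: power_add[symmetric])
      qed
      have "?d l j dvd ncol k \<rho> j l r"
        by (rule ncol_dvd[where d = ?d and q = q])
           (use b0 bi d l j in \<open>auto intro!: le_imp_power_dvd\<close>)
      then have "\<rho> l j * ?d l j dvd \<rho> l j * ncol k \<rho> j l r" by (rule mult_dvd_mono[OF dvd_refl])
      then have "?d l (Suc j) dvd \<rho> l j * ncol k \<rho> j l r" by (rule dvd_trans[OF d[OF l j]])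
      moreover have "fps_X ^ N dvd ?d l (Suc j)" using 2 by (intro le_imp_power_dvd)
      ultimately show ?thesis using 2 dvd_trans by auto
    qed
  qed
  then show ?case by (simp add: sum_subtractf)
qed simp

text \<open>An approximating network has finite orders throughout, even where \<beta> is infinite.
  Cutting these weights to 0 gives a network with profile exactly \<beta> and the same columns
  modulo \<open>t^N\<close>, to which the specialization argument applies.\<close>

lemma pluecker_order_le:
  assumes \<beta>: "plane_partition k n \<beta>" and kn: "k \<le> n" and \<Lambda>: "\<Lambda> \<in> contact_stratum k n \<beta>" and I: "I \<in> col_sets k n"
  shows "pluecker_order k n \<beta> I \<le> arc_minor k n \<Lambda> (pick I)"
proof -
  let ?q = "n - k" and ?B = "rev_profile k n \<beta>" and ?P = "profile_sum k n \<beta>"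
  have arc: "\<Lambda> \<in> arcs k n" using \<Lambda> unfolding contact_stratum_def by simp
  obtain J where J: "J \<in> col_sets k n" "\<Lambda> \<in> chart k n J"
    using grassmannian_in_chart arc unfolding arcs_def by blast
  note AJ = chart_mat[OF J(2,1)]
  define a where "a = entries (chart_mat k n J \<Lambda>)"
  have am: "arc_minor k n \<Lambda> f = t_order (minor k a f)" if "\<And>l. l < k \<Longrightarrow> f l < n" for f
    unfolding a_def by (rule arc_minor_chart[OF J that])
  have qk: "?q + k = n" using kn by simp
  have "minor k a (restrict (pick J) {..<k}) = 1" unfolding a_def minor_restrict by (rule minor_chart[OF AJ(1) J(1) AJ(2)])
  then have unit: "\<exists>f\<in>selections k (?q + k). t_order (minor k a f) = 0"
    unfolding qk by (intro bexI[of _ "restrict (pick J) {..<k}"]) (simp_all add: pick_selection[OF J(1)])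
  have co: "(INF f\<in>net_class k ?q i j. t_order (minor k a f)) = ?P i j" if "i \<le> k" "j \<le> ?q" for i j
    unfolding class_order_stratum[OF \<Lambda> kn that, symmetric] class_order_def
  proof (rule INF_cong[OF refl])
    fix f assume "f \<in> net_class k ?q i j"
    then have f: "f l < n" if "l < k" for l using that kn by (auto simp: net_class_def)
    show "t_order (minor k a f) = arc_minor k n \<Lambda> f" using am[OF f] by simp
  qed
  obtain M :: nat where M: "\<And>i j. i \<le> k \<Longrightarrow> j \<le> ?q \<Longrightarrow> ?P i j \<noteq> \<infinity> \<Longrightarrow> ?P i j \<le> enat M"
    using finite_profile_sum_bound[of k ?q ?P] by blast
  have f: "pick I l < n" if "l < k" for l using pick_less[OF I] that by simp
  have bound: "min (enat N) (pluecker_order k n \<beta> I) \<le> arc_minor k n \<Lambda> (pick I)" for N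
  proof -
    \<comment> \<open>\<open>M\<close> bounds all finite orders of families. The surplus
      \<open>M\<close> lets these be read off exactly and leaves at least \<open>N\<close> for a
      step from a finite to an infinite order.\<close>
    let ?N = "Suc (N + M)"
    have "0 < ?N" by simp
    from network_approximation[OF udom_infinite unit this]
    obtain \<rho> :: "nat \<Rightarrow> nat \<Rightarrow> udom fps" and b where b0: "\<forall>i. b i 0 = 0" and bi: "\<forall>i j. Suc i < k \<longrightarrow> j \<le> ?q \<longrightarrow> b i j \<le> b (Suc i) j"
      and bj: "\<forall>i j. i < k \<longrightarrow> j < ?q \<longrightarrow> b i j \<le> b i (Suc j)"
      and \<rho>: "\<forall>i j. i < k \<longrightarrow> j < ?q \<longrightarrow> t_order (\<rho> i j) = enat (b i (Suc j) - b i j)"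
      and ord: "\<forall>f\<in>selections k (?q + k). min (enat ?N) (t_order (minor k (netcol k ?q \<rho>) f)) \<le> t_order (minor k a f)"
      and low: "\<forall>i j e. i \<le> k \<longrightarrow> j \<le> ?q \<longrightarrow> (\<forall>f\<in>net_class k ?q i j. e \<le> t_order (minor k a f)) \<longrightarrow>
        min (enat ?N) e \<le> enat (\<Sum>r<i. b r (j + 1 + r - i))"
      and up: "\<forall>i j. \<forall>f\<in>net_class k ?q i j. i \<le> k \<longrightarrow> j \<le> ?q \<longrightarrow> t_order (minor k a f) < enat ?N \<longrightarrow>
        enat (\<Sum>r<i. b r (j + 1 + r - i)) \<le> t_order (minor k a f)"
      by (elim exE conjE)
    note b0 = b0[rule_format] and bi = bi[rule_format] and bj = bj[rule_format] and \<rho> = \<rho>[rule_format]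
      and ord = ord[rule_format] and up = up[rule_format]
    define S where "S i j = (\<Sum>r<i. b r (j + 1 + r - i))" for i j
    have S_step: "S (Suc i) (Suc j) = b i (Suc j) + S i j" for i j unfolding S_def by simp
    have S_low: "min (enat ?N) (?P i j) \<le> enat (S i j)" if "i \<le> k" "j \<le> ?q" for i j
      unfolding S_def co[OF that, symmetric]
      by (rule low[rule_format]) (use that in \<open>auto intro: INF_lower\<close>)
    have S_fin: "?P i j = enat (S i j)" if ij: "i \<le> k" "j \<le> ?q" and fin: "?P i j \<noteq> \<infinity>" for i j
    proof -
      let ?T = "(\<lambda>f. t_order (minor k a f)) ` net_class k ?q i j"
      have lt: "?P i j < enat ?N" using M[OF ij fin] by (rule le_less_trans) simp
      have "?T \<noteq> {}" using fin co[OF ij] by (auto simp: top_enat_def)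
      then have "Inf ?T \<in> ?T" unfolding Inf_enat_def by (simp, metis (no_types, lifting) LeastI_ex ex_in_conv)
      then obtain f where f: "f \<in> net_class k ?q i j" "?P i j = t_order (minor k a f)" using co[OF ij] by auto
      have "enat (S i j) \<le> ?P i j" unfolding f(2) S_def by (rule up[OF f(1) ij]) (use lt f(2) in simp)
      moreover have "?P i j \<le> enat (S i j)" using S_low[OF ij] lt by (simp add: min_def split: if_splits)
      ultimately show ?thesis by simp
    qed
    \<comment> \<open>Where the order of the family first becomes infinite on a diagonal, the sum is
      at least \<open>?N\<close> and the part before it at most \<open>M\<close>. After that the
      bound is inherited by monotonicity of \<open>b\<close>.\<close>
    have b_inf: "N \<le> b i (Suc j)" if "i < k" "j < ?q" "?P (Suc i) (Suc j) = \<infinity>" for i j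
      using that
    proof (induction i arbitrary: j)
      case (0 j)
      have "enat ?N \<le> enat (S (Suc 0) (Suc j))" using S_low[of "Suc 0" "Suc j"] 0 by simp
      then show ?case unfolding S_step by (simp add: S_def)
    next
      case (Suc i)
      show ?case
      proof (cases "?P (Suc i) j = \<infinity>")
        case True
        then obtain j' where j: "j = Suc j'" by (cases j) (auto simp: profile_sum_0)
        have "N \<le> b i j" using Suc.IH[of j'] Suc.prems True j by simp
        also have "\<dots> \<le> b (Suc i) j" using bi[of i j] Suc.prems by simp
        also have "\<dots> \<le> b (Suc i) (Suc j)" using bj[of "Suc i" j] Suc.prems by simp
        finally show ?thesis .
      next
        case False
        have "enat ?N \<le> enat (S (Suc (Suc i)) (Suc j))" using S_low[of "Suc (Suc i)" "Suc j"] Suc.prems by simp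
        moreover have "enat (S (Suc i) j) \<le> enat M" using S_fin[of "Suc i" j] M[of "Suc i" j] False Suc.prems by simp
        ultimately show ?thesis unfolding S_step by simp
      qed
    qed
    have b_fin: "?B i (Suc j) = enat (b i (Suc j))" if ij: "i < k" "j < ?q" "?B i (Suc j) \<noteq> \<infinity>" for i j
    proof -
      have "?P i j \<noteq> \<infinity>" using profile_sum_infinite[OF \<beta> ij(1,2)] ij(3) by blast
      moreover from this have "?P (Suc i) (Suc j) \<noteq> \<infinity>" unfolding profile_sum_step using ij(3)
        by (simp add: plus_eq_infty_iff_enat)
      ultimately have "?P (Suc i) (Suc j) = enat (S (Suc i) (Suc j))" "?P i j = enat (S i j)"
        using S_fin[of "Suc i" "Suc j"] S_fin[of i j] ij by auto
      then show ?thesis unfolding profile_sum_step S_step using ij(3) by (cases "?B i (Suc j)") auto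
    qed
    define \<rho>' where "\<rho>' i j = (if ?B i (Suc j) = \<infinity> then 0 else \<rho> i j)" for i j
    have hp: "has_profile k n \<beta> \<rho>'" unfolding has_profile_def
    proof (intro allI impI)
      fix i j assume ij: "i < k" "j < ?q"
      show "t_order (\<rho>' i j) + ?B i j = ?B i (Suc j)"
      proof (cases "?B i (Suc j) = \<infinity>")
        case False
        have le: "?B i j \<le> ?B i (Suc j)" by (rule rev_profile_columns[OF \<beta> ij])
        have "?B i j = enat (b i j)"
        proof (cases j)
          case 0
          then show ?thesis by (simp add: b0 zero_enat_def)
        next
          case (Suc j')
          have "?B i j \<noteq> \<infinity>" using False le by (metis enat_ord_simps(5))
          then show ?thesis using b_fin[of i j'] ij Suc by simp
        qed
        then show ?thesis using False b_fin[OF ij False] \<rho>[OF ij] bj[OF ij] by (simp add: \<rho>'_def)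
      qed (simp add: \<rho>'_def)
    qed
    have "\<exists>w. (\<forall>i j. t_power (weight_exponent k n \<beta> i j) dvd w i j) \<and>
      (\<forall>c<n. \<forall>r<k. entries (net_arc_matrix k n w) c (k - Suc r) = netcol k ?q \<rho>' c r)"
      by (rule essential_weighting_exists[OF \<beta> kn hp]) (simp add: \<rho>'_def)
    then obtain w where w: "\<forall>i j. t_power (weight_exponent k n \<beta> i j) dvd w i j"
      "\<forall>c<n. \<forall>r<k. entries (net_arc_matrix k n w) c (k - Suc r) = netcol k ?q \<rho>' c r"
      by (elim exE conjE)
    have "pluecker_order k n \<beta> I \<le> t_order (minor k (entries (net_arc_matrix k n w)) (pick I))"
      by (rule pluecker_order_le_specialization[OF I w(1)[rule_format]])
    also have "\<dots> = t_order (minor k (netcol k ?q \<rho>') (pick I))"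
      by (rule minor_reverse_rows_order[of n]) (use w(2) f in auto)
    finally have 1: "pluecker_order k n \<beta> I \<le> t_order (minor k (netcol k ?q \<rho>') (pick I))" .
    have "fps_X ^ N dvd netcol k ?q \<rho>' c r - netcol k ?q \<rho> c r" for c r
    proof -
      have "fps_X ^ N dvd ncol k \<rho> (?q - c) (c - ?q) r - ncol k \<rho>' (?q - c) (c - ?q) r"
      proof (rule truncate_network[where q = ?q and b = b])
        fix i j assume ij: "i < k" "j < ?q"
        show "\<rho>' i j = \<rho> i j \<or> \<rho>' i j = 0 \<and> N \<le> b i (Suc j)"
          using b_inf[OF ij] unfolding \<rho>'_def profile_sum_step by auto
      qed (use b0 bi bj \<rho> in auto)
      then show ?thesis unfolding netcol_def by (metis dvd_minus_iff minus_diff_eq)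
    qed
    then have "t_power (enat N) dvd minor k (netcol k ?q \<rho>') (pick I) - minor k (netcol k ?q \<rho>) (pick I)"
      unfolding minor_def t_power_enat by (intro cdet_dvd_diff)
    from t_order_min_diff[OF this]
    have 2: "min (enat N) (t_order (minor k (netcol k ?q \<rho>') (pick I))) \<le> t_order (minor k (netcol k ?q \<rho>) (pick I))" .
    have 3: "min (enat ?N) (t_order (minor k (netcol k ?q \<rho>) (pick I))) \<le> t_order (minor k a (pick I))"
      using ord[of "restrict (pick I) {..<k}"] pick_selection[OF I] unfolding qk minor_restrict by simp
    have "min (enat N) (pluecker_order k n \<beta> I) \<le> min (enat N) (t_order (minor k (netcol k ?q \<rho>') (pick I)))"
      using 1 by (rule min.mono[OF order_refl])
    also have "\<dots> \<le> min (enat ?N) (t_order (minor k (netcol k ?q \<rho>) (pick I)))"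
      using 2 by (auto intro: min.coboundedI1)
    also have "\<dots> \<le> arc_minor k n \<Lambda> (pick I)" using 3 am[OF f] by simp
    finally show ?thesis .
  qed
  show ?thesis
  proof (rule ccontr)
    assume "\<not> ?thesis"
    then obtain d where d: "arc_minor k n \<Lambda> (pick I) = enat d" "enat d < pluecker_order k n \<beta> I"
      by (cases "arc_minor k n \<Lambda> (pick I)") auto
    then have "enat d < min (enat (Suc d)) (pluecker_order k n \<beta> I)" by simp
    also have "\<dots> \<le> enat d" using bound[of "Suc d"] d(1) by simp
    finally show False by simp
  qed
qed

theorem lemma8p3:
  fixes k n :: nat and \<beta> \<beta>' :: "nat \<Rightarrow> nat \<Rightarrow> enat"
  assumes "0 < k" and "k < n"
    and "plane_partition k n \<beta>" and "plane_partition k n \<beta>'"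
  shows "(zariski_closure k n (contact_stratum k n \<beta>) \<supseteq> zariski_closure k n (contact_stratum k n \<beta>')
            \<longrightarrow> pluecker_le k n \<beta> \<beta>') \<and>
         (\<forall>\<Lambda> \<in> contact_stratum k n \<beta>. \<forall>\<Lambda>' \<in> contact_stratum k n \<beta>'.
            zariski_closure k n (contact_stratum k n \<beta>) \<supseteq> zariski_closure k n (contact_stratum k n \<beta>')
            \<longrightarrow> (\<forall>lam. is_partition k n lam
                  \<longrightarrow> contact_profile k n \<Lambda> lam \<le> contact_profile k n \<Lambda>' lam))"
proof (intro conjI impI ballI allI)
  have kn: "k \<le> n" using assms(2) by simp
  assume sub: "zariski_closure k n (contact_stratum k n \<beta>') \<subseteq> zariski_closure k n (contact_stratum k n \<beta>)"
  show "pluecker_le k n \<beta> \<beta>'" unfolding pluecker_le_def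
  proof
    fix I assume I: "I \<in> col_sets k n"
    \<comment> \<open>Only one minor is bounded at a time. On the stratum of \<beta> the generic
      order is a lower bound, and on the network arc of \<beta>' the minor has its generic
      order.\<close>
    define e where "e f = (if f = pick I then pluecker_order k n \<beta> I else 0)" for f
    have "e (pick I) \<le> arc_minor k n (row_span (net_arc_matrix k n (generic_weight k n \<beta>'))) (pick I)"
    proof (rule minor_order_semicontinuous[OF sub _ _ network_arc(1)[OF assms(4) kn]])
      show "contact_stratum k n \<beta> \<subseteq> arcs k n" unfolding contact_stratum_def by auto
      show "e f \<le> arc_minor k n \<Lambda> f" if "\<Lambda> \<in> contact_stratum k n \<beta>" for \<Lambda> f
        using pluecker_order_le[OF assms(3) kn that I] by (simp add: e_def)
    qed (use pick_less[OF I] in simp)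
    then show "pluecker_order k n \<beta> I \<le> pluecker_order k n \<beta>' I"
      using network_arc_pluecker[OF assms(4) kn I] by (simp add: e_def)
  qed
next
  fix \<Lambda> \<Lambda>' lam
  assume "\<Lambda> \<in> contact_stratum k n \<beta>" "\<Lambda>' \<in> contact_stratum k n \<beta>'" "is_partition k n lam"
    "zariski_closure k n (contact_stratum k n \<beta>') \<subseteq> zariski_closure k n (contact_stratum k n \<beta>)"
  then show "contact_profile k n \<Lambda> lam \<le> contact_profile k n \<Lambda>' lam"
    using contact_profile_semicontinuous assms(2) by (metis less_imp_le)
qed

end
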